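(* Let $d\ge 1$ and, for $1\le i\le d$, let $\Omega_i\subsetneq\mathbb{C}$ be a simply connected domain and let $S_i\subset\partial\Omega_i$ be open in the relative topology of $\partial\Omega_i$, such that $\mathbb{C}\setminus(\Omega_i\cup S_i)$ is connected. Put $\Omega=\prod_{i=1}^d\Omega_i$ and $S=\prod_{i=1}^d S_i$. Fix an enumeration $(N_j)_{j\ge 0}$ of $\mathbb{N}^d$ and an infinite subset $\mu$ of $\mathbb{N}=\{0,1,2,\dots\}$. Let $d(\cdot,\cdot)$ denote the metric of $A^\infty(\Omega,S)$. Then there exists a function $f\in A^\infty(\Omega,S)$ with the following property: (P) for all compact sets $K_i\subset\mathbb{C}$ with $\mathbb{C}\setminus K_i$ connected ($1\le i\le d$) such that $K=\prod_{i=1}^d K_i$ is disjoint from $\prod_{i=1}^d(\Omega_i\cup\overline{S_i})$, and every $h\in O(K)$, there exists a strictly increasing sequence $(\lambda_n)$ in $\mu$ such that for every compact set $\widetilde L\subseteq\prod_{i=1}^d(\Omega_i\cup S_i)$ we have, as $n\to+\infty$, $$\sup_{\zeta\in\widetilde L}\rho\left(S_{\lambda_n}(f,\zeta),h\right)\to 0\quad\text{and}\quad\sup_{\zeta\in\widetilde L}d\left(S_{\lambda_n}(f,\zeta),f\right)\to 0,$$ where $\rho$ is the metric of $O(K)$. Furthermore, the set of all $f\in X^\infty(\Omega,S)$ satisfying (P) is a dense $G_\delta$ subset of $X^\infty(\Omega,S)$, and the union of this set with $\{0\}$ contains a vector subspace that is dense in $X^\infty(\Omega,S)$.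
   Context: $A^\infty(\Omega,S)$ is the set of all holomorphic $f:\Omega\to\mathbb{C}$ such that for every differential operator $D$ of mixed partial derivatives in $z=(z_1,\dots,z_d)$ (i.e. $D=\partial^{a_1+\dots+a_d}/\partial z_1^{a_1}\cdots\partial z_d^{a_d}$, $a\in\mathbb{N}^d$), $Df$ extends continuously to $\prod_{i=1}^d(\Omega_i\cup S_i)$ (the extension is again denoted $Df$; the notation $S=\prod S_i$ carries the data of the individual $S_i$). Its topology is given by the seminorms $f\mapsto\sup_{z\in L}|Df(z)|$, where $L$ ranges over compact subsets of $\prod_{i=1}^d(\Omega_i\cup S_i)$ and $D$ over all such operators; "the metric" is a translation-invariant metric inducing this topology. $X^\infty(\Omega,S)$ is the closure of the set of polynomials in $A^\infty(\Omega,S)$. For $K\subset\mathbb{C}^d$ compact, $O(K)$ is the set of functions $h$ that are holomorphic on some open set $U\supseteq K$ ($U$ depending on $h$; an element is understood together with its holomorphic extension near $K$, so that its derivatives on $K$ are defined), with the topology given by the seminorms $h\mapsto\sup_{z\in K}|Dh(z)|$, $D$ ranging over all differential operators of mixed partial derivatives in $z_1,\dots,z_d$; its metric $\rho$ is a translation-invariant metric inducing this topology. For $a=(a_1,\dots,a_d)\in\mathbb{N}^d$, write $(z-\zeta)^a=\prod_i(z_i-\zeta_i)^{a_i}$ and $a(f,\zeta)=\frac{1}{a_1!\cdots a_d!}\frac{\partial^{a_1+\dots+a_d}f}{\partial z_1^{a_1}\cdots\partial z_d^{a_d}}(\zeta)$; if $a=N_j$ this is written $a_{N_j}(f,\zeta)$.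 For $\zeta\in\prod_{i=1}^d(\Omega_i\cup S_i)$ not in $\Omega$, the derivatives at $\zeta$ are the values of the continuous extensions. The partial sums are $S_N(f,\zeta)(z)=\sum_{j=0}^N a_{N_j}(f,\zeta)(z-\zeta)^{N_j}$.
   Formalization: Added assumption: if ℂ∖(Ω_i∪S_i) is bounded, then the union of Ω_i and the closure of S_i is ℂ; without it no f satisfies (P), e.g. d=1, Ω=ℂ∖[0,∞), S=(1,∞), K={0}, by the maximum principle on |z|=2. *)

theory Defs
  imports "HOL-Analysis.Analysis" "HOL-Library.Function_Algebras"
begin

definition cprod :: "('n \<Rightarrow> complex set) \<Rightarrow> (complex ^ 'n) set" where
  "cprod A = {z. \<forall>i. z $ i \<in> A i}"

text \<open>Holomorphy in several variables: complex differentiability, i.e. a complex-linear total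
  derivative, at every point of an open set.\<close>

definition holomorphic_several :: "(complex ^ 'n \<Rightarrow> complex) \<Rightarrow> (complex ^ 'n) set \<Rightarrow> bool" where
  "holomorphic_several f U \<longleftrightarrow> open U \<and>
     (\<forall>z\<in>U. \<exists>f'. (f has_derivative f') (at z) \<and> (\<forall>c v. f' (c *s v) = c * f' v))"

definition partial_deriv :: "'n \<Rightarrow> (complex ^ 'n \<Rightarrow> complex) \<Rightarrow> complex ^ 'n \<Rightarrow> complex" where
  "partial_deriv i f z = deriv (\<lambda>w. f (\<chi> j. if j = i then w else z $ j)) (z $ i)"

text \<open>The index type carries no order, so one listing of the coordinates is fixed; for holomorphic
  functions the partial derivatives commute and the listing is immaterial.\<close>

definition coords :: "'n::finite list" where
  "coords = (SOME xs. distinct xs \<and> set xs = UNIV)"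

definition mixed_deriv :: "nat ^ 'n \<Rightarrow> (complex ^ 'n \<Rightarrow> complex) \<Rightarrow> complex ^ 'n::finite \<Rightarrow> complex" where
  "mixed_deriv a f = foldr (\<lambda>i. partial_deriv i ^^ (a $ i)) coords f"

definition is_cont_ext ::
  "('n \<Rightarrow> complex set) \<Rightarrow> ('n \<Rightarrow> complex set) \<Rightarrow> nat ^ 'n \<Rightarrow> (complex ^ 'n \<Rightarrow> complex)
    \<Rightarrow> (complex ^ 'n::finite \<Rightarrow> complex) \<Rightarrow> bool" where
  "is_cont_ext \<Omega> S a f g \<longleftrightarrow>
     continuous_on (cprod (\<lambda>i. \<Omega> i \<union> S i)) g \<and> (\<forall>z\<in>cprod \<Omega>. g z = mixed_deriv a f z)"

text \<open>The extension is unique on the product of the sets \<open>\<Omega> i \<union> S i\<close> when \<open>S i\<close> lies in the closure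
  of \<open>\<Omega> i\<close>; it is only evaluated there.\<close>

definition ext_deriv ::
  "('n \<Rightarrow> complex set) \<Rightarrow> ('n \<Rightarrow> complex set) \<Rightarrow> nat ^ 'n \<Rightarrow> (complex ^ 'n \<Rightarrow> complex)
    \<Rightarrow> complex ^ 'n::finite \<Rightarrow> complex" where
  "ext_deriv \<Omega> S a f = (SOME g. is_cont_ext \<Omega> S a f g)"

text \<open>A function on \<open>cprod \<Omega>\<close> is represented by the total function vanishing outside \<open>cprod \<Omega>\<close>,
  so that equality in \<open>A_inf\<close> is equality on \<open>cprod \<Omega>\<close>.\<close>

definition A_inf :: "('n \<Rightarrow> complex set) \<Rightarrow> ('n \<Rightarrow> complex set) \<Rightarrow> (complex ^ 'n::finite \<Rightarrow> complex) set" where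
  "A_inf \<Omega> S = {f. (\<forall>z. z \<notin> cprod \<Omega> \<longrightarrow> f z = 0) \<and> holomorphic_several f (cprod \<Omega>) \<and>
     (\<forall>a. \<exists>g. is_cont_ext \<Omega> S a f g)}"

definition restrict0 :: "('n \<Rightarrow> complex set) \<Rightarrow> (complex ^ 'n \<Rightarrow> complex) \<Rightarrow> complex ^ 'n \<Rightarrow> complex" where
  "restrict0 \<Omega> p = (\<lambda>z. if z \<in> cprod \<Omega> then p z else 0)"

text \<open>Suprema are taken in \<open>ennreal\<close>: they are 0 over the empty set and \<open>\<infinity>\<close> if unbounded.\<close>

definition sup_on :: "'a set \<Rightarrow> ('a \<Rightarrow> complex) \<Rightarrow> ennreal" where
  "sup_on L g = (SUP z\<in>L. ennreal (cmod (g z)))"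

definition A_inf_seminorms ::
  "('n \<Rightarrow> complex set) \<Rightarrow> ('n \<Rightarrow> complex set) \<Rightarrow> ((complex ^ 'n::finite \<Rightarrow> complex) \<Rightarrow> ennreal) set" where
  "A_inf_seminorms \<Omega> S =
     {\<lambda>f. sup_on L (ext_deriv \<Omega> S a f) | L a. compact L \<and> L \<subseteq> cprod (\<lambda>i. \<Omega> i \<union> S i)}"

text \<open>Elements of \<open>O(K)\<close> are germs along \<open>K\<close> of functions in \<open>holo_near K\<close>.\<close>

definition holo_near :: "(complex ^ 'n) set \<Rightarrow> (complex ^ 'n \<Rightarrow> complex) set" where
  "holo_near K = {h. \<exists>U. K \<subseteq> U \<and> holomorphic_several h U}"

definition germ :: "'a::topological_space set \<Rightarrow> ('a \<Rightarrow> complex) \<Rightarrow> ('a \<Rightarrow> complex) set" where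
  "germ K h = {g. \<exists>U. open U \<and> K \<subseteq> U \<and> (\<forall>z\<in>U. g z = h z)}"

definition O_seminorms :: "(complex ^ 'n::finite) set \<Rightarrow> ((complex ^ 'n \<Rightarrow> complex) \<Rightarrow> ennreal) set" where
  "O_seminorms K = {\<lambda>h. sup_on K (mixed_deriv a h) | a. True}"

text \<open>The space is \<open>cl ` X\<close>, where \<open>cl\<close> sends a representing function to the element it
  represents: the identity for \<open>A_inf\<close>, \<open>germ K\<close> for \<open>O(K)\<close>. The seminorms \<open>P\<close> are given on
  representatives and must not depend on their choice.\<close>

definition seminorm_topology ::
  "(('a \<Rightarrow> complex) \<Rightarrow> 'b) \<Rightarrow> ('a \<Rightarrow> complex) set \<Rightarrow> (('a \<Rightarrow> complex) \<Rightarrow> ennreal) set \<Rightarrow> 'b topology" where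
  "seminorm_topology cl X P = topology_generated_by
     {cl ` {g \<in> X. p (g - f) < ennreal r} | p f r. p \<in> P \<and> f \<in> X \<and> r > 0}"

definition invariant_metric_for ::
  "(('a \<Rightarrow> complex) \<Rightarrow> 'b) \<Rightarrow> ('a \<Rightarrow> complex) set \<Rightarrow> (('a \<Rightarrow> complex) \<Rightarrow> ennreal) set
    \<Rightarrow> ('b \<Rightarrow> 'b \<Rightarrow> real) \<Rightarrow> bool" where
  "invariant_metric_for cl X P m \<longleftrightarrow>
     Metric_space (cl ` X) m \<and>
     Metric_space.mtopology (cl ` X) m = seminorm_topology cl X P \<and>
     (\<forall>f\<in>X. \<forall>g\<in>X. \<forall>h\<in>X. m (cl (f + h)) (cl (g + h)) = m (cl f) (cl g))"

definition A_inf_topology ::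
  "('n \<Rightarrow> complex set) \<Rightarrow> ('n \<Rightarrow> complex set) \<Rightarrow> (complex ^ 'n::finite \<Rightarrow> complex) topology" where
  "A_inf_topology \<Omega> S = seminorm_topology (\<lambda>f. f) (A_inf \<Omega> S) (A_inf_seminorms \<Omega> S)"

definition A_inf_metric ::
  "('n \<Rightarrow> complex set) \<Rightarrow> ('n \<Rightarrow> complex set)
    \<Rightarrow> ((complex ^ 'n::finite \<Rightarrow> complex) \<Rightarrow> (complex ^ 'n \<Rightarrow> complex) \<Rightarrow> real) \<Rightarrow> bool" where
  "A_inf_metric \<Omega> S m \<longleftrightarrow> invariant_metric_for (\<lambda>f. f) (A_inf \<Omega> S) (A_inf_seminorms \<Omega> S) m"

definition O_metric ::
  "(complex ^ 'n::finite) set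
    \<Rightarrow> ((complex ^ 'n \<Rightarrow> complex) set \<Rightarrow> (complex ^ 'n \<Rightarrow> complex) set \<Rightarrow> real) \<Rightarrow> bool" where
  "O_metric K m \<longleftrightarrow> invariant_metric_for (germ K) (holo_near K) (O_seminorms K) m"

definition monomial :: "nat ^ 'n \<Rightarrow> complex ^ 'n::finite \<Rightarrow> complex" where
  "monomial a z = (\<Prod>i\<in>UNIV. z $ i ^ (a $ i))"

definition polynomials :: "(complex ^ 'n::finite \<Rightarrow> complex) set" where
  "polynomials = {\<lambda>z. \<Sum>a\<in>F. c a * monomial a z | F c. finite F}"

definition X_inf :: "('n \<Rightarrow> complex set) \<Rightarrow> ('n \<Rightarrow> complex set) \<Rightarrow> (complex ^ 'n::finite \<Rightarrow> complex) set" where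
  "X_inf \<Omega> S = A_inf_topology \<Omega> S closure_of (restrict0 \<Omega> ` polynomials)"

definition X_inf_topology ::
  "('n \<Rightarrow> complex set) \<Rightarrow> ('n \<Rightarrow> complex set) \<Rightarrow> (complex ^ 'n::finite \<Rightarrow> complex) topology" where
  "X_inf_topology \<Omega> S = subtopology (A_inf_topology \<Omega> S) (X_inf \<Omega> S)"

definition taylor_coeff ::
  "('n \<Rightarrow> complex set) \<Rightarrow> ('n \<Rightarrow> complex set) \<Rightarrow> nat ^ 'n \<Rightarrow> (complex ^ 'n \<Rightarrow> complex)
    \<Rightarrow> complex ^ 'n::finite \<Rightarrow> complex" where
  "taylor_coeff \<Omega> S a f \<zeta> = ext_deriv \<Omega> S a f \<zeta> / (\<Prod>i\<in>UNIV. fact (a $ i))"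

definition partial_sum ::
  "('n \<Rightarrow> complex set) \<Rightarrow> ('n \<Rightarrow> complex set) \<Rightarrow> (nat \<Rightarrow> nat ^ 'n) \<Rightarrow> nat
    \<Rightarrow> (complex ^ 'n \<Rightarrow> complex) \<Rightarrow> complex ^ 'n \<Rightarrow> complex ^ 'n::finite \<Rightarrow> complex" where
  "partial_sum \<Omega> S N n f \<zeta> = (\<lambda>z. \<Sum>j\<le>n. taylor_coeff \<Omega> S (N j) f \<zeta> * monomial (N j) (z - \<zeta>))"

definition universal ::
  "('n \<Rightarrow> complex set) \<Rightarrow> ('n \<Rightarrow> complex set) \<Rightarrow> (nat \<Rightarrow> nat ^ 'n) \<Rightarrow> nat set
    \<Rightarrow> ((complex ^ 'n::finite \<Rightarrow> complex) \<Rightarrow> (complex ^ 'n \<Rightarrow> complex) \<Rightarrow> real)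
    \<Rightarrow> ((complex ^ 'n) set \<Rightarrow> (complex ^ 'n \<Rightarrow> complex) set \<Rightarrow> (complex ^ 'n \<Rightarrow> complex) set \<Rightarrow> real)
    \<Rightarrow> (complex ^ 'n \<Rightarrow> complex) \<Rightarrow> bool" where
  "universal \<Omega> S N \<mu> d \<rho> f \<longleftrightarrow>
     (\<forall>K. (\<forall>i. compact (K i) \<and> connected (- K i)) \<longrightarrow>
       cprod K \<inter> cprod (\<lambda>i. \<Omega> i \<union> closure (S i)) = {} \<longrightarrow>
       (\<forall>h\<in>holo_near (cprod K). \<exists>l. strict_mono l \<and> range l \<subseteq> \<mu> \<and>
         (\<forall>L. compact L \<and> L \<subseteq> cprod (\<lambda>i. \<Omega> i \<union> S i) \<longrightarrow>
           (\<lambda>n. SUP \<zeta>\<in>L. ennreal (\<rho> (cprod K)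
              (germ (cprod K) (partial_sum \<Omega> S N (l n) f \<zeta>)) (germ (cprod K) h))) \<longlonglongrightarrow> 0 \<and>
           (\<lambda>n. SUP \<zeta>\<in>L. ennreal (d (restrict0 \<Omega> (partial_sum \<Omega> S N (l n) f \<zeta>)) f)) \<longlonglongrightarrow> 0)))"

text \<open>Pitfall: connectedness of \<open>- (\<Omega> i \<union> S i)\<close> in the plane does not imply connectedness in the
  sphere. If this complement is bounded and \<open>\<Omega> i \<union> closure (S i) \<noteq> UNIV\<close>, no function is \<open>universal\<close>.
  Example in one variable: \<open>\<Omega>\<close> is the plane slit along \<open>[0,\<infinity>)\<close>, \<open>S = (1,\<infinity>)\<close>, \<open>K = {0}\<close>. Partial
  sums converging to \<open>f\<close> uniformly on the circle \<open>|z| = 2\<close> converge on the whole disc by the maximum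
  principle, to a limit determined by \<open>f\<close>, so they cannot tend at \<open>0\<close> to each of the constants 0 and 1.
  The theorem therefore assumes \<open>\<Omega> i \<union> closure (S i) = UNIV\<close> whenever the complement is bounded.\<close>

end

theory Submission
  imports Defs "HOL-Complex_Analysis.Complex_Analysis"
begin

text \<open>Polynomials are dense in the space \<open>X\<^sup>\<infinity>\<close>, and the Taylor partial sums of a polynomial are
  eventually the polynomial itself, at every centre. Hence universality follows from Baire's theorem
  once a polynomial \<open>P\<close> can be found that is close, with finitely many derivatives, to a given \<open>p\<close> on a
  compact set \<open>L\<close> of centres and to a given \<open>q\<close> on \<open>K\<close>. Some factor \<open>K i\<close> misses
  \<open>\<Omega> i \<union> closure (S i)\<close>; since the complement of \<open>\<Omega> i \<union> S i\<close> is connected and unbounded (otherwise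
  \<open>K i\<close> is empty), the projection of \<open>L\<close> can be filled to a compact set with connected complement
  disjoint from \<open>K i\<close>, and Runge's theorem gives a polynomial \<open>\<phi>\<close> of the single variable \<open>z $ i\<close> that is
  nearly 1 around the former and nearly 0 around the latter: take \<open>P = \<phi> p + (1 - \<phi>) q\<close>.

  Countably many products \<open>K\<close> and polynomials \<open>q\<close> suffice, which gives the \<open>G\<^sub>\<delta>\<close> property;
  that every germ on \<open>K\<close> is a limit of polynomials is Runge's theorem in several variables, proved one
  variable at a time. The Cauchy kernel needed for it is transported from circles by Riemann maps of
  the components of a simply connected neighbourhood.

  For the dense subspace, functions \<open>F 0, F 1, \<dots>\<close> are chosen so that \<open>F j\<close> is universal along index
  sets on which the partial sums of all earlier \<open>F i\<close> tend to 0 on the sets \<open>K\<close>; in a linear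
  combination, only the last function with nonzero coefficient then contributes on \<open>K\<close>.\<close>

text \<open>Only the topologies and the translation invariance of the metrics are known, so each
  metric statement is first turned into finitely many seminorm inequalities; it suffices to inspect
  balls around 0, and invariance makes the conversion uniform over pairs of functions. Disjointness
  of the products guarantees just one separated coordinate, the other factors of \<open>K\<close>
  may meet the domain; hence the separating polynomial depends on a single variable. Uniformity in
  the centre is cheap: a partial sum involves finitely many Taylor coefficients, each controlled by
  a seminorm over the compact set of centres. Sup-norm approximation on open sets is upgraded to
  derivatives by Cauchy estimates whose constants depend only on radius and orders. A germ
  \<open>h\<close> need not extend to the larger product taken from the countable family; therefore
  the countably many conditions test polynomials, and \<open>h\<close> is recovered on the smaller
  product. In the chain of functions the index sets depend on the product as well as on the stage,
  so no diagonal extraction over the products is required.\<close>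

no_notation fps_nth (infixl "$" 75)

section \<open>Holomorphic functions of several variables\<close>

definition upd :: "complex ^ 'n \<Rightarrow> 'n \<Rightarrow> complex \<Rightarrow> complex ^ 'n" where
  "upd z i w = (\<chi> j. if j = i then w else z $ j)"

lemma upd_nth [simp]: "upd z i w $ j = (if j = i then w else z $ j)"
  by (simp add: upd_def)

lemma upd_same [simp]: "upd z i (z $ i) = z"
  by (simp add: vec_eq_iff)

lemma upd_upd [simp]: "upd (upd z i v) i w = upd z i w"
  by (simp add: vec_eq_iff)

lemma upd_eq_axis: "upd z i w = z + axis i (w - z $ i)"
  by (simp add: vec_eq_iff axis_def)

lemma upd_add: "upd z j w + v = upd (z + v) j (w + v $ j)"
  by (simp add: vec_eq_iff)

lemma norm_axis: "norm (axis i x :: complex ^ 'n::finite) = norm x"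
  by (simp add: norm_vec_def L2_set_def axis_def if_distrib[where f = "\<lambda>x. (norm x)^2"] cong: if_cong)

lemma dist_upd: "dist (upd z i v) (upd z i w) = dist v (w :: complex)"
proof -
  have "upd z i v - upd z i w = axis i (v - w)"
    by (simp add: vec_eq_iff axis_def)
  then show ?thesis by (simp add: dist_norm norm_axis)
qed

lemma dist_upd_self: "dist (upd z i w) z = dist w (z $ i)"
  by (metis dist_upd upd_same)

lemma bounded_linear_axis: "bounded_linear (axis i :: complex \<Rightarrow> complex ^ 'n::finite)"
proof (rule bounded_linear_intro[of _ 1])
  show "norm (axis i x :: complex ^ 'n) \<le> norm x * 1" for x :: complex
    by (simp add: norm_axis)
qed (auto simp: vec_eq_iff axis_def)

lemma has_derivative_upd:
  "(upd z i has_derivative axis i) (at (w::complex) within A)" for z :: "complex ^ 'n::finite"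
proof -
  have "((\<lambda>w. z + axis i (w - z $ i)) has_derivative (\<lambda>h. 0 + axis i (h - 0))) (at w within A)"
    by (intro derivative_intros bounded_linear.has_derivative[OF bounded_linear_axis])
  then show ?thesis by (simp add: upd_eq_axis[abs_def])
qed

lemma continuous_on_upd [continuous_intros]:
  assumes "continuous_on A f" "continuous_on A g"
  shows "continuous_on A (\<lambda>x. upd (f x) i (g x) :: complex ^ 'n::finite)"
  unfolding upd_def
proof (rule continuous_on_vec_lambda)
  show "continuous_on A (\<lambda>x. if j = i then g x else f x $ j)" for j
    using assms by (cases "j = i") (auto intro: continuous_intros)
qed

lemma open_slice:
  fixes U :: "(complex ^ 'n::finite) set"
  assumes "open U"
  shows "open {w. upd z i w \<in> U}"
proof -
  have "continuous_on UNIV (\<lambda>w. upd z i w)"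
    by (intro continuous_intros)
  then have "open ((\<lambda>w. upd z i w) -` U)"
    using assms open_vimage by blast
  then show ?thesis by (simp add: vimage_def)
qed

lemma partial_deriv_upd: "partial_deriv i f z = deriv (\<lambda>w. f (upd z i w)) (z $ i)"
  by (simp add: partial_deriv_def upd_def)

text \<open>Continuity together with holomorphy in each variable separately is easier to propagate
  through limits and partial derivatives than total complex differentiability.\<close>

definition sep_hol :: "(complex ^ 'n::finite \<Rightarrow> complex) \<Rightarrow> (complex ^ 'n) set \<Rightarrow> bool" where
  "sep_hol f U \<longleftrightarrow> open U \<and> continuous_on U f \<and>
     (\<forall>z\<in>U. \<forall>i. (\<lambda>w. f (upd z i w)) field_differentiable (at (z $ i)))"

lemma sep_hol_open: "sep_hol f U \<Longrightarrow> open U"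
  and sep_hol_continuous: "sep_hol f U \<Longrightarrow> continuous_on U f"
  and sep_hol_slice_diff: "sep_hol f U \<Longrightarrow> z \<in> U \<Longrightarrow> (\<lambda>w. f (upd z i w)) field_differentiable (at (z $ i))"
  by (auto simp: sep_hol_def)

lemma sep_hol_slice:
  assumes "sep_hol f U"
  shows "(\<lambda>w. f (upd z i w)) holomorphic_on {w. upd z i w \<in> U}"
proof (unfold holomorphic_on_def, intro ballI)
  fix w assume "w \<in> {w. upd z i w \<in> U}"
  then have "(\<lambda>v. f (upd (upd z i w) i v)) field_differentiable (at (upd z i w $ i))"
    using assms unfolding sep_hol_def by blast
  then show "(\<lambda>w. f (upd z i w)) field_differentiable at w within {w. upd z i w \<in> U}"
    by (auto intro: field_differentiable_at_within)
qed

lemma sep_holI_slice: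
  assumes "open U" "continuous_on U f"
    "\<And>z i. z \<in> U \<Longrightarrow> (\<lambda>w. f (upd z i w)) holomorphic_on {w. upd z i w \<in> U}"
  shows "sep_hol f U"
  unfolding sep_hol_def
proof (intro conjI ballI allI assms)
  fix z i assume "z \<in> U"
  then show "(\<lambda>w. f (upd z i w)) field_differentiable (at (z $ i))"
    using assms(3)[of z i] open_slice[OF assms(1), of z i]
    by (simp add: holomorphic_on_open field_differentiable_def)
qed

text \<open>The chain rule along \<open>upd z i\<close> gives a real derivative of the slice;
  complex linearity turns it into multiplication by its value on \<open>axis i 1\<close>.\<close>

lemma holomorphic_several_derivative:
  assumes "(f has_derivative f') (at z)" and lin: "\<And>c v. f' (c *s v) = c * f' v"
  shows "((\<lambda>w. f (upd z i w)) has_field_derivative f' (axis i 1)) (at (z $ i))"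
proof -
  have "((\<lambda>w. f (upd z i w)) has_derivative (\<lambda>h. f' (axis i h))) (at (z $ i))"
    using has_derivative_compose[OF has_derivative_upd[of z i "z $ i" UNIV], of f f'] assms by simp
  moreover have "(\<lambda>h. f' (axis i h)) = (*) (f' (axis i 1))"
  proof
    fix h
    have "axis i h = h *s axis i (1::complex)"
      by (simp add: vec_eq_iff axis_def)
    then have "f' (axis i h) = f' (h *s axis i 1)" by simp
    then show "f' (axis i h) = f' (axis i 1) * h" by (simp only: lin mult.commute)
  qed
  ultimately show ?thesis
    by (simp add: has_field_derivative_def)
qed

text \<open>Complex linearity determines the total derivative from its values on the axes. The
  explicit form is the one that can be passed to a limit in
  \<open>holomorphic_several_limit\<close>.\<close>

lemma holomorphic_several_has_derivative:
  assumes "holomorphic_several f U" "z \<in> U"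
  shows "(f has_derivative (\<lambda>v. \<Sum>i\<in>UNIV. v $ i * partial_deriv i f z)) (at z)"
proof -
  obtain f' where f': "(f has_derivative f') (at z)" and lin: "\<And>c v. f' (c *s v) = c * f' v"
    using assms by (auto simp: holomorphic_several_def)
  interpret bounded_linear f' using f' by (rule has_derivative_bounded_linear)
  have "f' v = (\<Sum>i\<in>UNIV. v $ i * partial_deriv i f z)" for v
  proof -
    have "f' v = f' (\<Sum>i\<in>UNIV. v $ i *s axis i 1)"
      by (simp only: basis_expansion)
    also have "\<dots> = (\<Sum>i\<in>UNIV. v $ i * f' (axis i 1))"
      by (simp add: sum lin)
    also have "\<dots> = (\<Sum>i\<in>UNIV. v $ i * partial_deriv i f z)"
      unfolding partial_deriv_upd
      by (simp add: DERIV_imp_deriv[OF holomorphic_several_derivative[OF f' lin]])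
    finally show ?thesis .
  qed
  then have "f' = (\<lambda>v. \<Sum>i\<in>UNIV. v $ i * partial_deriv i f z)"
    by (rule ext)
  then show ?thesis using f' by simp
qed

lemma holomorphic_several_imp_sep_hol:
  assumes "holomorphic_several f U"
  shows "sep_hol f U"
  unfolding sep_hol_def
proof (intro conjI ballI allI)
  show "open U" using assms by (simp add: holomorphic_several_def)
  show "continuous_on U f"
    by (rule continuous_at_imp_continuous_on)
      (use assms holomorphic_several_has_derivative has_derivative_continuous in blast)
  fix z i assume "z \<in> U"
  then show "(\<lambda>w. f (upd z i w)) field_differentiable (at (z $ i))"
    using assms holomorphic_several_derivative unfolding holomorphic_several_def field_differentiable_def
    by metis
qed

lemma sep_hol_subset: "sep_hol f U \<Longrightarrow> open V \<Longrightarrow> V \<subseteq> U \<Longrightarrow> sep_hol f V"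
  by (auto simp: sep_hol_def intro: continuous_on_subset)

lemma eventually_upd_in:
  fixes z :: "complex ^ 'n::finite"
  assumes "open U" "z \<in> U"
  shows "eventually (\<lambda>w. upd z i w \<in> U) (nhds (z $ i))"
  using open_slice[OF assms(1), of z i] assms(2) by (auto simp: eventually_nhds)

lemma sep_hol_local:
  assumes "open U" "\<And>z. z \<in> U \<Longrightarrow> \<exists>V. z \<in> V \<and> sep_hol f V"
  shows "sep_hol f U"
  unfolding sep_hol_def
proof (intro conjI ballI allI)
  show "open U" by fact
  show "continuous_on U f"
  proof (rule continuous_at_imp_continuous_on, rule ballI)
    fix z assume "z \<in> U"
    then obtain V where "z \<in> V" "sep_hol f V" using assms by blast
    then show "isCont f z"
      using sep_hol_open sep_hol_continuous continuous_on_eq_continuous_at by blast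
  qed
qed (use assms sep_hol_slice_diff in blast)

lemma sep_hol_const [simp]: "open U \<Longrightarrow> sep_hol (\<lambda>z. c) U"
  by (simp add: sep_hol_def)

lemma sep_hol_add: "sep_hol f U \<Longrightarrow> sep_hol g U \<Longrightarrow> sep_hol (\<lambda>z. f z + g z) U"
  by (auto simp: sep_hol_def intro!: continuous_intros field_differentiable_add)

lemma sep_hol_diff: "sep_hol f U \<Longrightarrow> sep_hol g U \<Longrightarrow> sep_hol (\<lambda>z. f z - g z) U"
  by (auto simp: sep_hol_def intro!: continuous_intros field_differentiable_diff)

lemma sep_hol_mult: "sep_hol f U \<Longrightarrow> sep_hol g U \<Longrightarrow> sep_hol (\<lambda>z. f z * g z) U"
  by (auto simp: sep_hol_def intro!: continuous_intros field_differentiable_mult)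

lemma sep_hol_cmult: "sep_hol f U \<Longrightarrow> sep_hol (\<lambda>z. c * f z) U"
  using sep_hol_mult[OF sep_hol_const] sep_hol_open by blast

lemma sep_hol_translate:
  assumes "sep_hol f U" "open V" "\<And>z. z \<in> V \<Longrightarrow> z + v \<in> U"
  shows "sep_hol (\<lambda>z. f (z + v)) V"
  unfolding sep_hol_def
proof (intro conjI ballI allI)
  show "continuous_on V (\<lambda>z. f (z + v))"
    by (rule continuous_on_compose2[OF sep_hol_continuous[OF assms(1)]]) (use assms in \<open>auto intro!: continuous_intros\<close>)
  fix z i assume "z \<in> V"
  then have *: "(\<lambda>w. f (upd (z + v) i w)) field_differentiable at (z $ i + v $ i)"
    using sep_hol_slice_diff[OF assms(1), of "z + v" i] assms(3) by simp
  have "((\<lambda>w. f (upd (z + v) i w)) \<circ> (\<lambda>w. w + v $ i)) field_differentiable at (z $ i)"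
    by (rule field_differentiable_compose) (use * in \<open>auto intro!: derivative_intros simp: field_differentiable_def\<close>)
  then show "(\<lambda>w. f (upd z i w + v)) field_differentiable at (z $ i)"
    by (simp add: upd_add o_def)
qed (use assms in auto)

text \<open>Weierstrass' theorem on each one-variable slice; joint continuity survives uniform
  limits, and no total derivative has to be followed through the limit.\<close>

lemma sep_hol_uniform_limit:
  assumes "\<And>n. sep_hol (F n) U" "uniform_limit U F f sequentially"
  shows "sep_hol f U"
proof (rule sep_holI_slice)
  show U: "open U" using assms(1) sep_hol_open by blast
  show "continuous_on U f"
    by (rule uniform_limit_theorem[OF _ assms(2)])
      (auto intro!: always_eventually sep_hol_continuous assms(1))
  fix z i assume "z \<in> U"
  show "(\<lambda>w. f (upd z i w)) holomorphic_on {w. upd z i w \<in> U}" (is "_ holomorphic_on ?S")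
  proof (rule holomorphic_uniform_sequence)
    show "open ?S" using U by (rule open_slice)
    show "(\<lambda>w. F n (upd z i w)) holomorphic_on ?S" for n
      by (rule sep_hol_slice) (rule assms)
    fix w assume "w \<in> ?S"
    then obtain d where d: "d > 0" "cball w d \<subseteq> ?S"
      using \<open>open ?S\<close> open_contains_cball by blast
    have "uniform_limit (cball w d) (\<lambda>n w. F n (upd z i w)) (\<lambda>w. f (upd z i w)) sequentially"
      by (rule uniform_limit_compose'[OF assms(2)]) (use d in auto)
    then show "\<exists>d>0. cball w d \<subseteq> ?S \<and>
       uniform_limit (cball w d) (\<lambda>n w. F n (upd z i w)) (\<lambda>w. f (upd z i w)) sequentially"
      using d by blast
  qed
qed

lemma upd_cball:
  assumes "w \<in> cball (z $ i) r"
  shows "upd z i w \<in> cball (z :: complex ^ 'n::finite) r"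
  using assms by (simp add: dist_commute[of z] dist_upd_self dist_commute[of w])

text \<open>Cauchy's inequality on the disc of radius \<open>r\<close> in direction
  \<open>i\<close>, which \<open>upd_cball\<close> keeps inside the ball.\<close>

lemma partial_deriv_bound:
  assumes "sep_hol f U" "cball z r \<subseteq> U" "r > 0" "\<And>w. w \<in> cball z r \<Longrightarrow> norm (f w) \<le> M"
  shows "norm (partial_deriv i f z) \<le> M / r"
proof -
  have sub: "cball (z $ i) r \<subseteq> {w. upd z i w \<in> U}"
    using assms(2) upd_cball by blast
  have hol: "(\<lambda>w. f (upd z i w)) holomorphic_on cball (z $ i) r"
    using sep_hol_slice[OF assms(1)] sub holomorphic_on_subset by blast
  have "norm ((deriv ^^ 1) (\<lambda>w. f (upd z i w)) (z $ i)) \<le> fact 1 * M / r ^ 1"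
  proof (rule Cauchy_inequality)
    show "(\<lambda>w. f (upd z i w)) holomorphic_on ball (z $ i) r"
      using hol holomorphic_on_subset ball_subset_cball by blast
    show "continuous_on (cball (z $ i) r) (\<lambda>w. f (upd z i w))"
      using hol holomorphic_on_imp_continuous_on by blast
    fix w assume "norm (z $ i - w) = r"
    then have "w \<in> cball (z $ i) r" by (simp add: dist_norm)
    then show "norm (f (upd z i w)) \<le> M"
      using assms(4) upd_cball by blast
  qed (use assms in auto)
  then show ?thesis by (simp add: partial_deriv_upd)
qed

text \<open>First-order Taylor expansion; Cauchy's inequality on discs of radius \<open>r\<close>
  around the points of \<open>cball w r\<close> bounds the second derivative by
  \<open>2 * M / r^2\<close>, which is why radius \<open>2 * r\<close> is assumed. The bound sees
  \<open>g\<close> only through \<open>M\<close>, so difference quotients converge uniformly in the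
  remaining variables.\<close>

lemma difference_quotient_bound:
  assumes hol: "g holomorphic_on cball w (2 * r)" and r: "r > 0"
    and M: "\<And>v. v \<in> cball w (2 * r) \<Longrightarrow> norm (g v) \<le> M" and h: "norm h \<le> r" "h \<noteq> 0"
  shows "norm ((g (w + h) - g w) / h - deriv g w) \<le> 2 * M / r^2 * norm h"
proof -
  have ball: "g holomorphic_on ball w (2 * r)"
    using hol holomorphic_on_subset ball_subset_cball by blast
  have in_ball: "v \<in> ball w (2 * r)" if "v \<in> cball w r" for v
    using that r by auto
  have "norm ((deriv ^^ 0) g (w + h) - (\<Sum>i\<le>1. (deriv ^^ i) g w * (w + h - w) ^ i / fact i))
      \<le> 2 * M / r^2 * norm (w + h - w) ^ Suc 1 / fact 1"
  proof (rule complex_Taylor[where S = "cball w r"])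
    fix i x assume x: "x \<in> cball w r"
    have "(deriv ^^ i) g holomorphic_on ball w (2 * r)"
      by (rule holomorphic_higher_deriv[OF ball]) auto
    then have "(deriv ^^ i) g field_differentiable at x"
      using in_ball[OF x] holomorphic_on_imp_differentiable_at open_ball by blast
    then have "((deriv ^^ i) g has_field_derivative (deriv ^^ Suc i) g x) (at x)"
      by (simp add: DERIV_deriv_iff_field_differentiable)
    then show "((deriv ^^ i) g has_field_derivative (deriv ^^ Suc i) g x) (at x within cball w r)"
      by (rule DERIV_subset) simp
  next
    fix x assume x: "x \<in> cball w r"
    have sub: "cball x r \<subseteq> cball w (2 * r)"
    proof
      fix y assume "y \<in> cball x r"
      then show "y \<in> cball w (2 * r)"
        using x dist_triangle[of w y x] by auto
    qed
    have "norm ((deriv ^^ Suc 1) g x) \<le> fact (Suc 1) * M / r ^ Suc 1"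
    proof (rule Cauchy_inequality)
      show "g holomorphic_on ball x r"
        by (rule holomorphic_on_subset[OF hol]) (use sub ball_subset_cball in blast)
      show "continuous_on (cball x r) g"
        by (rule holomorphic_on_imp_continuous_on[OF holomorphic_on_subset[OF hol sub]])
      fix y assume "norm (x - y) = r"
      then have "y \<in> cball x r" by (simp add: dist_norm)
      then show "norm (g y) \<le> M" using sub M by blast
    qed (use r in auto)
    then show "norm ((deriv ^^ Suc 1) g x) \<le> 2 * M / r^2"
      by (simp add: power2_eq_square)
  qed (use r h in \<open>auto simp: dist_norm\<close>)
  then have *: "norm (g (w + h) - g w - deriv g w * h) \<le> 2 * M / r^2 * norm h ^ 2"
    by (simp add: power2_eq_square algebra_simps)
  have "(g (w + h) - g w) / h - deriv g w = (g (w + h) - g w - deriv g w * h) / h"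
    using h by (simp add: field_simps)
  then have "norm ((g (w + h) - g w) / h - deriv g w) = norm (g (w + h) - g w - deriv g w * h) / norm h"
    by (simp add: norm_divide)
  also have "\<dots> \<le> 2 * M / r^2 * norm h ^ 2 / norm h"
    using * h by (intro divide_right_mono) auto
  also have "\<dots> = 2 * M / r^2 * norm h"
    using h by (simp add: power2_eq_square)
  finally show ?thesis .
qed

text \<open>Joint continuity, and holomorphy in the variables other than \<open>i\<close>, are the
  difficulty. Both are inherited from difference quotients in direction \<open>i\<close>, which are
  separately holomorphic for trivial reasons and converge locally uniformly to the partial
  derivative.\<close>

lemma sep_hol_partial_deriv:
  assumes f: "sep_hol f U"
  shows "sep_hol (partial_deriv i f) U"
proof (rule sep_hol_local)
  show "open U" using f by (rule sep_hol_open)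
  fix z0 assume "z0 \<in> U"
  then obtain e where e: "e > 0" "cball z0 e \<subseteq> U"
    using \<open>open U\<close> open_contains_cball by blast
  have "compact (f ` cball z0 e)"
    by (rule compact_continuous_image)
      (use e continuous_on_subset[OF sep_hol_continuous[OF f]] in auto)
  then obtain M where M: "\<And>z. z \<in> cball z0 e \<Longrightarrow> norm (f z) \<le> M"
    using compact_imp_bounded bounded_iff by (metis imageI)
  \<comment> \<open>A point within \<open>r\<close> of \<open>z0\<close>, moved by
    \<open>2 * r\<close> in one coordinate, stays within \<open>3 * r < e\<close> of
    \<open>z0\<close>; the doubled radius is what \<open>difference_quotient_bound\<close> asks
    for.\<close>
  define r where "r = e / 4"
  have r: "r > 0" using e by (simp add: r_def)
  define h where "h n = complex_of_real (r / Suc n)" for n :: nat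
  have nh: "norm (h n) = r / Suc n" for n
    using r unfolding h_def norm_of_real by simp
  have h: "norm (h n) \<le> r" "h n \<noteq> 0" for n
  proof -
    show "norm (h n) \<le> r" using r by (simp add: nh field_simps)
    have "norm (h n) > 0" using r by (simp add: nh)
    then show "h n \<noteq> 0" by auto
  qed
  have near: "upd z i w \<in> cball z0 e" if "z \<in> ball z0 r" "w \<in> cball (z $ i) (2 * r)" for z w
  proof -
    have "dist z0 (upd z i w) \<le> dist z0 z + dist z (upd z i w)"
      by (rule dist_triangle)
    moreover have "dist z (upd z i w) \<le> 2 * r"
      using upd_cball[OF that(2)] by simp
    ultimately show ?thesis using that(1) r by (simp add: r_def)
  qed
  have shift: "upd z i (z $ i + h n) = z + axis i (h n)" for z n
    by (simp add: upd_eq_axis)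
  have "sep_hol (partial_deriv i f) (ball z0 r)"
  proof (rule sep_hol_uniform_limit)
    fix n
    have "sep_hol (\<lambda>z. f (z + axis i (h n))) (ball z0 r)"
    proof (rule sep_hol_translate[OF f])
      fix z assume "z \<in> ball z0 r"
      then show "z + axis i (h n) \<in> U"
        unfolding shift[symmetric] using near[of z "z $ i + h n"] h[of n] r e by (auto simp: dist_norm)
    qed auto
    moreover have "sep_hol f (ball z0 r)"
      by (rule sep_hol_subset[OF f]) (use e in \<open>auto simp: r_def\<close>)
    ultimately show "sep_hol (\<lambda>z. inverse (h n) * (f (z + axis i (h n)) - f z)) (ball z0 r)"
      by (intro sep_hol_cmult sep_hol_diff)
  next
    show "uniform_limit (ball z0 r) (\<lambda>n z. inverse (h n) * (f (z + axis i (h n)) - f z))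
      (partial_deriv i f) sequentially"
    proof (rule uniform_limitI)
      fix \<epsilon> :: real assume "\<epsilon> > 0"
      have "(\<lambda>n. 2 * M / r^2 * (r / Suc n)) \<longlonglongrightarrow> 2 * M / r^2 * 0"
        by (intro tendsto_intros LIMSEQ_Suc lim_const_over_n)
      then have "\<forall>\<^sub>F n in sequentially. 2 * M / r^2 * (r / Suc n) < \<epsilon>"
        using \<open>\<epsilon> > 0\<close> by (auto simp: order_tendsto_iff)
      then show "\<forall>\<^sub>F n in sequentially. \<forall>z\<in>ball z0 r.
          dist (inverse (h n) * (f (z + axis i (h n)) - f z)) (partial_deriv i f z) < \<epsilon>"
      proof (rule eventually_mono, intro ballI)
        fix n z assume n: "2 * M / r^2 * (r / Suc n) < \<epsilon>" and z: "z \<in> ball z0 r"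
        have "cball (z $ i) (2 * r) \<subseteq> {w. upd z i w \<in> U}"
          using near[OF z] e by blast
        then have "(\<lambda>w. f (upd z i w)) holomorphic_on cball (z $ i) (2 * r)"
          using sep_hol_slice[OF f] holomorphic_on_subset by blast
        then have "norm ((f (upd z i (z $ i + h n)) - f (upd z i (z $ i))) / h n
            - deriv (\<lambda>w. f (upd z i w)) (z $ i)) \<le> 2 * M / r^2 * norm (h n)"
          by (rule difference_quotient_bound) (use r h M near[OF z] in auto)
        then show "dist (inverse (h n) * (f (z + axis i (h n)) - f z)) (partial_deriv i f z) < \<epsilon>"
          using n by (simp add: dist_norm partial_deriv_upd nh divide_inverse algebra_simps flip: shift)
      qed
    qed
  qed
  then show "\<exists>V. z0 \<in> V \<and> sep_hol (partial_deriv i f) V"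
    using r by (meson centre_in_ball)
qed

subsection \<open>Iterated partial derivatives\<close>

abbreviation pd :: "'n list \<Rightarrow> (complex ^ 'n::finite \<Rightarrow> complex) \<Rightarrow> complex ^ 'n \<Rightarrow> complex" where
  "pd is f \<equiv> foldr partial_deriv is f"

text \<open>Spelling a mixed derivative as a word of first-order derivatives turns the powers inside
  \<open>foldr\<close> into plain list induction.\<close>

definition idxs :: "nat ^ 'n \<Rightarrow> 'n::finite list" where
  "idxs a = concat (map (\<lambda>i. replicate (a $ i) i) coords)"

lemma mixed_deriv_eq_pd: "mixed_deriv a f = pd (idxs a) f"
proof -
  have rep: "foldr partial_deriv (replicate k i) g = (partial_deriv i ^^ k) g"
    for k i and g :: "complex ^ 'n \<Rightarrow> complex"
    by (induction k) auto
  have "foldr (\<lambda>i. partial_deriv i ^^ (a $ i)) js f = pd (concat (map (\<lambda>i. replicate (a $ i) i) js)) f" for js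
    by (induction js) (auto simp: rep)
  then show ?thesis by (simp add: mixed_deriv_def idxs_def)
qed

lemma sep_hol_pd: "sep_hol f U \<Longrightarrow> sep_hol (pd is f) U"
  by (induction "is") (auto intro: sep_hol_partial_deriv)

lemma partial_deriv_cong:
  assumes "open U" "z \<in> U" "\<And>z. z \<in> U \<Longrightarrow> f z = g z"
  shows "partial_deriv i f z = partial_deriv i g z"
  unfolding partial_deriv_upd
  by (rule deriv_cong_ev[OF eventually_mono[OF eventually_upd_in[OF assms(1,2)]]]) (use assms in auto)

lemma partial_deriv_add:
  assumes "(\<lambda>w. f (upd z i w)) field_differentiable (at (z $ i))"
    "(\<lambda>w. g (upd z i w)) field_differentiable (at (z $ i))"
  shows "partial_deriv i (\<lambda>z. f z + g z) z = partial_deriv i f z + partial_deriv i g z"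
  unfolding partial_deriv_upd using assms by (rule deriv_add)

lemma partial_deriv_cmult:
  assumes "(\<lambda>w. f (upd z i w)) field_differentiable (at (z $ i))"
  shows "partial_deriv i (\<lambda>z. c * f z) z = c * partial_deriv i f z"
  unfolding partial_deriv_upd using assms by (rule deriv_cmult)

lemma pd_cong:
  assumes "open U" "\<And>z. z \<in> U \<Longrightarrow> f z = g z" "z \<in> U"
  shows "pd is f z = pd is g z"
  using assms(3)
proof (induction "is" arbitrary: z)
  case (Cons i "is")
  then show ?case using partial_deriv_cong[OF assms(1), of z "pd is f" "pd is g"] by simp
qed (use assms in auto)

lemma pd_add:
  assumes "sep_hol f U" "sep_hol g U" "z \<in> U"
  shows "pd is (\<lambda>z. f z + g z) z = pd is f z + pd is g z"
  using assms(3)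
proof (induction "is" arbitrary: z)
  case (Cons i "is")
  have "partial_deriv i (pd is (\<lambda>z. f z + g z)) z = partial_deriv i (\<lambda>z. pd is f z + pd is g z) z"
    by (rule partial_deriv_cong[of U]) (use Cons sep_hol_open[OF assms(1)] in auto)
  also have "\<dots> = partial_deriv i (pd is f) z + partial_deriv i (pd is g) z"
    by (rule partial_deriv_add[OF sep_hol_slice_diff[OF sep_hol_pd[OF assms(1)] Cons.prems]
          sep_hol_slice_diff[OF sep_hol_pd[OF assms(2)] Cons.prems]])
  finally show ?case by simp
qed auto

lemma pd_cmult:
  assumes "sep_hol f U" "z \<in> U"
  shows "pd is (\<lambda>z. c * f z) z = c * pd is f z"
  using assms(2)
proof (induction "is" arbitrary: z)
  case (Cons i "is")
  have "partial_deriv i (pd is (\<lambda>z. c * f z)) z = partial_deriv i (\<lambda>z. c * pd is f z) z"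
    by (rule partial_deriv_cong[of U]) (use Cons sep_hol_open[OF assms(1)] in auto)
  also have "\<dots> = c * partial_deriv i (pd is f) z"
    by (rule partial_deriv_cmult[OF sep_hol_slice_diff[OF sep_hol_pd[OF assms(1)] Cons.prems]])
  finally show ?case by simp
qed auto

lemma pd_diff:
  assumes "sep_hol f U" "sep_hol g U" "z \<in> U"
  shows "pd is (\<lambda>z. f z - g z) z = pd is f z - pd is g z"
  using pd_add[OF assms(1) sep_hol_cmult[OF assms(2), of "-1"] assms(3), of "is"]
    pd_cmult[OF assms(2,3), of "is" "-1"] by simp

lemma sep_hol_sum: "open U \<Longrightarrow> (\<And>k. k \<in> F \<Longrightarrow> sep_hol (f k) U) \<Longrightarrow> sep_hol (\<lambda>z. \<Sum>k\<in>F. f k z) U"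
  by (induction F rule: infinite_finite_induct) (auto intro: sep_hol_add)

lemma partial_deriv_const: "partial_deriv i (\<lambda>z. c) = (\<lambda>z. 0)"
  by (simp add: partial_deriv_upd fun_eq_iff)

lemma pd_zero: "pd is (\<lambda>z. 0) = (\<lambda>z. 0)"
  by (induction "is") (auto simp: partial_deriv_const)

lemma pd_sum:
  assumes "open U" "\<And>k. k \<in> F \<Longrightarrow> sep_hol (f k) U" "z \<in> U"
  shows "pd is (\<lambda>z. \<Sum>k\<in>F. f k z) z = (\<Sum>k\<in>F. pd is (f k) z)"
  using assms(2)
proof (induction F rule: infinite_finite_induct)
  case (insert k F)
  then show ?case
    using pd_add[of "f k" U "\<lambda>z. \<Sum>k\<in>F. f k z" z "is"] sep_hol_sum[OF assms(1), of F f] assms(3) by simp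
qed (auto simp: pd_zero)

text \<open>Cauchy's inequality is iterated, halving the radius at each letter of the word. The
  order of quantifiers matters: \<open>C\<close> depends on \<open>e\<close> and the word only, so
  the same constant serves all functions and all points of a compact set.\<close>

lemma pd_bound:
  fixes "is" :: "'n::finite list"
  assumes "e > 0"
  shows "\<exists>C>0. \<forall>f U z M. sep_hol f U \<longrightarrow> cball z e \<subseteq> U \<longrightarrow> (\<forall>w\<in>cball z e. norm (f w) \<le> M)
    \<longrightarrow> norm (pd is f z) \<le> C * M"
  using assms
proof (induction "is" arbitrary: e)
  case Nil
  then show ?case by (intro exI[of _ 1]) auto
next
  case (Cons i "is")
  obtain C where C: "C > 0" "\<And>f U z M. sep_hol f U \<Longrightarrow> cball z (e/2) \<subseteq> U \<Longrightarrow>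
      (\<forall>w\<in>cball z (e/2). norm (f w) \<le> M) \<Longrightarrow> norm (pd is f z) \<le> C * M"
    using Cons.IH[of "e/2"] Cons.prems by auto
  show ?case
  proof (intro exI[of _ "C / (e/2)"] conjI allI impI)
    show "0 < C / (e/2)" using C Cons.prems by simp
    fix f :: "complex ^ 'n \<Rightarrow> complex" and U z M
    assume f: "sep_hol f U" "cball z e \<subseteq> U" "\<forall>w\<in>cball z e. norm (f w) \<le> M"
    have sub: "cball w (e/2) \<subseteq> cball z e" if w: "w \<in> cball z (e/2)" for w
    proof
      fix v assume "v \<in> cball w (e/2)"
      then show "v \<in> cball z e" using w dist_triangle[of z v w] by auto
    qed
    have "norm (partial_deriv i (pd is f) z) \<le> C * M / (e/2)"
    proof (rule partial_deriv_bound[OF sep_hol_pd[OF f(1)]])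
      show "cball z (e/2) \<subseteq> U" using f(2) Cons.prems subset_trans[OF subset_cball] by fastforce
      show "norm (pd is f w) \<le> C * M" if "w \<in> cball z (e/2)" for w
        by (rule C(2)[OF f(1)]) (use sub[OF that] f in blast)+
    qed (use Cons.prems in auto)
    then show "norm (pd (i # is) f z) \<le> C / (e/2) * M" by (simp add: mult.commute mult.left_commute)
  qed
qed

section \<open>Polynomials and their Taylor expansions\<close>

lemma polynomials_sum:
  assumes "finite F"
  shows "(\<lambda>z. \<Sum>a\<in>F. c a * monomial a z) \<in> polynomials"
  using assms unfolding polynomials_def by blast

lemma polynomials_add:
  assumes "p \<in> polynomials" "q \<in> polynomials"
  shows "(\<lambda>z. p z + q z) \<in> polynomials"
proof -
  obtain F c where F: "finite F" "p = (\<lambda>z. \<Sum>a\<in>F. c a * monomial a z)"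
    using assms(1) by (auto simp: polynomials_def)
  obtain G d where G: "finite G" "q = (\<lambda>z. \<Sum>a\<in>G. d a * monomial a z)"
    using assms(2) by (auto simp: polynomials_def)
  define e where "e a = (if a \<in> F then c a else 0) + (if a \<in> G then d a else 0)" for a
  have "(\<Sum>a\<in>F \<union> G. e a * monomial a z) = p z + q z" for z
  proof -
    have "(\<Sum>a\<in>F \<union> G. e a * monomial a z)
        = (\<Sum>a\<in>F \<union> G. (if a \<in> F then c a else 0) * monomial a z)
        + (\<Sum>a\<in>F \<union> G. (if a \<in> G then d a else 0) * monomial a z)"
      by (simp add: e_def distrib_right sum.distrib)
    also have "(\<Sum>a\<in>F \<union> G. (if a \<in> F then c a else 0) * monomial a z) = p z"
      unfolding F(2) by (rule sum.mono_neutral_cong_right) (use F G in auto)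
    also have "(\<Sum>a\<in>F \<union> G. (if a \<in> G then d a else 0) * monomial a z) = q z"
      unfolding G(2) by (rule sum.mono_neutral_cong_right) (use F G in auto)
    finally show ?thesis .
  qed
  then have "(\<lambda>z. p z + q z) = (\<lambda>z. \<Sum>a\<in>F \<union> G. e a * monomial a z)"
    by simp
  then show ?thesis using F G by (simp add: polynomials_sum)
qed

lemma polynomials_monomial: "monomial a \<in> polynomials"
  using polynomials_sum[of "{a}" "\<lambda>_. 1"] by simp

lemma monomial_0 [simp]: "monomial 0 z = 1"
  by (simp add: monomial_def)

lemma monomial_add: "monomial (a + b) z = monomial a z * monomial b z"
  by (simp add: monomial_def power_add prod.distrib)

lemma polynomials_cmult:
  assumes "p \<in> polynomials"
  shows "(\<lambda>z. c * p z) \<in> polynomials"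
proof -
  obtain F d where F: "finite F" "p = (\<lambda>z. \<Sum>a\<in>F. d a * monomial a z)"
    using assms by (auto simp: polynomials_def)
  have "(\<lambda>z. c * p z) = (\<lambda>z. \<Sum>a\<in>F. (c * d a) * monomial a z)"
    unfolding F(2) by (simp add: sum_distrib_left mult.assoc)
  then show ?thesis using polynomials_sum[OF F(1)] by simp
qed

lemma polynomials_const: "(\<lambda>z. c) \<in> polynomials"
  using polynomials_cmult[OF polynomials_monomial[of 0], of c] by simp

lemma polynomials_finite_sum:
  "(\<And>k. k \<in> F \<Longrightarrow> f k \<in> polynomials) \<Longrightarrow> (\<lambda>z. \<Sum>k\<in>F. f k z) \<in> polynomials"
  by (induction F rule: infinite_finite_induct) (auto intro: polynomials_const polynomials_add)

lemma polynomials_induct [consumes 1, case_names monomial add cmult zero]: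
  assumes "p \<in> polynomials"
    and "\<And>a. P (monomial a)"
    and "\<And>p q. p \<in> polynomials \<Longrightarrow> q \<in> polynomials \<Longrightarrow> P p \<Longrightarrow> P q \<Longrightarrow> P (\<lambda>z. p z + q z)"
    and "\<And>p c. p \<in> polynomials \<Longrightarrow> P p \<Longrightarrow> P (\<lambda>z. c * p z)"
    and "P (\<lambda>z. 0)"
  shows "P p"
proof -
  obtain F c where F: "finite F" "p = (\<lambda>z. \<Sum>a\<in>F. c a * monomial a z)"
    using assms(1) by (auto simp: polynomials_def)
  have "P (\<lambda>z. \<Sum>a\<in>F. c a * monomial a z)"
    using F(1)
  proof (induction F)
    case (insert b F)
    then show ?case
      using assms(3)[OF polynomials_cmult[OF polynomials_monomial] polynomials_sum assms(4)[OF polynomials_monomial assms(2)]]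
      by simp
  qed (use assms(5) in simp)
  then show ?thesis using F by simp
qed

lemma polynomials_mult:
  assumes "p \<in> polynomials" "q \<in> polynomials"
  shows "(\<lambda>z. p z * q z) \<in> polynomials"
  using assms(1)
proof (induction rule: polynomials_induct)
  case (monomial a)
  show ?case using assms(2)
  proof (induction rule: polynomials_induct)
    case (monomial b)
    then show ?case using polynomials_monomial[of "a + b"] by (simp add: monomial_add[abs_def])
  next
    case (cmult p c)
    then show ?case using polynomials_cmult[of "\<lambda>z. monomial a z * p z" c] by (simp add: mult.left_commute)
  qed (auto simp: distrib_left polynomials_add polynomials_const)
qed (auto simp: distrib_right mult.assoc polynomials_add polynomials_cmult polynomials_const)

lemma polynomials_diff:
  assumes "p \<in> polynomials" "q \<in> polynomials"
  shows "(\<lambda>z. p z - q z) \<in> polynomials"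
  using polynomials_add[OF assms(1) polynomials_cmult[OF assms(2), of "-1"]] by simp

lemma polynomials_power: "p \<in> polynomials \<Longrightarrow> (\<lambda>z. p z ^ k) \<in> polynomials"
  by (induction k) (auto intro: polynomials_const polynomials_mult)

lemma polynomials_prod:
  "(\<And>k. k \<in> F \<Longrightarrow> f k \<in> polynomials) \<Longrightarrow> (\<lambda>z. \<Prod>k\<in>F. f k z) \<in> polynomials"
  by (induction F rule: infinite_finite_induct) (auto intro: polynomials_const polynomials_mult)

lemma polynomials_coord: "(\<lambda>z. z $ i) \<in> polynomials"
proof -
  have "monomial (axis i 1) z = z $ i" for z :: "complex ^ 'a"
  proof -
    have "monomial (axis i 1) z = (\<Prod>j\<in>UNIV. if j = i then z $ i else 1)"
      unfolding monomial_def by (rule prod.cong) (auto simp: axis_def)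
    then show ?thesis by simp
  qed
  then have "monomial (axis i 1) = (\<lambda>z. z $ i)" by (rule ext)
  then show ?thesis using polynomials_monomial[of "axis i 1"] by simp
qed

lemma polynomials_coord_poly: "(\<lambda>z. poly p (z $ i)) \<in> polynomials"
  unfolding poly_altdef
  by (intro polynomials_finite_sum polynomials_cmult polynomials_power polynomials_coord)

lemma polynomials_monomial_shift: "(\<lambda>z. monomial a (z - \<zeta>)) \<in> polynomials"
  unfolding monomial_def vector_minus_component
  by (intro polynomials_prod polynomials_power polynomials_diff polynomials_coord polynomials_const)

lemma holomorphic_several_const: "open U \<Longrightarrow> holomorphic_several (\<lambda>z. c) U"
  unfolding holomorphic_several_def by (auto intro!: exI[of _ "\<lambda>_. 0"] derivative_intros)

lemma holomorphic_several_add: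
  assumes "holomorphic_several f U" "holomorphic_several g U"
  shows "holomorphic_several (\<lambda>z. f z + g z) U"
  unfolding holomorphic_several_def
proof (intro conjI ballI)
  show "open U" using assms by (simp add: holomorphic_several_def)
  fix z assume z: "z \<in> U"
  obtain f' g' where "(f has_derivative f') (at z)" "\<forall>c v. f' (c *s v) = c * f' v"
    "(g has_derivative g') (at z)" "\<forall>c v. g' (c *s v) = c * g' v"
    using assms z by (fastforce simp: holomorphic_several_def)
  then show "\<exists>f'. ((\<lambda>z. f z + g z) has_derivative f') (at z) \<and> (\<forall>c v. f' (c *s v) = c * f' v)"
    by (intro exI[of _ "\<lambda>v. f' v + g' v"]) (auto intro!: derivative_intros simp: distrib_left)
qed

lemma holomorphic_several_mult:
  assumes "holomorphic_several f U" "holomorphic_several g U"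
  shows "holomorphic_several (\<lambda>z. f z * g z) U"
  unfolding holomorphic_several_def
proof (intro conjI ballI)
  show "open U" using assms by (simp add: holomorphic_several_def)
  fix z assume z: "z \<in> U"
  obtain f' g' where "(f has_derivative f') (at z)" "\<forall>c v. f' (c *s v) = c * f' v"
    "(g has_derivative g') (at z)" "\<forall>c v. g' (c *s v) = c * g' v"
    using assms z by (fastforce simp: holomorphic_several_def)
  then show "\<exists>f'. ((\<lambda>z. f z * g z) has_derivative f') (at z) \<and> (\<forall>c v. f' (c *s v) = c * f' v)"
    by (intro exI[of _ "\<lambda>v. f z * g' v + f' v * g z"])
      (auto intro!: derivative_eq_intros simp: algebra_simps)
qed

lemma holomorphic_several_subset:
  "holomorphic_several f U \<Longrightarrow> open V \<Longrightarrow> V \<subseteq> U \<Longrightarrow> holomorphic_several f V"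
  by (auto simp: holomorphic_several_def)

lemma holomorphic_several_coord: "open U \<Longrightarrow> holomorphic_several (\<lambda>z. z $ i) U"
  unfolding holomorphic_several_def
  by (intro conjI ballI exI[of _ "\<lambda>v. v $ i"])
    (auto intro!: bounded_linear_imp_has_derivative bounded_linear_vec_nth)

lemma holomorphic_several_monomial:
  assumes "open U"
  shows "holomorphic_several (monomial a) U"
proof -
  have pow: "holomorphic_several (\<lambda>z. z $ i ^ k) U" for i :: 'a and k
    by (induction k) (auto intro!: holomorphic_several_mult holomorphic_several_coord holomorphic_several_const assms)
  have "holomorphic_several (\<lambda>z. \<Prod>i\<in>I. z $ i ^ (a $ i)) U" if "finite I" for I
    using that by induction (auto intro!: holomorphic_several_mult pow holomorphic_several_const assms)
  then show ?thesis by (simp add: monomial_def[abs_def])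
qed

lemma holomorphic_several_polynomial:
  assumes "p \<in> polynomials" "open U"
  shows "holomorphic_several p U"
  using assms(1)
  by (induction rule: polynomials_induct)
    (auto intro!: holomorphic_several_add holomorphic_several_mult holomorphic_several_const
       holomorphic_several_monomial assms)

lemma sep_hol_polynomial: "p \<in> polynomials \<Longrightarrow> open U \<Longrightarrow> sep_hol p U"
  by (simp add: holomorphic_several_imp_sep_hol holomorphic_several_polynomial)

lemma continuous_on_polynomial: "p \<in> polynomials \<Longrightarrow> continuous_on A p"
  using sep_hol_polynomial[of p UNIV] sep_hol_continuous continuous_on_subset by blast

text \<open>All factors except the one with index \<open>i\<close> are constant in the direction of
  differentiation.\<close>

lemma partial_deriv_prod:
  fixes g :: "'n::finite \<Rightarrow> complex \<Rightarrow> complex"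
  assumes "g i holomorphic_on UNIV"
  shows "(partial_deriv i ^^ k) (\<lambda>z. \<Prod>j\<in>UNIV. g j (z $ j))
    = (\<lambda>z. \<Prod>j\<in>UNIV. (if j = i then (deriv ^^ k) (g i) else g j) (z $ j))"
proof (induction k)
  case 0
  show ?case by (auto intro!: ext prod.cong)
next
  case (Suc k)
  have split: "(\<Prod>j\<in>UNIV. (if j = i then h else g j) (z $ j)) = h (z $ i) * (\<Prod>j\<in>UNIV - {i}. g j (z $ j))"
    for h and z :: "complex ^ 'n"
    by (subst prod.remove[of _ i]) (auto intro!: prod.cong)
  have "partial_deriv i (\<lambda>z. (deriv ^^ k) (g i) (z $ i) * (\<Prod>j\<in>UNIV - {i}. g j (z $ j))) z
      = (deriv ^^ Suc k) (g i) (z $ i) * (\<Prod>j\<in>UNIV - {i}. g j (z $ j))" for z :: "complex ^ 'n"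
  proof -
    have "(deriv ^^ k) (g i) holomorphic_on UNIV"
      by (rule holomorphic_higher_deriv) (use assms in auto)
    then have "(deriv ^^ k) (g i) field_differentiable at (z $ i)"
      by (simp add: holomorphic_on_def)
    then have "deriv (\<lambda>w. (deriv ^^ k) (g i) w * c) (z $ i) = deriv ((deriv ^^ k) (g i)) (z $ i) * c" for c
      by (rule deriv_cmult_right)
    moreover have "(\<Prod>j\<in>UNIV - {i}. g j (upd z i w $ j)) = (\<Prod>j\<in>UNIV - {i}. g j (z $ j))" for w
      by (rule prod.cong) auto
    ultimately show ?thesis
      by (simp only: partial_deriv_upd) simp
  qed
  then show ?case by (simp add: Suc split)
qed

lemma coords_props: "distinct (coords :: 'n::finite list)" "set (coords :: 'n list) = UNIV"
proof -
  have "\<exists>xs::'n list. distinct xs \<and> set xs = UNIV"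
    using finite_distinct_list[OF finite[of "UNIV :: 'n set"]] by blast
  then have "distinct (coords :: 'n list) \<and> set (coords :: 'n list) = UNIV"
    unfolding coords_def by (rule someI_ex)
  then show "distinct (coords :: 'n list)" "set (coords :: 'n list) = UNIV" by auto
qed

text \<open>Induction over the listing with the coordinates already treated marked by
  \<open>set is\<close>; distinctness of \<open>coords\<close> ensures that no factor is
  differentiated twice.\<close>

lemma mixed_deriv_prod:
  fixes g :: "'n::finite \<Rightarrow> complex \<Rightarrow> complex"
  assumes "\<And>i. g i holomorphic_on UNIV"
  shows "mixed_deriv a (\<lambda>z. \<Prod>j\<in>UNIV. g j (z $ j)) z = (\<Prod>j\<in>UNIV. (deriv ^^ (a $ j)) (g j) (z $ j))"
proof -
  have "foldr (\<lambda>i. partial_deriv i ^^ (a $ i)) is (\<lambda>z. \<Prod>j\<in>UNIV. g j (z $ j))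
      = (\<lambda>z. \<Prod>j\<in>UNIV. (if j \<in> set is then (deriv ^^ (a $ j)) (g j) else g j) (z $ j))"
    if "distinct is" for "is"
    using that
  proof (induction "is")
    case (Cons i "is")
    have "(partial_deriv i ^^ (a $ i)) (\<lambda>z. \<Prod>j\<in>UNIV. (if j \<in> set is then (deriv ^^ (a $ j)) (g j) else g j) (z $ j))
      = (\<lambda>z. \<Prod>j\<in>UNIV. (if j = i then (deriv ^^ (a $ i)) ((\<lambda>j. if j \<in> set is then (deriv ^^ (a $ j)) (g j) else g j) i)
           else (\<lambda>j. if j \<in> set is then (deriv ^^ (a $ j)) (g j) else g j) j) (z $ j))"
      by (rule partial_deriv_prod) (use Cons assms in auto)
    also have "\<dots> = (\<lambda>z. \<Prod>j\<in>UNIV. (if j \<in> set (i # is) then (deriv ^^ (a $ j)) (g j) else g j) (z $ j))"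
      using Cons by (intro ext prod.cong) auto
    finally show ?case using Cons by simp
  qed auto
  then show ?thesis
    by (simp add: mixed_deriv_def coords_props)
qed

text \<open>For \<open>k > n\<close> the binomial coefficient vanishes, so the truncated exponent
  \<open>n - k\<close> does no harm and the formula needs no side condition.\<close>

lemma higher_deriv_power_at:
  "(deriv ^^ k) (\<lambda>w. w ^ n) z = (of_nat (n choose k) * fact k) * (z::complex) ^ (n - k)"
proof (cases "k \<le> n")
  case True
  have "(deriv ^^ k) (\<lambda>w. (w - 0) ^ n) z = pochhammer (of_nat (Suc n - k)) k * (z - 0) ^ (n - k)"
    by (rule higher_deriv_power)
  moreover have "pochhammer (of_nat (Suc n - k)) k = (of_nat (n choose k) * fact k :: complex)"
    using True by (simp add: binomial_gbinomial gbinomial_pochhammer' of_nat_diff Suc_diff_le add.commute)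
  ultimately show ?thesis by simp
next
  case False
  have "(deriv ^^ k) (\<lambda>w. (w - 0) ^ n) z = pochhammer (of_nat (Suc n - k)) k * (z - 0) ^ (n - k)"
    by (rule higher_deriv_power)
  moreover have "pochhammer (of_nat (Suc n - k)) k = (0::complex)"
    using False by (simp add: pochhammer_0_left)
  ultimately show ?thesis using False by simp
qed

lemma finite_vec_le: "finite {a :: nat ^ 'n::finite. \<forall>i. a $ i \<le> b $ i}"
proof -
  have "{a :: nat ^ 'n. \<forall>i. a $ i \<le> b $ i} \<subseteq> vec_lambda ` (PiE UNIV (\<lambda>i. {..b $ i}))"
  proof
    fix a :: "nat ^ 'n" assume "a \<in> {a. \<forall>i. a $ i \<le> b $ i}"
    then have "vec_nth a \<in> PiE UNIV (\<lambda>i. {..b $ i})" "a = vec_lambda (vec_nth a)"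
      by (auto simp: vec_lambda_eta)
    then show "a \<in> vec_lambda ` (PiE UNIV (\<lambda>i. {..b $ i}))" by blast
  qed
  moreover have "finite (PiE (UNIV :: 'n set) (\<lambda>i. {..b $ i}))"
    by (rule finite_PiE) auto
  ultimately show ?thesis using finite_subset finite_imageI by blast
qed

text \<open>For a monomial this is the binomial theorem in each coordinate; coefficients outside the
  box vanish, so any finite superset \<open>M\<close> gives the same sum. Allowing supersets adapts
  the result to an arbitrary enumeration of the multi-indices, and \<open>F\<close> is independent
  of the centre.\<close>

lemma polynomial_taylor:
  fixes p :: "complex ^ 'n::finite \<Rightarrow> complex"
  assumes "p \<in> polynomials"
  shows "\<exists>F. finite F \<and> (\<forall>M. finite M \<longrightarrow> F \<subseteq> M \<longrightarrow> (\<forall>\<zeta> z.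
    (\<Sum>a\<in>M. mixed_deriv a p \<zeta> / (\<Prod>i\<in>UNIV. fact (a $ i)) * monomial a (z - \<zeta>)) = p z))"
  using assms
proof (induction rule: polynomials_induct)
  case (monomial b)
  let ?F = "{a. \<forall>i. a $ i \<le> b $ i}"
  have md: "mixed_deriv a (monomial b) \<zeta> / (\<Prod>i\<in>UNIV. fact (a $ i))
      = (\<Prod>i\<in>UNIV. of_nat (b $ i choose a $ i) * \<zeta> $ i ^ (b $ i - a $ i))" for a and \<zeta> :: "complex ^ 'n"
  proof -
    have "mixed_deriv a (monomial b) \<zeta> = (\<Prod>i\<in>UNIV. (deriv ^^ (a $ i)) (\<lambda>w. w ^ (b $ i)) (\<zeta> $ i))"
      unfolding monomial_def[abs_def] by (rule mixed_deriv_prod) (auto intro!: holomorphic_intros)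
    then show ?thesis
      by (simp add: higher_deriv_power_at flip: prod_dividef)
  qed
  show ?case
  proof (intro exI[of _ ?F] conjI allI impI)
    show "finite ?F" by (rule finite_vec_le)
    fix M :: "(nat ^ 'n) set" and \<zeta> z :: "complex ^ 'n" assume M: "finite M" "?F \<subseteq> M"
    let ?t = "\<lambda>a. \<Prod>i\<in>UNIV. of_nat (b $ i choose a $ i) * \<zeta> $ i ^ (b $ i - a $ i) * (z $ i - \<zeta> $ i) ^ (a $ i)"
    have "(\<Sum>a\<in>M. mixed_deriv a (monomial b) \<zeta> / (\<Prod>i\<in>UNIV. fact (a $ i)) * monomial a (z - \<zeta>)) = (\<Sum>a\<in>M. ?t a)"
      unfolding md by (simp add: monomial_def prod.distrib)
    also have "\<dots> = (\<Sum>a\<in>?F. ?t a)"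
    proof (rule sum.mono_neutral_right[OF M])
      show "\<forall>a\<in>M - ?F. ?t a = 0"
      proof
        fix a assume "a \<in> M - ?F"
        then obtain i where "b $ i < a $ i" by (auto simp: not_le)
        then show "?t a = 0" by (intro prod_zero) (auto intro!: bexI[of _ i])
      qed
    qed
    \<comment> \<open>Multi-indices in the box are functions into intervals, so distributivity
      splits the sum into one binomial expansion per coordinate.\<close>
    also have "\<dots> = (\<Sum>h\<in>PiE UNIV (\<lambda>i. {..b $ i}).
        \<Prod>i\<in>UNIV. of_nat (b $ i choose h i) * \<zeta> $ i ^ (b $ i - h i) * (z $ i - \<zeta> $ i) ^ h i)"
      by (rule sum.reindex_bij_witness[of _ vec_lambda vec_nth]) (auto simp: vec_lambda_eta PiE_iff)
    also have "\<dots> = (\<Prod>i\<in>UNIV. \<Sum>k\<le>b $ i. of_nat (b $ i choose k) * \<zeta> $ i ^ (b $ i - k) * (z $ i - \<zeta> $ i) ^ k)"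
      by (rule prod_sum_PiE[symmetric]) auto
    also have "\<dots> = (\<Prod>i\<in>UNIV. z $ i ^ (b $ i))"
    proof (rule prod.cong[OF refl])
      fix i
      have "z $ i ^ (b $ i) = ((z $ i - \<zeta> $ i) + \<zeta> $ i) ^ (b $ i)" by simp
      also have "\<dots> = (\<Sum>k\<le>b $ i. of_nat (b $ i choose k) * (z $ i - \<zeta> $ i) ^ k * \<zeta> $ i ^ (b $ i - k))"
        by (rule binomial_ring)
      also have "\<dots> = (\<Sum>k\<le>b $ i. of_nat (b $ i choose k) * \<zeta> $ i ^ (b $ i - k) * (z $ i - \<zeta> $ i) ^ k)"
        by (simp add: mult_ac)
      finally show "(\<Sum>k\<le>b $ i. of_nat (b $ i choose k) * \<zeta> $ i ^ (b $ i - k) * (z $ i - \<zeta> $ i) ^ k) = z $ i ^ (b $ i)"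
        by (rule sym)
    qed
    finally show "(\<Sum>a\<in>M. mixed_deriv a (monomial b) \<zeta> / (\<Prod>i\<in>UNIV. fact (a $ i)) * monomial a (z - \<zeta>)) = monomial b z"
      by (simp add: monomial_def)
  qed
next
  case (add p q)
  obtain F where F: "finite F \<and> (\<forall>M. finite M \<longrightarrow> F \<subseteq> M \<longrightarrow> (\<forall>\<zeta> z.
      (\<Sum>a\<in>M. mixed_deriv a p \<zeta> / (\<Prod>i\<in>UNIV. fact (a $ i)) * monomial a (z - \<zeta>)) = p z))"
    using add.IH(1) by (rule exE)
  obtain G where G: "finite G \<and> (\<forall>M. finite M \<longrightarrow> G \<subseteq> M \<longrightarrow> (\<forall>\<zeta> z.
      (\<Sum>a\<in>M. mixed_deriv a q \<zeta> / (\<Prod>i\<in>UNIV. fact (a $ i)) * monomial a (z - \<zeta>)) = q z))"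
    using add.IH(2) by (rule exE)
  have "mixed_deriv a (\<lambda>z. p z + q z) \<zeta> = mixed_deriv a p \<zeta> + mixed_deriv a q \<zeta>" for a \<zeta>
    unfolding mixed_deriv_eq_pd by (rule pd_add[of _ UNIV]) (use add.hyps sep_hol_polynomial in auto)
  then show ?case
    using F G by (intro exI[of _ "F \<union> G"]) (simp add: add_divide_distrib distrib_right sum.distrib)
next
  case (cmult p c)
  obtain F where F: "finite F \<and> (\<forall>M. finite M \<longrightarrow> F \<subseteq> M \<longrightarrow> (\<forall>\<zeta> z.
      (\<Sum>a\<in>M. mixed_deriv a p \<zeta> / (\<Prod>i\<in>UNIV. fact (a $ i)) * monomial a (z - \<zeta>)) = p z))"
    using cmult.IH by (rule exE)
  have "mixed_deriv a (\<lambda>z. c * p z) \<zeta> = c * mixed_deriv a p \<zeta>" for a \<zeta>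
    unfolding mixed_deriv_eq_pd by (rule pd_cmult[of _ UNIV]) (use cmult.hyps sep_hol_polynomial in auto)
  then show ?case
  proof (intro exI[of _ F] conjI allI impI)
    fix M :: "(nat ^ 'n) set" and \<zeta> z :: "complex ^ 'n" assume M: "finite M" "F \<subseteq> M"
    have "(\<Sum>a\<in>M. c * mixed_deriv a p \<zeta> / (\<Prod>i\<in>UNIV. fact (a $ i)) * monomial a (z - \<zeta>))
      = c * (\<Sum>a\<in>M. mixed_deriv a p \<zeta> / (\<Prod>i\<in>UNIV. fact (a $ i)) * monomial a (z - \<zeta>))"
      unfolding sum_distrib_left by (rule sum.cong) auto
    then show "(\<Sum>a\<in>M. mixed_deriv a (\<lambda>z. c * p z) \<zeta> / (\<Prod>i\<in>UNIV. fact (a $ i)) * monomial a (z - \<zeta>)) = c * p z"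
      using F M \<open>\<And>a \<zeta>. mixed_deriv a (\<lambda>z. c * p z) \<zeta> = c * mixed_deriv a p \<zeta>\<close> by simp
  qed (use F in blast)
next
  case zero
  show ?case by (intro exI[of _ "{}"]) (auto simp: mixed_deriv_eq_pd pd_zero)
qed

section \<open>Polynomial approximation\<close>

subsection \<open>Uniform approximation by a class of functions\<close>

text \<open>The class \<open>S\<close> is left arbitrary because Runge's theorem in several
  variables passes through classes in which the given function still occurs, with some of its
  variables frozen.\<close>

definition approximable :: "('a \<Rightarrow> complex) set \<Rightarrow> 'a set \<Rightarrow> ('a \<Rightarrow> complex) \<Rightarrow> bool" where
  "approximable S X f \<longleftrightarrow> (\<forall>\<epsilon>>0. \<exists>g\<in>S. \<forall>x\<in>X. norm (f x - g x) < \<epsilon>)"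

definition add_closed :: "('a \<Rightarrow> complex) set \<Rightarrow> bool" where
  "add_closed S \<longleftrightarrow> (\<lambda>x. 0) \<in> S \<and> (\<forall>f\<in>S. \<forall>g\<in>S. (\<lambda>x. f x + g x) \<in> S)"

lemma approximableI_mem: "f \<in> S \<Longrightarrow> approximable S X f"
  unfolding approximable_def by (metis diff_self norm_zero)

lemma approximable_closed:
  assumes "\<And>\<epsilon>. \<epsilon> > 0 \<Longrightarrow> \<exists>g. approximable S X g \<and> (\<forall>x\<in>X. norm (f x - g x) < \<epsilon>)"
  shows "approximable S X f"
  unfolding approximable_def
proof (intro allI impI)
  fix \<epsilon> :: real assume "\<epsilon> > 0"
  then obtain g where g: "approximable S X g" "\<forall>x\<in>X. norm (f x - g x) < \<epsilon>/2"
    using assms[of "\<epsilon>/2"] by auto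
  obtain h where h: "h \<in> S" "\<forall>x\<in>X. norm (g x - h x) < \<epsilon>/2"
    using g(1) \<open>\<epsilon> > 0\<close> unfolding approximable_def by (meson half_gt_zero)
  have "norm (f x - h x) < \<epsilon>" if "x \<in> X" for x
    using g(2) h(2) that norm_triangle_ineq[of "f x - g x" "g x - h x"] by fastforce
  then show "\<exists>g\<in>S. \<forall>x\<in>X. norm (f x - g x) < \<epsilon>" using h(1) by blast
qed

lemma approximable_trans:
  assumes "approximable S X f" "\<And>g. g \<in> S \<Longrightarrow> approximable T X g"
  shows "approximable T X f"
  by (rule approximable_closed) (use assms in \<open>unfold approximable_def[of S], blast\<close>)

lemma approximable_add:
  assumes S: "add_closed S" and "approximable S X f" "approximable S X g"
  shows "approximable S X (\<lambda>x. f x + g x)"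
  unfolding approximable_def
proof (intro allI impI)
  fix \<epsilon> :: real assume "\<epsilon> > 0"
  then obtain f' g' where f': "f' \<in> S" "\<forall>x\<in>X. norm (f x - f' x) < \<epsilon>/2"
    and g': "g' \<in> S" "\<forall>x\<in>X. norm (g x - g' x) < \<epsilon>/2"
    using assms unfolding approximable_def by (meson half_gt_zero)
  have "norm (f x + g x - (f' x + g' x)) < \<epsilon>" if "x \<in> X" for x
    using f'(2) g'(2) that norm_triangle_ineq[of "f x - f' x" "g x - g' x"]
    by (fastforce simp: algebra_simps)
  then show "\<exists>h\<in>S. \<forall>x\<in>X. norm (f x + g x - h x) < \<epsilon>"
    using f' g' S unfolding add_closed_def by (intro bexI[of _ "\<lambda>x. f' x + g' x"]) auto
qed

lemma approximable_sum:
  assumes S: "add_closed S" and "\<And>k. k \<in> I \<Longrightarrow> approximable S X (f k)"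
  shows "approximable S X (\<lambda>x. \<Sum>k\<in>I. f k x)"
  using assms(2)
proof (induction I rule: infinite_finite_induct)
  case (insert k I)
  then show ?case using approximable_add[OF S, of X "f k" "\<lambda>x. \<Sum>k\<in>I. f k x"] by simp
qed (use S in \<open>auto intro!: approximableI_mem simp: add_closed_def\<close>)

lemma approximable_bounded_mult:
  assumes "approximable S X f" and M: "\<And>x. x \<in> X \<Longrightarrow> norm (h x) \<le> M"
    and "\<And>g. g \<in> S \<Longrightarrow> (\<lambda>x. h x * g x) \<in> T"
  shows "approximable T X (\<lambda>x. h x * f x)"
  unfolding approximable_def
proof (intro allI impI)
  fix \<epsilon> :: real assume "\<epsilon> > 0"
  then have "\<epsilon> / (\<bar>M\<bar> + 1) > 0" by simp
  then obtain g where g: "g \<in> S" "\<forall>x\<in>X. norm (f x - g x) < \<epsilon> / (\<bar>M\<bar> + 1)"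
    using assms(1) unfolding approximable_def by blast
  have "norm (h x * f x - h x * g x) < \<epsilon>" if "x \<in> X" for x
  proof -
    have "norm (h x * f x - h x * g x) = norm (h x) * norm (f x - g x)"
      by (metis norm_mult right_diff_distrib)
    also have "\<dots> \<le> \<bar>M\<bar> * norm (f x - g x)"
      using M[OF that] by (intro mult_right_mono) auto
    also have "\<dots> \<le> \<bar>M\<bar> * (\<epsilon> / (\<bar>M\<bar> + 1))"
      using g(2) that by (intro mult_left_mono) (auto intro: less_imp_le)
    also have "\<dots> < \<epsilon>" using \<open>\<epsilon> > 0\<close> by (simp add: field_simps)
    finally show ?thesis .
  qed
  then show "\<exists>g\<in>T. \<forall>x\<in>X. norm (h x * f x - g x) < \<epsilon>"
    by (intro bexI[OF _ assms(3)[OF g(1)]]) simp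
qed

text \<open>Sums alone suffice as closure: the generating sets used below absorb constants into
  their polynomial factor.\<close>

inductive_set additive_span :: "('a \<Rightarrow> complex) set \<Rightarrow> ('a \<Rightarrow> complex) set" for G where
  zero: "(\<lambda>x. 0) \<in> additive_span G"
| gen: "g \<in> G \<Longrightarrow> f \<in> additive_span G \<Longrightarrow> (\<lambda>x. g x + f x) \<in> additive_span G"

lemma additive_span_base: "g \<in> G \<Longrightarrow> g \<in> additive_span G"
  using additive_span.gen[OF _ additive_span.zero] by fastforce

lemma add_closed_additive_span: "add_closed (additive_span G)"
proof -
  have "(\<lambda>x. f x + g x) \<in> additive_span G" if "f \<in> additive_span G" "g \<in> additive_span G" for f g
    using that by induction (auto simp: add.assoc intro: additive_span.gen)
  then show ?thesis by (auto simp: add_closed_def intro: additive_span.zero)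
qed

lemma approximable_additive_span:
  assumes T: "add_closed T" and "\<And>g. g \<in> G \<Longrightarrow> approximable T X g" and "f \<in> additive_span G"
  shows "approximable T X f"
  using assms(3)
proof induction
  case zero
  then show ?case using T by (auto intro!: approximableI_mem simp: add_closed_def)
next
  case (gen g f)
  then show ?case using assms(2) by (auto intro!: approximable_add[OF T])
qed

subsection \<open>Moving poles\<close>

abbreviation polys :: "(complex \<Rightarrow> complex) set" where "polys \<equiv> range poly"

lemma polys_mult: "f \<in> polys \<Longrightarrow> g \<in> polys \<Longrightarrow> (\<lambda>x. f x * g x) \<in> polys"
  by (auto simp: fun_eq_iff simp flip: poly_mult)

lemma add_closed_polys: "add_closed polys"
  unfolding add_closed_def
proof (intro conjI ballI)
  show "(\<lambda>x. 0) \<in> polys" by (metis poly_0 rangeI ext)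
  fix f g assume "f \<in> polys" "g \<in> polys"
  then show "(\<lambda>x. f x + g x) \<in> polys" by (auto simp: fun_eq_iff simp flip: poly_add)
qed

lemma approximable_polys_mult:
  assumes "approximable polys X f" "approximable polys X g"
    and f: "\<And>x. x \<in> X \<Longrightarrow> norm (f x) \<le> M" and g: "\<And>x. x \<in> X \<Longrightarrow> norm (g x) \<le> M'"
  shows "approximable polys X (\<lambda>x. f x * g x)"
proof (rule approximable_closed)
  fix \<epsilon> :: real assume "\<epsilon> > 0"
  then have *: "\<epsilon> / (\<bar>M\<bar> + 1) > 0" by simp
  \<comment> \<open>The cap 1 keeps \<open>q\<close> bounded by \<open>M' + 1\<close> on
    \<open>X\<close>, so that multiplying approximants of \<open>f\<close> by \<open>q\<close> is
    harmless.\<close>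
  define \<delta> where "\<delta> = min 1 (\<epsilon> / (\<bar>M\<bar> + 1))"
  have "\<delta> > 0" using * by (simp add: \<delta>_def)
  then obtain q where q: "q \<in> polys" "\<forall>x\<in>X. norm (g x - q x) < \<delta>"
    using assms(2) unfolding approximable_def by blast
  have "norm (q x) \<le> M' + 1" if "x \<in> X" for x
  proof -
    have "norm (q x) \<le> norm (g x) + norm (g x - q x)"
      using norm_triangle_sub[of "q x" "g x"] by (simp add: norm_minus_commute)
    also have "\<dots> \<le> M' + 1" using g[OF that] q(2) that by (intro add_mono) (auto simp: \<delta>_def intro: less_imp_le)
    finally show ?thesis .
  qed
  then have "approximable polys X (\<lambda>x. q x * f x)"
    using approximable_bounded_mult[OF assms(1) _ polys_mult[OF q(1)]] by blast
  moreover have "norm (f x * g x - q x * f x) < \<epsilon>" if "x \<in> X" for x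
  proof -
    have "norm (f x * g x - q x * f x) = norm (f x) * norm (g x - q x)"
      by (metis norm_mult right_diff_distrib mult.commute)
    also have "\<dots> \<le> \<bar>M\<bar> * norm (g x - q x)"
      using f[OF that] by (intro mult_right_mono) auto
    also have "\<dots> \<le> \<bar>M\<bar> * (\<epsilon> / (\<bar>M\<bar> + 1))"
      using q(2) that by (intro mult_left_mono) (auto simp: \<delta>_def intro: less_imp_le)
    also have "\<dots> < \<epsilon>" using \<open>\<epsilon> > 0\<close> by (simp add: field_simps)
    finally show ?thesis .
  qed
  ultimately show "\<exists>h. approximable polys X h \<and> (\<forall>x\<in>X. norm (f x * g x - h x) < \<epsilon>)" by blast
qed

text \<open>Partial sums of the geometric series; a single \<open>r < 1\<close> on all of
  \<open>V\<close> makes the remainder uniform. It serves twice: to expand a distant pole in powers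
  of \<open>z\<close>, and to shift a pole by a small step.\<close>

lemma approximable_polys_geometric:
  assumes x: "approximable polys V x" and r: "\<And>z. z \<in> V \<Longrightarrow> norm (x z) \<le> r" and "r < 1"
  shows "approximable polys V (\<lambda>z. 1 / (1 - x z))"
proof (cases "V = {}")
  case True
  then show ?thesis using add_closed_polys unfolding approximable_def add_closed_def by blast
next
  case False
  then have "r \<ge> 0" using r norm_ge_zero order_trans by blast
  have one: "(\<lambda>z. 1) \<in> polys" by (rule range_eqI[of _ _ 1]) auto
  have pow: "approximable polys V (\<lambda>z. x z ^ k) \<and> (\<forall>z\<in>V. norm (x z ^ k) \<le> 1)" for k
  proof (induction k)
    case (Suc k)
    have "approximable polys V (\<lambda>z. x z * x z ^ k)"
      by (rule approximable_polys_mult[OF x, of _ r 1]) (use Suc r in auto)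
    moreover have "norm (x z * x z ^ k) \<le> 1" if "z \<in> V" for z
      using r[OF that] \<open>r < 1\<close> by (simp add: norm_mult norm_power power_le_one mult_le_one)
    ultimately show ?case by simp
  qed (auto intro: approximableI_mem[OF one])
  show ?thesis
  proof (rule approximable_closed)
    fix \<epsilon> :: real assume "\<epsilon> > 0"
    have "(\<lambda>n. r ^ n) \<longlonglongrightarrow> 0" using \<open>r \<ge> 0\<close> \<open>r < 1\<close> by (simp add: LIMSEQ_power_zero)
    then obtain n where n: "r ^ n < \<epsilon> * (1 - r)"
      using \<open>\<epsilon> > 0\<close> \<open>r < 1\<close> order_tendstoD(2)[of "\<lambda>n. r ^ n" 0 sequentially "\<epsilon> * (1 - r)"]
      by (auto simp: eventually_sequentially)
    have "norm (1 / (1 - x z) - (\<Sum>k<n. x z ^ k)) < \<epsilon>" if "z \<in> V" for z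
    proof -
      have lt: "norm (x z) < 1" using r[OF that] \<open>r < 1\<close> by simp
      then have "x z \<noteq> 1" by auto
      then have "1 / (1 - x z) - (\<Sum>k<n. x z ^ k) = x z ^ n / (1 - x z)"
        by (simp add: sum_gp_strict field_simps)
      then have "norm (1 / (1 - x z) - (\<Sum>k<n. x z ^ k)) = norm (x z) ^ n / norm (1 - x z)"
        by (simp add: norm_divide norm_power)
      also have "\<dots> \<le> r ^ n / (1 - r)"
        using r[OF that] \<open>r < 1\<close> \<open>r \<ge> 0\<close> norm_triangle_ineq2[of 1 "x z"]
        by (intro frac_le power_mono) auto
      also have "\<dots> < \<epsilon>" using n \<open>r < 1\<close> by (simp add: field_simps)
      finally show ?thesis .
    qed
    moreover have "approximable polys V (\<lambda>z. \<Sum>k<n. x z ^ k)"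
      by (rule approximable_sum[OF add_closed_polys]) (use pow in blast)
    ultimately show "\<exists>g. approximable polys V g \<and> (\<forall>z\<in>V. norm (1 / (1 - x z) - g z) < \<epsilon>)" by blast
  qed
qed

lemma approximable_polys_cmult:
  assumes "approximable polys V f"
  shows "approximable polys V (\<lambda>z. c * f z)"
proof (rule approximable_bounded_mult[OF assms, of _ "norm c"])
  fix g assume "g \<in> polys"
  moreover have "(\<lambda>z. c) \<in> polys" by (rule range_eqI[of _ _ "[:c:]"]) auto
  ultimately show "(\<lambda>z. c * g z) \<in> polys" using polys_mult by blast
qed auto

text \<open>Pole pushing. At \<open>w0\<close>, farther out than \<open>V\<close>, the function
  expands in powers of \<open>z / w0\<close>; steps that are short compared with the distance
  \<open>\<delta>\<close> to \<open>V\<close> preserve approximability, and connectedness of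
  \<open>C\<close> chains them together.\<close>

lemma approximable_inverse_pole:
  assumes C: "connected C" and \<delta>: "\<delta> > 0" "\<And>w z. w \<in> C \<Longrightarrow> z \<in> V \<Longrightarrow> \<delta> \<le> norm (w - z)"
    and w0: "w0 \<in> C" "norm w0 > R" and R: "\<And>z. z \<in> V \<Longrightarrow> norm z \<le> R" and "w \<in> C"
  shows "approximable polys V (\<lambda>z. 1 / (w - z))"
proof (rule connected_induction_simple[OF C w0(1) \<open>w \<in> C\<close>, where P = "\<lambda>w. approximable polys V (\<lambda>z. 1 / (w - z))"])
  show "approximable polys V (\<lambda>z. 1 / (w0 - z))"
  proof (cases "V = {}")
    case True
    then show ?thesis using add_closed_polys unfolding approximable_def add_closed_def by blast
  next
    case False
    then have "R \<ge> 0" using R norm_ge_zero order_trans by blast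
    then have "w0 \<noteq> 0" using w0 by auto
    have "(\<lambda>z. z / w0) \<in> polys" by (rule range_eqI[of _ _ "[:0, 1 / w0:]"]) auto
    then have "approximable polys V (\<lambda>z. 1 / (1 - z / w0))"
      by (intro approximable_polys_geometric[of _ _ "R / norm w0"] approximableI_mem)
        (use w0 R \<open>w0 \<noteq> 0\<close> in \<open>auto simp: norm_divide divide_simps\<close>)
    then have "approximable polys V (\<lambda>z. (1 / w0) * (1 / (1 - z / w0)))"
      by (rule approximable_polys_cmult)
    moreover have "(\<lambda>z. (1 / w0) * (1 / (1 - z / w0))) = (\<lambda>z. 1 / (w0 - z))"
      using \<open>w0 \<noteq> 0\<close> by (auto simp: fun_eq_iff divide_simps)
    ultimately show ?thesis by simp
  qed
next
  fix a assume "a \<in> C"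
  have "approximable polys V (\<lambda>z. 1 / (v - z))"
    if "approximable polys V (\<lambda>z. 1 / (u - z))" "u \<in> C \<inter> ball a (\<delta>/4)" "v \<in> C \<inter> ball a (\<delta>/4)" for u v
  proof -
    \<comment> \<open>Two points of \<open>ball a (\<delta>/4)\<close> differ by at most half of the
      guaranteed distance to \<open>V\<close>, so the ratio \<open>(u - v) / (u - z)\<close> of the
      geometric series is at most 1/2.\<close>
    have uv: "norm (u - v) \<le> \<delta>/2"
      using that(2,3) dist_triangle2[of u v a] by (simp add: dist_norm norm_minus_commute)
    have bd: "norm (1 / (u - z)) \<le> 1 / \<delta>" "norm ((u - v) * (1 / (u - z))) \<le> 1/2"
      "u - z \<noteq> 0" "v - z \<noteq> 0" if "z \<in> V" for z
    proof -
      have *: "\<delta> \<le> norm (u - z)" "\<delta> \<le> norm (v - z)" using \<delta>(2) \<open>z \<in> V\<close> \<open>u \<in> _\<close> \<open>v \<in> _\<close> by auto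
      then show "norm (1 / (u - z)) \<le> 1 / \<delta>" using \<delta>(1) by (simp add: norm_divide frac_le)
      show "norm ((u - v) * (1 / (u - z))) \<le> 1/2"
        using * \<delta>(1) uv by (simp add: norm_mult norm_divide divide_simps)
      show "u - z \<noteq> 0" "v - z \<noteq> 0" using * \<delta>(1) by auto
    qed
    have "approximable polys V (\<lambda>z. 1 / (1 - (u - v) * (1 / (u - z))))"
      by (rule approximable_polys_geometric[OF approximable_polys_cmult[OF that(1)] bd(2)]) auto
    moreover have "norm (1 / (1 - (u - v) * (1 / (u - z)))) \<le> 2" if "z \<in> V" for z
    proof -
      have "1/2 \<le> norm (1 - (u - v) * (1 / (u - z)))"
        using bd(2)[OF that] norm_triangle_ineq2[of 1 "(u - v) * (1 / (u - z))"] by simp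
      then show ?thesis unfolding norm_divide by (simp add: divide_simps split: if_splits)
    qed
    ultimately have "approximable polys V (\<lambda>z. (1 / (u - z)) * (1 / (1 - (u - v) * (1 / (u - z)))))"
      using bd(1) by (intro approximable_polys_mult[OF that(1)]) auto
    moreover have "(1 / (u - z)) * (1 / (1 - (u - v) * (1 / (u - z)))) = 1 / (v - z)" if "z \<in> V" for z
      using bd(3,4)[OF that] by (simp add: divide_simps)
    ultimately show ?thesis
      unfolding approximable_def by simp
  qed
  then show "\<exists>T. openin (top_of_set C) T \<and> a \<in> T \<and>
      (\<forall>x\<in>T. \<forall>y\<in>T. approximable polys V (\<lambda>z. 1 / (x - z)) \<longrightarrow> approximable polys V (\<lambda>z. 1 / (y - z)))"
    using \<open>a \<in> C\<close> \<delta>(1) by (intro exI[of _ "C \<inter> ball a (\<delta>/4)"]) auto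
qed

subsection \<open>A Cauchy kernel for a compact set with connected complement\<close>

text \<open>Finitely many closed balls cover \<open>K\<close>, and paths to one base point tie them
  together. Unlike \<open>U\<close> itself, the result has positive distance from compact sets
  disjoint from it, as pole pushing requires.\<close>

lemma compact_connected_superset:
  fixes U :: "'a::euclidean_space set"
  assumes "open U" "connected U" "compact K" "K \<subseteq> U"
  obtains C where "compact C" "connected C" "K \<subseteq> C" "C \<subseteq> U"
proof (cases "K = {}")
  case True
  then show ?thesis using that[of "{}"] by auto
next
  case False
  then obtain a where a: "a \<in> K" "a \<in> U" using assms by blast
  have "\<exists>r>0. cball x r \<subseteq> U" if "x \<in> K" for x
    using that assms open_contains_cball by blast
  then obtain r where r: "\<And>x. x \<in> K \<Longrightarrow> r x > 0 \<and> cball x (r x) \<subseteq> U" by metis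
  have "K \<subseteq> (\<Union>x\<in>K. ball x (r x))" using r by force
  then obtain D where D: "D \<subseteq> K" "finite D" "K \<subseteq> (\<Union>x\<in>D. ball x (r x))"
    using compactE_image[OF assms(3), of K "\<lambda>x. ball x (r x)"] by auto
  have "path_connected U" using assms by (simp add: connected_open_path_connected)
  then have "\<exists>g. path g \<and> path_image g \<subseteq> U \<and> pathstart g = a \<and> pathfinish g = x" if "x \<in> D" for x
    using a that D(1) assms(4) unfolding path_connected_def by blast
  then obtain g where g: "\<And>x. x \<in> D \<Longrightarrow> path (g x) \<and> path_image (g x) \<subseteq> U \<and> pathstart (g x) = a \<and> pathfinish (g x) = x"
    by metis
  define C where "C = (\<Union>x\<in>D. cball x (r x) \<union> path_image (g x))"
  have ax: "a \<in> path_image (g x)" "x \<in> path_image (g x)" if "x \<in> D" for x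
    using g[OF that] by (metis pathstart_in_path_image pathfinish_in_path_image)+
  have "compact C" unfolding C_def using D(2) g by (intro compact_UN compact_Un compact_path_image) auto
  moreover have "connected C"
    unfolding C_def
  proof (rule connected_Union)
    fix S assume "S \<in> (\<lambda>x. cball x (r x) \<union> path_image (g x)) ` D"
    then obtain x where x: "x \<in> D" "S = cball x (r x) \<union> path_image (g x)" by blast
    have "x \<in> cball x (r x)" using r x D by (auto intro: less_imp_le)
    then have "cball x (r x) \<inter> path_image (g x) \<noteq> {}"
      using ax[OF x(1)] by blast
    then show "connected S" unfolding x(2)
      using g[OF x(1)] by (intro connected_Un connected_path_image) auto
  next
    show "\<Inter> ((\<lambda>x. cball x (r x) \<union> path_image (g x)) ` D) \<noteq> {}"
      using ax by blast
  qed
  moreover have "K \<subseteq> C"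
    using D(3) UN_mono[OF subset_refl, of D "\<lambda>x. ball x (r x)" "\<lambda>x. cball x (r x) \<union> path_image (g x)"]
    unfolding C_def by (meson ball_subset_cball le_supI1 subset_trans)
  moreover have "C \<subseteq> U" unfolding C_def using r g D(1) by blast
  ultimately show ?thesis using that by blast
qed

lemma compact_between:
  fixes U :: "'a::euclidean_space set"
  assumes "compact K" "open U" "K \<subseteq> U"
  obtains V A where "open V" "compact A" "K \<subseteq> V" "V \<subseteq> A" "A \<subseteq> U"
proof -
  obtain C :: "nat \<Rightarrow> 'a set" where C: "\<And>n. compact (C n)" "\<And>n. C n \<subseteq> U" "\<And>n. C n \<subseteq> interior (C (Suc n))"
    "\<And>K. compact K \<Longrightarrow> K \<subseteq> U \<Longrightarrow> \<exists>N. \<forall>n\<ge>N. K \<subseteq> C n"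
    using open_Union_compact_subsets[OF assms(2)] by metis
  obtain N where "K \<subseteq> C N" using C(4)[OF assms(1,3)] by blast
  then show ?thesis
    using that[of "interior (C (Suc N))" "C (Suc N)"] C interior_subset by blast
qed

text \<open>A compact connected set off \<open>K\<close>, containing a large circle and the part of
  the disc outside \<open>U\<close>, is carved out of the disc. The complement of what remains is
  this set glued to the exterior of the disc along the circle, hence connected.\<close>

lemma bounded_open_superset_connected_compl:
  fixes K :: "complex set"
  assumes "compact K" "open U" "K \<subseteq> U" "connected (- K)"
  obtains W where "open W" "bounded W" "connected (- W)" "K \<subseteq> W" "W \<subseteq> U"
proof -
  obtain R where R: "R > 0" "K \<subseteq> ball 0 R"
    using bounded_subset_ballD[OF compact_imp_bounded[OF assms(1)], of 0] by blast
  have "compact (sphere 0 R \<union> (cball 0 R - U))"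
    using assms(2) by (intro compact_Un compact_diff) auto
  moreover have "sphere 0 R \<union> (cball 0 R - U) \<subseteq> - K" using R assms by auto
  ultimately obtain C where C: "compact C" "connected C" "sphere 0 R \<union> (cball 0 R - U) \<subseteq> C" "C \<subseteq> - K"
    using compact_connected_superset[of "- K"] assms by (metis compact_imp_closed open_Compl)
  define W where "W = ball 0 R - C"
  have "- W = - ball 0 R \<union> C" unfolding W_def by auto
  moreover have "connected (- ball (0::complex) R \<union> C)"
  proof (rule connected_Un)
    show "connected (- ball (0::complex) R)"
      by (intro path_connected_imp_connected path_connected_complement_bounded_convex) auto
    have "of_real R \<in> sphere (0::complex) R" using R by simp
    then have "complex_of_real R \<in> C" "complex_of_real R \<in> - ball 0 R" using C(3) by auto
    then show "- ball 0 R \<inter> C \<noteq> {}" by blast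
  qed (fact C(2))
  ultimately have "connected (- W)" by simp
  moreover have "open W" unfolding W_def using C(1) compact_imp_closed by (intro open_Diff) auto
  moreover have "bounded W" unfolding W_def by (meson bounded_ball bounded_diff)
  moreover have "K \<subseteq> W" unfolding W_def using R(2) C(4) by blast
  moreover have "W \<subseteq> U" unfolding W_def using C(3) ball_subset_cball[of 0 R] by blast
  ultimately show ?thesis using that by blast
qed

text \<open>Cauchy's formula on a circle in the unit disc, pulled back by the Riemann map. Stating
  it with a weight \<open>w\<close> on \<open>{0..1}\<close> avoids winding numbers of the image
  curve, and the vanishing for \<open>z\<close> outside \<open>B\<close> allows kernels of several
  components to be added.\<close>

lemma cauchy_kernel_simply_connected:
  fixes B K :: "complex set"
  assumes B: "open B" "simply_connected B" "B \<noteq> UNIV" "B \<noteq> {}" and K: "compact K" "K \<subseteq> B"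
  obtains V c w where "open V" "K \<subseteq> V" "V \<subseteq> B"
    "continuous_on {0..1} c" "continuous_on {0..1} w" "c ` {0..1} \<subseteq> B - V"
    "\<And>f z. f holomorphic_on B \<Longrightarrow> z \<in> V \<Longrightarrow> ((\<lambda>t. w t * f (c t) / (c t - z)) has_integral f z) {0..1}"
    "\<And>f z. f holomorphic_on B \<Longrightarrow> z \<notin> B \<Longrightarrow> ((\<lambda>t. w t * f (c t) / (c t - z)) has_integral 0) {0..1::real}"
proof -
  obtain \<phi> \<psi> where \<phi>: "\<phi> holomorphic_on B" and \<psi>: "\<psi> holomorphic_on ball 0 1"
    and \<phi>B: "\<And>z. z \<in> B \<Longrightarrow> \<phi> z \<in> ball 0 1 \<and> \<psi> (\<phi> z) = z"
    and \<psi>D: "\<And>u. u \<in> ball 0 1 \<Longrightarrow> \<psi> u \<in> B \<and> \<phi> (\<psi> u) = u"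
  proof -
    have "\<exists>\<phi> \<psi>. \<phi> holomorphic_on B \<and> \<psi> holomorphic_on ball 0 1 \<and>
      (\<forall>z\<in>B. \<phi> z \<in> ball 0 1 \<and> \<psi> (\<phi> z) = z) \<and> (\<forall>u\<in>ball 0 1. \<psi> u \<in> B \<and> \<phi> (\<psi> u) = u)"
      using Riemann_mapping_theorem[of B] B by blast
    then show ?thesis using that by blast
  qed
  have "compact (\<phi> ` K)"
    using K holomorphic_on_imp_continuous_on[OF holomorphic_on_subset[OF \<phi> K(2)]]
    by (simp add: compact_continuous_image)
  moreover have "\<phi> ` K \<subseteq> ball 0 1" using \<phi>B K by auto
  ultimately obtain r0 where r0: "r0 < 1" "\<phi> ` K \<subseteq> ball 0 r0"
  proof -
    assume a: "compact (\<phi> ` K)" "\<phi> ` K \<subseteq> ball 0 1" and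
      th: "\<And>r0. r0 < 1 \<Longrightarrow> \<phi> ` K \<subseteq> ball 0 r0 \<Longrightarrow> thesis"
    show thesis
    proof (cases "\<phi> ` K = {}")
      case True
      then show ?thesis using th[of 0] by auto
    next
      case False
      then obtain x where x: "x \<in> \<phi> ` K" "\<forall>y\<in>\<phi> ` K. norm y \<le> norm x"
        using continuous_attains_sup[OF a(1), of norm] continuous_on_norm_id by blast
      then have "norm x < 1" using a(2) by auto
      then show ?thesis using th[of "(norm x + 1) / 2"] x by force
    qed
  qed
  have \<psi>im: "\<psi> ` ball 0 1 \<subseteq> B" using \<psi>D by blast
  \<comment> \<open>The bound 1/2 makes the radius positive also when \<open>r0\<close> is not. The
    number \<open>s\<close> lies midway between \<open>r\<close> and 1, so the circle surrounds the
    image of \<open>K\<close> inside the unit disc.\<close>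
  define r where "r = max r0 (1/2)"
  have r: "0 < r" "r < 1" "\<phi> ` K \<subseteq> ball 0 r" using r0 by (auto simp: r_def)
  define s where "s = (1 + r) / 2"
  have s: "r < s" "s < 1" "0 < s" using r by (auto simp: s_def)
  define V where "V = {z \<in> B. \<phi> z \<in> ball 0 r}"
  define c where "c t = \<psi> (circlepath 0 s t)" for t
  \<comment> \<open>The derivative of \<open>\<psi>\<close> times that of the circle, with the
    factor \<open>2 * pi * \<i>\<close> of Cauchy's formula already divided out.\<close>
  define w where "w t = deriv \<psi> (circlepath 0 s t) * (s * exp (2 * of_real pi * \<i> * of_real t))" for t
  have circ: "circlepath 0 s t \<in> ball 0 1 \<and> norm (circlepath 0 s t) = s" for t
    using s by (simp add: circlepath norm_mult)
  have cont_circ: "continuous_on {0..1} (circlepath 0 s)"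
    by (metis path_circlepath path_def)
  have \<psi>': "deriv \<psi> holomorphic_on ball 0 1"
    using \<psi> by (simp add: holomorphic_deriv)
  have conv: "((\<lambda>t. g (circlepath 0 s t) * (s * exp (2 * of_real pi * \<i> * of_real t))) has_integral y / (2 * pi * \<i>)) {0..1}"
    if "(g has_contour_integral y) (circlepath 0 s)" for g y
  proof -
    have "((\<lambda>t. g (circlepath 0 s t) * vector_derivative (circlepath 0 s) (at t within {0..1})) has_integral y) {0..1}"
      using that by (simp add: has_contour_integral_def)
    then have "((\<lambda>t. 1 / (2 * pi * \<i>) * (g (circlepath 0 s t) * vector_derivative (circlepath 0 s) (at t within {0..1})))
        has_integral 1 / (2 * pi * \<i>) * y) {0..1}"
      by (rule has_integral_mult_right)
    then show ?thesis
      by (rule has_integral_eq_rhs[OF has_integral_eq, rotated]) (auto simp: vector_derivative_circlepath01 field_simps)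
  qed
  show ?thesis
  proof (rule that[of V c w])
    show "open V"
      unfolding V_def using continuous_open_preimage[OF holomorphic_on_imp_continuous_on[OF \<phi>] B(1), of "ball 0 r"]
      by (simp add: vimage_def Int_def)
    show "K \<subseteq> V" "V \<subseteq> B" using K r by (auto simp: V_def)
    show "continuous_on {0..1} c"
      unfolding c_def by (rule continuous_on_compose2[OF holomorphic_on_imp_continuous_on[OF \<psi>] cont_circ]) (use circ in blast)
    have "continuous_on {0..1} (\<lambda>t. deriv \<psi> (circlepath 0 s t))"
      by (rule continuous_on_compose2[OF holomorphic_on_imp_continuous_on[OF \<psi>'] cont_circ]) (use circ in blast)
    then show "continuous_on {0..1} w" unfolding w_def by (intro continuous_intros)
    show "c ` {0..1} \<subseteq> B - V"
    proof (rule image_subsetI)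
      fix t
      have "\<psi> (circlepath 0 s t) \<in> B \<and> \<phi> (\<psi> (circlepath 0 s t)) = circlepath 0 s t" using \<psi>D circ by blast
      then show "c t \<in> B - V" using circ[of t] s by (auto simp: c_def V_def)
    qed
  next
    fix f z assume f: "f holomorphic_on B" and z: "z \<in> V"
    define u0 where "u0 = \<phi> z"
    have u0: "norm u0 < r" "u0 \<in> ball 0 1" "\<psi> u0 = z" using z \<phi>B by (auto simp: V_def u0_def)
    \<comment> \<open>Here \<open>\<psi> u - z\<close> equals \<open>h u * (u - u0)\<close>, and
      \<open>h\<close> has no zeros because \<open>\<psi>\<close> is injective; the transported
      integrand is thus \<open>G u / (u - u0)\<close> with \<open>G u0 = f z\<close>, and Cauchy's
      formula on the circle applies.\<close>
    define h where "h u = (if u = u0 then deriv \<psi> u0 else (\<psi> u - \<psi> u0) / (u - u0))" for u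
    have h: "h holomorphic_on ball 0 1"
      unfolding h_def by (rule pole_lemma_open[OF \<psi>]) auto
    have inj: "inj_on \<psi> (ball 0 1)" by (metis \<psi>D inj_onI)
    have h0: "h u \<noteq> 0" if "u \<in> ball 0 1" for u
    proof (cases "u = u0")
      case True
      then show ?thesis using holomorphic_injective_imp_regular[OF \<psi> open_ball inj u0(2)] by (simp add: h_def)
    next
      case False
      then show ?thesis using inj_onD[OF inj _ that u0(2)] by (auto simp: h_def)
    qed
    define G where "G u = f (\<psi> u) * deriv \<psi> u / h u" for u
    have f\<psi>: "(\<lambda>u. f (\<psi> u)) holomorphic_on ball 0 1"
      using holomorphic_on_compose_gen[OF \<psi> f \<psi>im] by (simp add: o_def)
    have G: "G holomorphic_on ball 0 1"
      unfolding G_def by (intro holomorphic_on_divide holomorphic_on_mult h h0 \<psi>' f\<psi>)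
    have "G u0 = f z" using h0[OF u0(2)] u0 by (simp add: G_def h_def)
    moreover have "((\<lambda>u. G u / (u - u0)) has_contour_integral (2 * of_real pi * \<i> * G u0)) (circlepath 0 s)"
    proof (rule Cauchy_integral_circlepath_simple)
      show "G holomorphic_on cball 0 s" by (rule holomorphic_on_subset[OF G]) (use s in auto)
    qed (use u0 s in auto)
    ultimately have "((\<lambda>t. G (circlepath 0 s t) / (circlepath 0 s t - u0) * (s * exp (2 * of_real pi * \<i> * of_real t)))
        has_integral f z) {0..1}"
      using conv by fastforce
    then show "((\<lambda>t. w t * f (c t) / (c t - z)) has_integral f z) {0..1}"
    proof (rule has_integral_eq[rotated])
      fix t :: real
      have ne: "circlepath 0 s t \<noteq> u0" using circ[of t] u0 s by auto
      moreover have "\<psi> (circlepath 0 s t) \<noteq> z"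
        using inj_onD[OF inj _ _ u0(2), of "circlepath 0 s t"] circ[of t] ne u0(3) by auto
      ultimately show "G (circlepath 0 s t) / (circlepath 0 s t - u0) * (s * exp (2 * of_real pi * \<i> * of_real t))
          = w t * f (c t) / (c t - z)"
        unfolding G_def h_def w_def c_def u0(3) by (simp add: divide_simps)
    qed
  next
    fix f z assume f: "f holomorphic_on B" and z: "z \<notin> B"
    have f\<psi>: "(\<lambda>u. f (\<psi> u)) holomorphic_on ball 0 1"
      using holomorphic_on_compose_gen[OF \<psi> f \<psi>im] by (simp add: o_def)
    \<comment> \<open>For \<open>z\<close> outside \<open>B\<close> the transported integrand has no
      pole in the unit disc, so Cauchy's theorem gives 0.\<close>
    have "\<psi> u - z \<noteq> 0" if "u \<in> ball 0 1" for u using \<psi>D[OF that] z by auto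
    then have "(\<lambda>u. f (\<psi> u) * deriv \<psi> u / (\<psi> u - z)) holomorphic_on ball 0 1"
      by (intro holomorphic_on_divide holomorphic_on_mult holomorphic_on_diff holomorphic_on_const \<psi> \<psi>' f\<psi>)
    then have "((\<lambda>u. f (\<psi> u) * deriv \<psi> u / (\<psi> u - z)) has_contour_integral 0) (circlepath 0 s)"
      by (rule Cauchy_theorem_disc_simple) (use s in auto)
    from conv[OF this]
    show "((\<lambda>t. w t * f (c t) / (c t - z)) has_integral 0) {0..1}"
      by (rule has_integral_eq_rhs[OF has_integral_eq, rotated]) (auto simp: w_def c_def mult_ac)
  qed
qed

text \<open>A component of a bounded open set with connected complement is simply connected;
  finitely many components cover \<open>K\<close>, and each brings its own kernel. The components
  themselves serve as summation index.\<close>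

lemma cauchy_kernel:
  fixes K U :: "complex set"
  assumes "compact K" "open U" "K \<subseteq> U" "connected (- K)"
  obtains V c w and I :: "complex set set" where "open V" "K \<subseteq> V" "V \<subseteq> U" "finite I"
    "\<And>B. B \<in> I \<Longrightarrow> continuous_on {0..1} (c B)" "\<And>B. B \<in> I \<Longrightarrow> continuous_on {0..1} (w B)"
    "\<And>B. B \<in> I \<Longrightarrow> c B ` {0..1::real} \<subseteq> U - V"
    "\<And>f z. f holomorphic_on U \<Longrightarrow> z \<in> V \<Longrightarrow>
      (\<Sum>B\<in>I. integral {0..1} (\<lambda>t. w B t * f (c B t) / (c B t - z))) = f z"
proof -
  obtain W where W: "open W" "bounded W" "connected (- W)" "K \<subseteq> W" "W \<subseteq> U"
    using bounded_open_superset_connected_compl[OF assms] by blast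
  have comp: "open B" "connected B" "B \<noteq> {}" "B \<subseteq> W" if "B \<in> components W" for B
    using that W(1) open_components in_components_connected in_components_nonempty in_components_subset by blast+
  have sc: "simply_connected B" "B \<noteq> UNIV" if "B \<in> components W" for B
  proof -
    have bd: "bounded B" using comp(4)[OF that] W(2) bounded_subset by blast
    moreover have "connected (- B)"
      using component_complement_connected[OF W(3)] that by simp
    ultimately show "simply_connected B"
      using simply_connected_iff_simple comp[OF that] by blast
    show "B \<noteq> UNIV" using bd not_bounded_UNIV by blast
  qed
  obtain I where I: "I \<subseteq> components W" "finite I" "K \<subseteq> \<Union> I"
    using compactE[OF assms(1), of "components W"] W(4) comp(1) Union_components by metis
  have disj: "B \<inter> B' = {}" if "B \<in> I" "B' \<in> I" "B \<noteq> B'" for B B'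
    using that I(1) components_eq by blast
  have KB: "compact (K \<inter> B)" if "B \<in> I" for B
  proof -
    have "x \<notin> B'" if "x \<in> B" "B' \<in> I - {B}" for x B'
      using disj[OF \<open>B \<in> I\<close>, of B'] that by auto
    \<comment> \<open>Removing the other open components leaves \<open>K \<inter> B\<close>, which
      is therefore compact although \<open>B\<close> is open.\<close>
    then have "K \<inter> B = K - \<Union> (I - {B})" using I(3) \<open>B \<in> I\<close> by auto
    moreover have "open (\<Union> (I - {B}))" using comp(1) I(1) by (intro open_Union) auto
    ultimately show ?thesis using compact_diff[OF assms(1)] by simp
  qed
  define Q where "Q B V c w \<longleftrightarrow> open V \<and> K \<inter> B \<subseteq> V \<and> V \<subseteq> B \<and>
      continuous_on {0..1} c \<and> continuous_on {0..1} w \<and> c ` {0..1::real} \<subseteq> B - V \<and>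
      (\<forall>f z. f holomorphic_on B \<longrightarrow> z \<in> V \<longrightarrow> ((\<lambda>t. w t * f (c t) / (c t - z)) has_integral f z) {0..1}) \<and>
      (\<forall>f z. f holomorphic_on B \<longrightarrow> z \<notin> B \<longrightarrow> ((\<lambda>t. w t * f (c t) / (c t - z)) has_integral 0) {0..1})"
    for B V c w
  have "\<exists>V c w. Q B V c w" if BI: "B \<in> I" for B
  proof -
    have B: "B \<in> components W" using BI I(1) by blast
    obtain V c w where "open V" "K \<inter> B \<subseteq> V" "V \<subseteq> B"
      "continuous_on {0..1} c" "continuous_on {0..1} w" "c ` {0..1::real} \<subseteq> B - V"
      "\<And>f z. f holomorphic_on B \<Longrightarrow> z \<in> V \<Longrightarrow> ((\<lambda>t. w t * f (c t) / (c t - z)) has_integral f z) {0..1}"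
      "\<And>f z. f holomorphic_on B \<Longrightarrow> z \<notin> B \<Longrightarrow> ((\<lambda>t. w t * f (c t) / (c t - z)) has_integral 0) {0..1}"
      using cauchy_kernel_simply_connected[OF comp(1)[OF B] sc[OF B] comp(3)[OF B] KB[OF BI] Int_lower2]
      by blast
    then have "Q B V c w" unfolding Q_def by simp
    then show ?thesis by blast
  qed
  then obtain V c w where "\<And>B. B \<in> I \<Longrightarrow> Q B (V B) (c B) (w B)" by metis
  note * = this[unfolded Q_def]
  have VB: "V B \<subseteq> B" and cB: "c B ` {0..1} \<subseteq> B - V B" and KV: "K \<inter> B \<subseteq> V B" and oV: "open (V B)"
    if "B \<in> I" for B using *[OF that] by simp_all
  have BU: "B \<subseteq> U" if "B \<in> I" for B
    using that I(1) comp(4) W(5) by (meson subsetD subset_trans)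
  show ?thesis
  proof (rule that[of "\<Union>B\<in>I. V B" I c w])
    show "finite I" by (rule I(2))
    show "continuous_on {0..1} (c B)" "continuous_on {0..1} (w B)" if "B \<in> I" for B
      using *[OF that] by simp_all
    show "open (\<Union>B\<in>I. V B)" by (intro open_UN ballI oV)
    show "K \<subseteq> (\<Union>B\<in>I. V B)"
    proof
      fix x assume "x \<in> K"
      then obtain B where "B \<in> I" "x \<in> B" using I(3) by auto
      then show "x \<in> (\<Union>B\<in>I. V B)" using KV[of B] \<open>x \<in> K\<close> by auto
    qed
    show "(\<Union>B\<in>I. V B) \<subseteq> U"
    proof (intro UN_least)
      show "V B \<subseteq> U" if "B \<in> I" for B using VB[OF that] BU[OF that] by (rule subset_trans)
    qed
    show "c B ` {0..1} \<subseteq> U - (\<Union>B\<in>I. V B)" if "B \<in> I" for B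
    proof
      fix x assume x: "x \<in> c B ` {0..1}"
      then have xB: "x \<in> B - V B" using cB[OF that] by (rule subsetD[rotated])
      have "x \<notin> V B'" if B': "B' \<in> I" for B'
      proof (cases "B = B'")
        case False
        then show ?thesis using xB disj[OF \<open>B \<in> I\<close> B'] VB[OF B'] by auto
      qed (use xB in simp)
      moreover have "x \<in> U" using xB BU[OF that] by auto
      ultimately show "x \<in> U - (\<Union>B\<in>I. V B)" by simp
    qed
    fix f z assume f: "f holomorphic_on U" and "z \<in> (\<Union>B\<in>I. V B)"
    then obtain B0 where B0: "B0 \<in> I" "z \<in> V B0" by (elim UN_E)
    have fB: "f holomorphic_on B" if "B \<in> I" for B
      using f BU[OF that] holomorphic_on_subset by blast
    \<comment> \<open>Only the kernel of the component containing \<open>z\<close> reproduces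
      \<open>f z\<close>; the others give 0 because \<open>z\<close> lies outside their
      components.\<close>
    have "integral {0..1} (\<lambda>t. w B t * f (c B t) / (c B t - z)) = (if B = B0 then f z else 0)" if "B \<in> I" for B
    proof (cases "B = B0")
      case True
      then show ?thesis using *[OF that] fB[OF that] B0 by (simp add: integral_unique)
    next
      case False
      have "z \<in> B0" by (rule subsetD[OF VB[OF B0(1)] B0(2)])
      then have "z \<notin> B" using disj[OF that B0(1) False] by auto
      then show ?thesis using *[OF that] fB[OF that] False by (simp add: integral_unique)
    qed
    then show "(\<Sum>B\<in>I. integral {0..1} (\<lambda>t. w B t * f (c B t) / (c B t - z))) = f z"
      using B0 I(2) by simp
  qed
qed

subsection \<open>Runge's theorem on products of planar compact sets\<close>

text \<open>Uniform continuity on the compact product makes left-endpoint sums converge uniformly in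
  the parameter, each subinterval adding at most \<open>1 / real n * (\<epsilon>/2)\<close> to the
  error. A Cauchy integral thereby becomes a uniform limit of finite combinations of
  kernels.\<close>

lemma riemann_sum_uniform:
  fixes H :: "real \<times> 'a::metric_space \<Rightarrow> complex"
  assumes X: "compact X" and H: "continuous_on ({0..1} \<times> X) H" and "\<epsilon> > 0"
  shows "\<exists>n>0. \<forall>x\<in>X. norm (integral {0..1} (\<lambda>t. H (t, x)) - (\<Sum>k<n. H (real k / real n, x)) / of_nat n) < \<epsilon>"
proof -
  have "uniformly_continuous_on ({0..1} \<times> X) H"
    using H X by (intro compact_uniformly_continuous compact_Times) auto
  then obtain \<delta> where \<delta>: "\<delta> > 0"
    "\<And>p q. p \<in> {0..1} \<times> X \<Longrightarrow> q \<in> {0..1} \<times> X \<Longrightarrow> dist q p < \<delta> \<Longrightarrow> dist (H q) (H p) < \<epsilon>/2"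
    unfolding uniformly_continuous_on_def using \<open>\<epsilon> > 0\<close> by (metis half_gt_zero)
  obtain n :: nat where n: "n > 0" "1 / real n < \<delta>"
    using \<delta>(1) nat_approx_posE by (metis of_nat_0_less_iff zero_less_Suc)
  have bound: "norm (integral {0..real m / real n} (\<lambda>t. H (t, x)) - (\<Sum>k<m. H (real k / real n, x)) / of_nat n)
      \<le> real m / real n * (\<epsilon>/2)" if "m \<le> n" "x \<in> X" for m x
    using that(1)
  proof (induction m)
    case (Suc m)
    let ?a = "real m / real n" and ?b = "real (Suc m) / real n"
    have ab: "0 \<le> ?a" "?a \<le> ?b" "?b \<le> 1" "?b - ?a = 1 / real n"
      using Suc.prems n(1) by (auto simp: field_simps)
    have cont: "continuous_on {0..1} (\<lambda>t. H (t, x))"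
      by (rule continuous_on_compose2[OF H]) (use that(2) in \<open>auto intro!: continuous_intros\<close>)
    have int: "(\<lambda>t. H (t, x)) integrable_on {c..d}" if "0 \<le> c" "d \<le> 1" for c d
      by (rule integrable_continuous_real[OF continuous_on_subset[OF cont]]) (use that in auto)
    have "norm (integral {?a..?b} (\<lambda>t. H (t, x) - H (?a, x))) \<le> \<epsilon>/2 * (?b - ?a)"
    proof (rule integral_bound)
      show "continuous_on {?a..?b} (\<lambda>t. H (t, x) - H (?a, x))"
        by (intro continuous_intros continuous_on_subset[OF cont]) (use ab in auto)
      fix t assume t: "t \<in> {?a..?b}"
      have "dist (t, x) (?a, x) < \<delta>"
        using t ab(4) n(2) by (simp add: dist_Pair_Pair dist_real_def)
      then have "dist (H (t, x)) (H (?a, x)) < \<epsilon>/2"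
        using \<delta>(2)[of "(?a, x)" "(t, x)"] t ab that(2) order_trans[OF ab(1), of t] by auto
      then show "norm (H (t, x) - H (?a, x)) \<le> \<epsilon>/2" by (simp add: dist_norm)
    qed (use ab in auto)
    moreover have "integral {?a..?b} (\<lambda>t. H (t, x) - H (?a, x))
        = integral {?a..?b} (\<lambda>t. H (t, x)) - H (?a, x) / of_nat n"
    proof -
      have "integral {?a..?b} (\<lambda>t. H (t, x) - H (?a, x))
          = integral {?a..?b} (\<lambda>t. H (t, x)) - integral {?a..?b} (\<lambda>t. H (?a, x))"
        by (rule integral_diff) (use int[OF ab(1,3)] in auto)
      also have "integral {?a..?b} (\<lambda>t. H (?a, x)) = (?b - ?a) *\<^sub>R H (?a, x)"
        using ab by simp
      finally show ?thesis unfolding ab(4) by (simp add: scaleR_conv_of_real)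
    qed
    ultimately have step: "norm (integral {?a..?b} (\<lambda>t. H (t, x)) - H (?a, x) / of_nat n) \<le> 1 / real n * (\<epsilon>/2)"
      using ab(4) by simp
    have "integral {0..?b} (\<lambda>t. H (t, x)) = integral {0..?a} (\<lambda>t. H (t, x)) + integral {?a..?b} (\<lambda>t. H (t, x))"
      by (rule Henstock_Kurzweil_Integration.integral_combine[symmetric]) (use int[OF order_refl ab(3)] ab in auto)
    then have "integral {0..?b} (\<lambda>t. H (t, x)) - (\<Sum>k<Suc m. H (real k / real n, x)) / of_nat n
        = (integral {0..?a} (\<lambda>t. H (t, x)) - (\<Sum>k<m. H (real k / real n, x)) / of_nat n)
        + (integral {?a..?b} (\<lambda>t. H (t, x)) - H (?a, x) / of_nat n)"
      by (simp add: add_divide_distrib)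
    then have "norm (integral {0..?b} (\<lambda>t. H (t, x)) - (\<Sum>k<Suc m. H (real k / real n, x)) / of_nat n)
        \<le> real m / real n * (\<epsilon>/2) + 1 / real n * (\<epsilon>/2)"
      using norm_triangle_le[OF add_mono[OF Suc.IH step]] Suc.prems by simp
    also have "\<dots> = ?b * (\<epsilon>/2)" by (simp add: add_divide_distrib distrib_right)
    finally show ?case .
  qed simp
  have "norm (integral {0..1} (\<lambda>t. H (t, x)) - (\<Sum>k<n. H (real k / real n, x)) / of_nat n) < \<epsilon>" if "x \<in> X" for x
    using bound[OF order_refl that] n(1) \<open>\<epsilon> > 0\<close> by simp
  then show ?thesis using n(1) by blast
qed

text \<open>The sets \<open>V\<close> and \<open>A\<close> depend neither on \<open>F\<close> nor on the parameters \<open>\<theta>\<close>; this is what lets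
  the variables be treated one at a time below.\<close>

lemma runge_parametric:
  fixes K U :: "complex set"
  assumes "compact K" "open U" "K \<subseteq> U" "connected (- K)"
  shows "\<exists>V A. open V \<and> compact A \<and> K \<subseteq> V \<and> V \<subseteq> A \<and> A \<subseteq> U \<and>
    (\<forall>(\<Theta> :: 'p::metric_space set) F. compact \<Theta> \<longrightarrow> continuous_on (\<Theta> \<times> U) (\<lambda>x. F (fst x) (snd x)) \<longrightarrow>
      (\<forall>\<theta>\<in>\<Theta>. F \<theta> holomorphic_on U) \<longrightarrow>
      approximable (additive_span {\<lambda>x. F (fst x) c * poly p (snd x) | c p. c \<in> A}) (\<Theta> \<times> V) (\<lambda>x. F (fst x) (snd x)))"
proof (rule cauchy_kernel[OF assms])
  fix V1 c w and I :: "complex set set"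
  assume V1: "open V1" "K \<subseteq> V1" "V1 \<subseteq> U" "finite I"
    "\<And>B. B \<in> I \<Longrightarrow> continuous_on {0..1} (c B)" "\<And>B. B \<in> I \<Longrightarrow> continuous_on {0..1} (w B)"
    "\<And>B. B \<in> I \<Longrightarrow> c B ` {0..1::real} \<subseteq> U - V1"
    "\<And>f z. f holomorphic_on U \<Longrightarrow> z \<in> V1 \<Longrightarrow>
      (\<Sum>B\<in>I. integral {0..1} (\<lambda>t. w B t * f (c B t) / (c B t - z))) = f z"
  define \<Gamma> where "\<Gamma> = (\<Union>B\<in>I. c B ` {0..1})"
  have \<Gamma>: "compact \<Gamma>" "\<Gamma> \<subseteq> U - V1"
    unfolding \<Gamma>_def using V1(4) by (intro compact_UN compact_continuous_image V1(5)) (auto dest: subsetD[OF V1(7)])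
  obtain R where R: "R > 0" "K \<subseteq> ball 0 R"
    using bounded_subset_ballD[OF compact_imp_bounded[OF assms(1)], of 0] by blast
  define p0 where "p0 = complex_of_real (R + 1)"
  have p0: "norm p0 > R" using R by (simp add: p0_def)
  \<comment> \<open>One compact connected set off \<open>K\<close> carries all kernel nodes and a
    point of large modulus, so every pole on \<open>\<Gamma>\<close> can be pushed out at the same
    distance \<open>\<delta>\<close> from \<open>V\<close>.\<close>
  have "compact (insert p0 \<Gamma>)" "insert p0 \<Gamma> \<subseteq> - K"
    using \<Gamma> R p0 V1(2) by auto
  then obtain C where C: "compact C" "connected C" "insert p0 \<Gamma> \<subseteq> C" "C \<subseteq> - K"
    using compact_connected_superset[of "- K"] assms by (metis compact_imp_closed open_Compl)
  have "open (V1 \<inter> ball 0 R \<inter> - C)" "K \<subseteq> V1 \<inter> ball 0 R \<inter> - C"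
    using V1 R C compact_imp_closed[OF C(1)] by (auto intro!: open_Int)
  then obtain V A' where VA: "open V" "compact A'" "K \<subseteq> V" "V \<subseteq> A'" "A' \<subseteq> V1 \<inter> ball 0 R \<inter> - C"
    using compact_between[OF assms(1)] by metis
  have "A' \<inter> C = {}" using VA(5) by blast
  then obtain \<delta> where \<delta>: "\<delta> > 0" "\<And>x y. x \<in> A' \<Longrightarrow> y \<in> C \<Longrightarrow> \<delta> \<le> dist x y"
    using separate_compact_closed[OF VA(2) compact_imp_closed[OF C(1)]] by blast
  \<comment> \<open>The nodes in \<open>\<Gamma>\<close> are the values at which a variable gets
    frozen, and \<open>A'\<close> makes \<open>A\<close> contain \<open>V\<close>; thus free and
    frozen variables range over one compact set.\<close>
  define A where "A = A' \<union> \<Gamma>"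
  have pole: "approximable polys V (\<lambda>z. 1 / (v - z))" if "v \<in> \<Gamma>" for v
  proof (rule approximable_inverse_pole[OF C(2) \<delta>(1) _ _ p0])
    show "\<delta> \<le> norm (u - z)" if "u \<in> C" "z \<in> V" for u z
      using \<delta>(2)[of z u] that VA(4) by (auto simp: dist_norm norm_minus_commute)
    show "norm z \<le> R" if "z \<in> V" for z
      using that VA(4,5) by (force intro: less_imp_le)
  qed (use C(3) that in auto)
  show ?thesis
  proof (rule exI[of _ V], rule exI[of _ A], intro conjI allI impI)
    show "A \<subseteq> U" "compact A" "V \<subseteq> A"
      using VA \<Gamma> V1(3) by (auto simp: A_def)
    fix \<Theta> :: "'p set" and F :: "'p \<Rightarrow> complex \<Rightarrow> complex"
    assume \<Theta>: "compact \<Theta>" and F: "continuous_on (\<Theta> \<times> U) (\<lambda>x. F (fst x) (snd x))"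
      and hol: "\<forall>\<theta>\<in>\<Theta>. F \<theta> holomorphic_on U"
    define S where "S = additive_span {\<lambda>x. F (fst x) c * poly p (snd x) | c p. c \<in> A}"
    define H where "H B y = w B (fst y) * F (fst (snd y)) (c B (fst y)) / (c B (fst y) - snd (snd y))" for B y
    have H: "continuous_on ({0..1} \<times> (\<Theta> \<times> A')) (H B)" if "B \<in> I" for B
    proof -
      have cB: "continuous_on ({0..1} \<times> (\<Theta> \<times> A')) (\<lambda>y. c B (fst y))"
        by (rule continuous_on_compose2[OF V1(5)[OF that]]) (auto intro!: continuous_intros)
      have wB: "continuous_on ({0..1} \<times> (\<Theta> \<times> A')) (\<lambda>y. w B (fst y))"
        by (rule continuous_on_compose2[OF V1(6)[OF that]]) (auto intro!: continuous_intros)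
      have "continuous_on ({0..1} \<times> (\<Theta> \<times> A')) (\<lambda>y. (\<lambda>x. F (fst x) (snd x)) (fst (snd y), c B (fst y)))"
      proof (rule continuous_on_compose2[OF F])
        show "continuous_on ({0..1} \<times> (\<Theta> \<times> A')) (\<lambda>y. (fst (snd y), c B (fst y)))"
          by (intro continuous_intros cB)
        show "(\<lambda>y. (fst (snd y), c B (fst y))) ` ({0..1} \<times> (\<Theta> \<times> A')) \<subseteq> \<Theta> \<times> U"
          using V1(7)[OF that] by auto
      qed
      moreover have "c B (fst y) - snd (snd y) \<noteq> 0" if "y \<in> {0..1} \<times> (\<Theta> \<times> A')" for y
      proof -
        have "c B (fst y) \<notin> V1" using V1(7)[OF \<open>B \<in> I\<close>] that by auto
        moreover have "snd (snd y) \<in> V1" using that VA(5) by auto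
        ultimately show ?thesis by auto
      qed
      ultimately show ?thesis
        unfolding H_def by (intro continuous_intros cB wB) auto
    qed
    have add: "add_closed S" unfolding S_def by (rule add_closed_additive_span)
    have "approximable S (\<Theta> \<times> V) (\<lambda>x. \<Sum>B\<in>I. integral {0..1} (\<lambda>t. H B (t, x)))"
    proof (rule approximable_sum[OF add])
      fix B assume B: "B \<in> I"
      show "approximable S (\<Theta> \<times> V) (\<lambda>x. integral {0..1} (\<lambda>t. H B (t, x)))"
      proof (rule approximable_closed)
        fix \<epsilon> :: real assume "\<epsilon> > 0"
        obtain n where n: "n > 0" "\<And>x. x \<in> \<Theta> \<times> A' \<Longrightarrow> norm (integral {0..1} (\<lambda>t. H B (t, x))
            - (\<Sum>k<n. H B (real k / real n, x)) / of_nat n) < \<epsilon>"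
          using riemann_sum_uniform[OF compact_Times[OF \<Theta> VA(2)] H[OF B] \<open>\<epsilon> > 0\<close>] by blast
        have "approximable S (\<Theta> \<times> V) (\<lambda>x. \<Sum>k<n. H B (real k / real n, x) / of_nat n)"
        proof (rule approximable_sum[OF add])
          fix k assume "k \<in> {..<n}"
          define t where "t = real k / real n"
          have t: "t \<in> {0..1}" using \<open>k \<in> _\<close> by (simp add: t_def)
          have c: "c B t \<in> \<Gamma>" unfolding \<Gamma>_def using B t by blast
          have "continuous_on \<Theta> (\<lambda>\<theta>. (\<lambda>x. F (fst x) (snd x)) (\<theta>, c B t))"
            by (rule continuous_on_compose2[OF F]) (use c \<Gamma> in \<open>auto intro!: continuous_intros\<close>)
          then have "compact ((\<lambda>\<theta>. F \<theta> (c B t)) ` \<Theta>)" using \<Theta> by (simp add: compact_continuous_image)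
          then obtain M where M: "\<And>\<theta>. \<theta> \<in> \<Theta> \<Longrightarrow> norm (F \<theta> (c B t)) \<le> M"
            using compact_imp_bounded bounded_iff by (metis imageI)
          \<comment> \<open>At a fixed node the kernel is a bounded function of the parameter times
            the inverse of a linear function of the variable; only the latter has to be
            approximated.\<close>
          have "approximable ((\<lambda>p x. p (snd x)) ` polys) (\<Theta> \<times> V) (\<lambda>x. (w B t / of_nat n) * (1 / (c B t - snd x)))"
            using approximable_polys_cmult[OF pole[OF c], of "w B t / of_nat n"]
            unfolding approximable_def by (simp add: mem_Times_iff)
          then have "approximable S (\<Theta> \<times> V) (\<lambda>x. F (fst x) (c B t) * ((w B t / of_nat n) * (1 / (c B t - snd x))))"
          proof (rule approximable_bounded_mult[where M = M])
            show "norm (F (fst x) (c B t)) \<le> M" if "x \<in> \<Theta> \<times> V" for x using M that by auto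
            fix g :: "'p \<times> complex \<Rightarrow> complex" assume "g \<in> (\<lambda>p x. p (snd x)) ` polys"
            then obtain p where "g = (\<lambda>x. poly p (snd x))" by auto
            then show "(\<lambda>x. F (fst x) (c B t) * g x) \<in> S"
              unfolding S_def using c by (intro additive_span_base) (auto simp: A_def)
          qed
          then show "approximable S (\<Theta> \<times> V) (\<lambda>x. H B (real k / real n, x) / of_nat n)"
            by (simp add: H_def t_def[symmetric] mult_ac)
        qed
        moreover have "\<forall>x\<in>\<Theta> \<times> V. norm (integral {0..1} (\<lambda>t. H B (t, x)) - (\<Sum>k<n. H B (real k / real n, x) / of_nat n)) < \<epsilon>"
          using n(2) VA(4) by (auto simp: sum_divide_distrib)
        ultimately show "\<exists>g. approximable S (\<Theta> \<times> V) g \<and> (\<forall>x\<in>\<Theta> \<times> V. norm (integral {0..1} (\<lambda>t. H B (t, x)) - g x) < \<epsilon>)"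
          by (intro exI conjI)
      qed
    qed
    moreover have "(\<Sum>B\<in>I. integral {0..1} (\<lambda>t. H B (t, x))) = F (fst x) (snd x)" if "x \<in> \<Theta> \<times> V" for x
      unfolding H_def using V1(8)[of "F (fst x)" "snd x"] that hol VA(4,5) by auto
    ultimately show "approximable S (\<Theta> \<times> V) (\<lambda>x. F (fst x) (snd x))"
      unfolding approximable_def by simp
  qed (use VA in auto)
qed

text \<open>Runge's theorem for the function that is 0 near \<open>K\<close> and 1 near
  \<open>L\<close>. The open sets are fixed before \<open>\<epsilon>\<close>, which leaves room for
  Cauchy estimates with constants independent of \<open>\<epsilon>\<close>.\<close>

lemma runge_separation:
  fixes K L :: "complex set"
  assumes "compact K" "compact L" "K \<inter> L = {}" "connected (- (K \<union> L))"
  shows "\<exists>V W. open V \<and> open W \<and> K \<subseteq> V \<and> L \<subseteq> W \<and>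
    (\<forall>\<epsilon>>0. \<exists>p. (\<forall>z\<in>V. norm (poly p z) < \<epsilon>) \<and> (\<forall>z\<in>W. norm (1 - poly p z) < \<epsilon>))"
proof -
  obtain U1 U2 where U: "open U1" "open U2" "K \<subseteq> U1" "L \<subseteq> U2" "U1 \<inter> U2 = {}"
    using separation_normal[OF compact_imp_closed[OF assms(1)] compact_imp_closed[OF assms(2)] assms(3)] by blast
  \<comment> \<open>The parameter is a dummy and takes the single value 0.\<close>
  define F where "F (\<theta>::real) w = (if w \<in> U2 then 1 else 0 :: complex)" for \<theta> w
  have F: "F \<theta> holomorphic_on U1 \<union> U2" for \<theta>
  proof (rule holomorphic_on_Un)
    show "F \<theta> holomorphic_on U1"
      by (rule holomorphic_transform[OF holomorphic_on_const[of 0]]) (use U(5) in \<open>auto simp: F_def\<close>)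
    show "F \<theta> holomorphic_on U2"
      by (rule holomorphic_transform[OF holomorphic_on_const[of 1]]) (auto simp: F_def)
  qed (use U in auto)
  obtain V A where VA: "open V" "compact A" "K \<union> L \<subseteq> V" "V \<subseteq> A" "A \<subseteq> U1 \<union> U2"
    and appr: "\<forall>(\<Theta> :: real set) F. compact \<Theta> \<longrightarrow> continuous_on (\<Theta> \<times> (U1 \<union> U2)) (\<lambda>x. F (fst x) (snd x)) \<longrightarrow>
      (\<forall>\<theta>\<in>\<Theta>. F \<theta> holomorphic_on U1 \<union> U2) \<longrightarrow>
      approximable (additive_span {\<lambda>x. F (fst x) c * poly p (snd x) | c p. c \<in> A}) (\<Theta> \<times> V) (\<lambda>x. F (fst x) (snd x))"
    using runge_parametric[where 'p = real, OF compact_Un[OF assms(1,2)] open_Un[OF U(1,2)] Un_mono[OF U(3,4)] assms(4)]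
    by (elim exE conjE) (rule that)
  have "continuous_on (U1 \<union> U2) (F 0)" using F holomorphic_on_imp_continuous_on by blast
  then have "continuous_on ({0::real} \<times> (U1 \<union> U2)) (\<lambda>x. F 0 (snd x))"
    by (rule continuous_on_compose2) (auto intro!: continuous_intros)
  then have "continuous_on ({0} \<times> (U1 \<union> U2)) (\<lambda>x. F (fst x) (snd x))"
    by (rule continuous_on_eq) auto
  then have ap: "approximable (additive_span {\<lambda>x. F (fst x) c * poly p (snd x) | c p. c \<in> A}) ({0} \<times> V) (\<lambda>x. F (fst x) (snd x))"
    by (intro appr[rule_format]) (use F in auto)
  have span: "\<exists>p. \<forall>z. f (0, z) = poly p z" if "f \<in> additive_span {\<lambda>x. F (fst x) c * poly p (snd x) | c p. c \<in> A}" for f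
    using that
  proof induction
    case zero
    show ?case by (rule exI[of _ 0]) simp
  next
    case (gen g f)
    obtain c p where "g = (\<lambda>x. F (fst x) c * poly p (snd x))" using gen.hyps(1) by blast
    moreover obtain q where "\<forall>z. f (0, z) = poly q z" using gen.IH by blast
    ultimately show ?case by (intro exI[of _ "smult (F 0 c) p + q"]) simp
  qed
  have "\<exists>p. (\<forall>z\<in>V \<inter> U1. norm (poly p z) < \<epsilon>) \<and> (\<forall>z\<in>V \<inter> U2. norm (1 - poly p z) < \<epsilon>)" if e: "\<epsilon> > 0" for \<epsilon>
  proof -
    obtain f where f: "f \<in> additive_span {\<lambda>x. F (fst x) c * poly p (snd x) | c p. c \<in> A}"
      "\<forall>x\<in>{0} \<times> V. norm (F (fst x) (snd x) - f x) < \<epsilon>"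
      using ap e unfolding approximable_def by blast
    obtain p where "\<forall>z. f (0, z) = poly p z" using span[OF f(1)] by blast
    then have *: "norm (F 0 z - poly p z) < \<epsilon>" if "z \<in> V" for z using f(2) that by auto
    have "norm (poly p z) < \<epsilon>" if "z \<in> V \<inter> U1" for z
    proof -
      have "z \<notin> U2" using that U(5) by auto
      then show ?thesis using *[of z] that by (simp add: F_def)
    qed
    moreover have "norm (1 - poly p z) < \<epsilon>" if "z \<in> V \<inter> U2" for z
      using *[of z] that by (simp add: F_def)
    ultimately show ?thesis by blast
  qed
  then show ?thesis
    using VA(1,3) U by (intro exI[of _ "V \<inter> U1"] exI[of _ "V \<inter> U2"]) auto
qed

section \<open>Products of planar sets and approximation one variable at a time\<close>

lemma mem_cprod [simp]: "z \<in> cprod A \<longleftrightarrow> (\<forall>i. z $ i \<in> A i)"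
  by (simp add: cprod_def)

lemma open_cprod:
  assumes "\<And>i. open (A i)"
  shows "open (cprod A :: (complex ^ 'n::finite) set)"
proof -
  have "cprod A = (\<Inter>i\<in>UNIV. (\<lambda>z. z $ i) -` A i)" by auto
  then show ?thesis
    using assms by (auto intro!: open_INT open_vimage continuous_intros)
qed

lemma closed_cprod:
  assumes "\<And>i. closed (A i)"
  shows "closed (cprod A :: (complex ^ 'n::finite) set)"
proof -
  have "cprod A = (\<Inter>i\<in>UNIV. (\<lambda>z. z $ i) -` A i)" by auto
  then show ?thesis
    using assms by (auto intro!: closed_INT closed_vimage continuous_intros)
qed

lemma norm_le_sum_components: "norm (z :: complex ^ 'n::finite) \<le> (\<Sum>i\<in>UNIV. norm (z $ i))"
  unfolding norm_vec_def by (rule L2_set_le_sum) auto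

lemma compact_cprod:
  assumes "\<And>i. compact (A i)"
  shows "compact (cprod A :: (complex ^ 'n::finite) set)"
  unfolding compact_eq_bounded_closed
proof
  show "closed (cprod A)" using assms compact_imp_closed by (intro closed_cprod) blast
  have "\<exists>B. \<forall>x\<in>A i. norm x \<le> B" for i
    using compact_imp_bounded[OF assms[of i]] by (simp add: bounded_iff)
  then obtain B where B: "\<And>i x. x \<in> A i \<Longrightarrow> norm x \<le> B i" by metis
  show "bounded (cprod A)"
    unfolding bounded_iff
  proof (intro exI ballI)
    fix z assume "z \<in> cprod A"
    then show "norm z \<le> (\<Sum>i\<in>UNIV. B i)"
      by (intro order_trans[OF norm_le_sum_components sum_mono] B) simp
  qed
qed

lemma cprod_mono: "(\<And>i. A i \<subseteq> B i) \<Longrightarrow> cprod A \<subseteq> cprod B"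
  by (auto simp: cprod_def)

lemma cprod_tube:
  fixes K :: "'n::finite \<Rightarrow> complex set"
  assumes "\<And>i. compact (K i)" "open U" "cprod K \<subseteq> U"
  obtains O' where "\<And>i. open (O' i)" "\<And>i. K i \<subseteq> O' i" "cprod O' \<subseteq> U"
proof -
  obtain e where e: "e > 0" "(\<Union>x\<in>cprod K. cball x e) \<subseteq> U"
    using compact_subset_open_imp_cball_epsilon_subset[OF compact_cprod[of K] assms(2,3)] assms(1) by metis
  \<comment> \<open>The norm is at most the sum of the moduli of the coordinates, so an error of
    \<open>r\<close> in each coordinate amounts to at most \<open>e\<close>.\<close>
  define r where "r = e / real CARD('n)"
  have r: "r > 0" using e by (simp add: r_def)
  show ?thesis
  proof (rule that[of "\<lambda>i. \<Union>x\<in>K i. ball x r"])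
    show "cprod (\<lambda>i. \<Union>x\<in>K i. ball x r) \<subseteq> U"
    proof
      fix z assume "z \<in> cprod (\<lambda>i. \<Union>x\<in>K i. ball x r)"
      then have "\<forall>i. \<exists>x. x \<in> K i \<and> dist x (z $ i) < r" by auto
      then obtain x where x: "\<And>i. x i \<in> K i \<and> dist (x i) (z $ i) < r" by metis
      have "norm (vec_lambda x - z) \<le> (\<Sum>i\<in>(UNIV::'n set). norm (x i - z $ i))"
        using norm_le_sum_components[of "vec_lambda x - z"] by simp
      also have "\<dots> \<le> (\<Sum>i\<in>(UNIV::'n set). r)"
        by (rule sum_mono) (use x in \<open>auto simp: dist_norm less_imp_le\<close>)
      also have "\<dots> = e" by (simp add: r_def)
      finally have "z \<in> cball (vec_lambda x) e" by (simp add: dist_norm)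
      moreover have "vec_lambda x \<in> cprod K" using x by auto
      ultimately show "z \<in> U" using e(2) by blast
    qed
  qed (use r in \<open>auto intro!: open_UN\<close>)
qed

lemma add_closedD: "add_closed S \<Longrightarrow> f \<in> S \<Longrightarrow> g \<in> S \<Longrightarrow> (\<lambda>x. f x + g x) \<in> S"
  unfolding add_closed_def by blast

lemma approximable_compose:
  assumes "approximable S Y f" "\<And>x. x \<in> X \<Longrightarrow> \<phi> x \<in> Y"
  shows "approximable ((\<lambda>g x. g (\<phi> x)) ` S) X (\<lambda>x. f (\<phi> x))"
  unfolding approximable_def
proof (intro allI impI)
  fix \<epsilon> :: real assume "\<epsilon> > 0"
  then obtain g where g: "g \<in> S" "\<forall>y\<in>Y. norm (f y - g y) < \<epsilon>"
    using assms(1) unfolding approximable_def by blast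
  show "\<exists>h\<in>(\<lambda>g x. g (\<phi> x)) ` S. \<forall>x\<in>X. norm (f (\<phi> x) - h x) < \<epsilon>"
    by (rule bexI[OF _ imageI[OF g(1)]]) (use g(2) assms(2) in simp)
qed

text \<open>For \<open>J = UNIV\<close> the variable disappears and
  \<open>f (override UNIV c z)\<close> is a constant; this is where freezing one variable after
  another ends.\<close>

definition override :: "'n set \<Rightarrow> complex ^ 'n \<Rightarrow> complex ^ 'n \<Rightarrow> complex ^ 'n::finite" where
  "override J c z = (\<chi> i. if i \<in> J then c $ i else z $ i)"

text \<open>Induction over the set \<open>J\<close> of frozen variables: in \<open>T J\<close> the
  function \<open>f\<close> is evaluated with the coordinates in \<open>J\<close> at nodes, and
  dependence on them is carried by polynomial factors. Each step applies the one-variable result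
  with the other coordinates as parameters. The sets \<open>V i\<close> are chosen once, so nothing
  shrinks along the induction.\<close>

theorem runge_several:
  fixes K :: "'n::finite \<Rightarrow> complex set"
  assumes K: "\<And>i. compact (K i)" "\<And>i. connected (- K i)" and f: "sep_hol f U" "cprod K \<subseteq> U"
  shows "\<exists>V. open V \<and> cprod K \<subseteq> V \<and> V \<subseteq> U \<and> approximable polynomials V f"
proof -
  obtain O' where O': "\<And>i. open (O' i)" "\<And>i. K i \<subseteq> O' i" "cprod O' \<subseteq> U"
    using cprod_tube[OF K(1) sep_hol_open[OF f(1)] f(2)] by blast
  define Q where "Q i V A \<longleftrightarrow> open V \<and> compact A \<and> K i \<subseteq> V \<and> V \<subseteq> A \<and> A \<subseteq> O' i \<and>
    (\<forall>(\<Theta> :: (complex ^ 'n) set) F. compact \<Theta> \<longrightarrow> continuous_on (\<Theta> \<times> O' i) (\<lambda>x. F (fst x) (snd x)) \<longrightarrow>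
      (\<forall>\<theta>\<in>\<Theta>. F \<theta> holomorphic_on O' i) \<longrightarrow>
      approximable (additive_span {\<lambda>x. F (fst x) c * poly p (snd x) | c p. c \<in> A}) (\<Theta> \<times> V) (\<lambda>x. F (fst x) (snd x)))"
    for i V A
  have "\<exists>V A. Q i V A" for i
    unfolding Q_def by (rule runge_parametric[OF K(1) O'(1,2) K(2)])
  then obtain V A where VA: "\<And>i. Q i (V i) (A i)" by metis
  have V: "open (V i)" "compact (A i)" "K i \<subseteq> V i" "V i \<subseteq> A i" "A i \<subseteq> O' i" for i
    using VA[of i] by (auto simp: Q_def)
  note appr = VA[unfolded Q_def, THEN conjunct2, THEN conjunct2, THEN conjunct2, THEN conjunct2, THEN conjunct2, rule_format]
  have AO: "x \<in> O' i" if "x \<in> A i" for x i using V(5) that by (rule subsetD)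
  have \<Theta>: "compact (cprod A)" using V(2) by (rule compact_cprod)
  have contf: "continuous_on (cprod O') f"
    using sep_hol_continuous[OF f(1)] O'(3) continuous_on_subset by blast
  define T where "T J = additive_span {\<lambda>z. p z * f (override J c z) | p c. p \<in> polynomials \<and> c \<in> cprod A}" for J
  have addT: "add_closed (T J)" for J unfolding T_def by (rule add_closed_additive_span)
  have base: "f \<in> T {}" if "c \<in> cprod A" for c
  proof -
    have "override {} c = (\<lambda>z. z)" by (simp add: override_def fun_eq_iff vec_eq_iff)
    then have "(\<lambda>z. 1 * f (override {} c z)) = f" by simp
    then show ?thesis
      unfolding T_def using polynomials_const[of 1] that
      by (intro additive_span_base CollectI exI[of _ "\<lambda>z. 1"] exI[of _ c] conjI) (simp_all only: refl)
  qed
  have step: "approximable (T (insert i J)) (cprod V) g" if "i \<notin> J" "g \<in> T J" for i J g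
  proof (rule approximable_additive_span[OF addT _ that(2)[unfolded T_def]])
    fix h assume "h \<in> {\<lambda>z. p z * f (override J c z) | p c. p \<in> polynomials \<and> c \<in> cprod A}"
    then obtain p c where h: "h = (\<lambda>z. p z * f (override J c z))" "p \<in> polynomials" "c \<in> cprod A" by blast
    define F where "F \<theta> w = f (upd \<theta> i w)" for \<theta> w
    have "continuous_on (cprod A \<times> O' i) (\<lambda>x. f (upd (fst x) i (snd x)))"
      by (rule continuous_on_compose2[OF contf]) (use AO in \<open>auto intro!: continuous_intros\<close>)
    then have F1: "continuous_on (cprod A \<times> O' i) (\<lambda>x. F (fst x) (snd x))"
      by (simp add: F_def)
    have F2: "F \<theta> holomorphic_on O' i" if "\<theta> \<in> cprod A" for \<theta>
    proof -
      have "upd \<theta> i w \<in> cprod O'" if "w \<in> O' i" for w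
        using that \<open>\<theta> \<in> cprod A\<close> AO by simp
      then have "O' i \<subseteq> {w. upd \<theta> i w \<in> U}" using O'(3) by blast
      then show ?thesis
        unfolding F_def using sep_hol_slice[OF f(1)] holomorphic_on_subset by blast
    qed
    have "approximable (additive_span {\<lambda>x. F (fst x) c * poly p (snd x) | c p. c \<in> A i})
        (cprod A \<times> V i) (\<lambda>x. F (fst x) (snd x))"
      by (rule appr[OF \<Theta> F1 F2])
    then have sub: "approximable ((\<lambda>g z. g (override J c z, z $ i)) ` additive_span {\<lambda>x. F (fst x) c * poly p (snd x) | c p. c \<in> A i})
        (cprod V) (\<lambda>z. F (override J c z) (z $ i))"
    proof (rule approximable_compose[where \<phi> = "\<lambda>z. (override J c z, z $ i)" and f = "\<lambda>x. F (fst x) (snd x)", unfolded fst_conv snd_conv])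
      show "(override J c z, z $ i) \<in> cprod A \<times> V i" if "z \<in> cprod V" for z
        using that h(3) V(4) by (auto simp: override_def)
    qed
    have "compact (p ` cprod A)"
      by (rule compact_continuous_image[OF continuous_on_polynomial[OF h(2)] \<Theta>])
    then obtain M where M: "\<And>z. z \<in> cprod A \<Longrightarrow> norm (p z) \<le> M"
      using compact_imp_bounded bounded_iff by (metis imageI)
    have mem: "(\<lambda>z. p z * g (override J c z, z $ i)) \<in> T (insert i J)"
      if "g \<in> additive_span {\<lambda>x. F (fst x) c * poly p (snd x) | c p. c \<in> A i}" for g
      using that
    proof induction
      case zero
      show ?case using addT by (simp add: add_closed_def)
    next
      case (gen g1 g2)
      then obtain b q where b: "g1 = (\<lambda>x. F (fst x) b * poly q (snd x))" "b \<in> A i" by blast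
      have "upd (override J c z) i b = override (insert i J) (upd c i b) z" for z
        by (simp add: vec_eq_iff override_def)
      then have "(\<lambda>z. p z * g1 (override J c z, z $ i))
          = (\<lambda>z. (p z * poly q (z $ i)) * f (override (insert i J) (upd c i b) z))"
        by (simp add: b(1) F_def mult_ac)
      moreover have "(\<lambda>z. (p z * poly q (z $ i)) * f (override (insert i J) (upd c i b) z)) \<in> T (insert i J)"
      proof -
        have "(\<lambda>z. p z * poly q (z $ i)) \<in> polynomials"
          by (rule polynomials_mult[OF h(2) polynomials_coord_poly])
        moreover have "upd c i b \<in> cprod A" using h(3) b(2) by auto
        ultimately show ?thesis unfolding T_def by (intro additive_span_base CollectI exI conjI) (rule refl)
      qed
      ultimately have "(\<lambda>z. p z * g1 (override J c z, z $ i)) \<in> T (insert i J)" by simp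
      then show ?case
        unfolding distrib_left by (rule add_closedD[OF addT _ gen.IH])
    qed
    have "approximable (T (insert i J)) (cprod V) (\<lambda>z. p z * F (override J c z) (z $ i))"
    proof (rule approximable_bounded_mult[OF sub])
      show "norm (p z) \<le> M" if "z \<in> cprod V" for z
        using M that cprod_mono[of V A, OF V(4)] by blast
    qed (use mem in blast)
    moreover have "(\<lambda>z. p z * F (override J c z) (z $ i)) = h"
    proof -
      have "upd (override J c z) i (z $ i) = override J c z" for z
        using \<open>i \<notin> J\<close> by (simp add: vec_eq_iff override_def)
      then show ?thesis by (simp add: h(1) F_def)
    qed
    ultimately show "approximable (T (insert i J)) (cprod V) h" by simp
  qed
  have all: "approximable (T J) (cprod V) f" if "c \<in> cprod A" for c and J :: "'n set"
  proof (induction J rule: finite_induct[OF finite])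
    case 1
    show ?case by (rule approximableI_mem[OF base[OF that]])
  next
    case (2 i J)
    show ?case by (rule approximable_trans[OF 2(3)]) (rule step[OF 2(2)])
  qed
  have "T UNIV \<subseteq> polynomials"
  proof
    fix g assume "g \<in> T UNIV"
    then show "g \<in> polynomials"
      unfolding T_def
    proof induction
      case (gen g h)
      then obtain p c where "g = (\<lambda>z. p z * f (override UNIV c z))" "p \<in> polynomials" by blast
      moreover have "override UNIV c z = c" for z by (simp add: override_def vec_eq_iff)
      ultimately have "g \<in> polynomials"
        using polynomials_cmult[of p "f c"] by (simp add: mult.commute)
      then show ?case using gen.IH by (rule polynomials_add)
    qed (rule polynomials_const)
  qed
  then have "approximable polynomials (cprod V) f"
  proof (cases "cprod V = {}")
    case True
    then show ?thesis using polynomials_const unfolding approximable_def by blast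
  next
    case False
    then obtain c where "c \<in> cprod A" using cprod_mono[of V A, OF V(4)] by blast
    from all[OF this, of UNIV] show ?thesis
      using \<open>T UNIV \<subseteq> polynomials\<close> unfolding approximable_def by blast
  qed
  moreover have "cprod V \<subseteq> U"
    using cprod_mono[of V O'] V(4,5) O'(3) by blast
  ultimately show ?thesis
    using open_cprod[of V] V(1) cprod_mono[of K V] V(3) by blast
qed

section \<open>Invariant metrics and seminorms\<close>

text \<open>A common frame for functions and for germs. Since \<open>cl\<close> need not be
  injective, \<open>seminorm_cong\<close> expresses that the seminorms of differences do not depend
  on the representative; the metric enters only through its topology and invariance.\<close>

locale seminorm_space =
  fixes cl :: "('a \<Rightarrow> complex) \<Rightarrow> 'b" and X :: "('a \<Rightarrow> complex) set"
    and P :: "(('a \<Rightarrow> complex) \<Rightarrow> ennreal) set" and m :: "'b \<Rightarrow> 'b \<Rightarrow> real"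
  assumes zero_mem: "0 \<in> X" and add_mem: "f \<in> X \<Longrightarrow> g \<in> X \<Longrightarrow> f + g \<in> X"
    and diff_mem: "f \<in> X \<Longrightarrow> g \<in> X \<Longrightarrow> f - g \<in> X"
    and seminorm_zero: "p \<in> P \<Longrightarrow> p 0 = 0"
    and seminorm_add: "p \<in> P \<Longrightarrow> f \<in> X \<Longrightarrow> g \<in> X \<Longrightarrow> p (f + g) \<le> p f + p g"
    and seminorm_cong: "p \<in> P \<Longrightarrow> f \<in> X \<Longrightarrow> g \<in> X \<Longrightarrow> h \<in> X \<Longrightarrow> cl f = cl g \<Longrightarrow> p (f - h) = p (g - h)"
    and inv_metric: "invariant_metric_for cl X P m"
begin

sublocale Metric_space "cl ` X" m
  using inv_metric by (simp add: invariant_metric_for_def)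

lemma mtopology_eq: "mtopology = seminorm_topology cl X P"
  using inv_metric by (simp add: invariant_metric_for_def)

text \<open>Translating by \<open>0 - g\<close> reduces every distance to a distance from 0, so only
  neighbourhoods of 0 have to be compared.\<close>

lemma metric_diff:
  assumes "f \<in> X" "g \<in> X"
  shows "m (cl f) (cl g) = m (cl (f - g)) (cl 0)"
proof -
  have "0 - g \<in> X" using assms zero_mem diff_mem by blast
  then have "m (cl (f + (0 - g))) (cl (g + (0 - g))) = m (cl f) (cl g)"
    using inv_metric assms unfolding invariant_metric_for_def by blast
  then show ?thesis by simp
qed

text \<open>A seminorm ball around 0 is a basic open set and therefore contains a metric ball;
  invariance spreads this to all pairs. Membership in the image of the ball only names some
  representative \<open>h\<close>, hence the appeal to \<open>seminorm_cong\<close>.\<close>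

lemma metric_imp_seminorm:
  assumes "p \<in> P" "r > 0"
  shows "\<exists>\<eta>>0. \<forall>f\<in>X. \<forall>g\<in>X. m (cl f) (cl g) < \<eta> \<longrightarrow> p (f - g) < ennreal r"
proof -
  let ?B = "cl ` {g \<in> X. p (g - 0) < ennreal r}"
  have "openin (seminorm_topology cl X P) ?B"
    unfolding seminorm_topology_def
    by (rule topology_generated_by_Basis) (use assms zero_mem in blast)
  then have "openin mtopology ?B" by (simp add: mtopology_eq)
  moreover have "cl 0 \<in> ?B"
    using zero_mem assms by (auto simp: seminorm_zero)
  ultimately obtain \<eta> where \<eta>: "\<eta> > 0" "mball (cl 0) \<eta> \<subseteq> ?B"
    unfolding openin_mtopology by blast
  have "p (f - g) < ennreal r" if "f \<in> X" "g \<in> X" "m (cl f) (cl g) < \<eta>" for f g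
  proof -
    have fg: "f - g \<in> X" using that diff_mem by blast
    have "m (cl 0) (cl (f - g)) < \<eta>"
      using that metric_diff[OF that(1,2)] commute[of "cl 0" "cl (f - g)"] by simp
    then have "cl (f - g) \<in> mball (cl 0) \<eta>"
      using fg zero_mem by (simp add: in_mball)
    then have "cl (f - g) \<in> ?B" using \<eta>(2) by (rule subsetD[rotated])
    then obtain h where h: "h \<in> X" "p (h - 0) < ennreal r" "cl (f - g) = cl h" by blast
    then show ?thesis
      using seminorm_cong[OF assms(1) fg h(1) zero_mem h(3)] by simp
  qed
  then show ?thesis using \<eta>(1) by blast
qed

text \<open>Induction on the generation of the open set. In the basic case the ball may be centred
  at a function other than \<open>f0\<close>, and the triangle inequality leaves the radius
  \<open>r - s\<close> around \<open>f0\<close>.\<close>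

lemma generated_nbhd:
  assumes "generate_topology_on {cl ` {g \<in> X. p (g - f) < ennreal r} | p f r. p \<in> P \<and> f \<in> X \<and> r > 0} U"
    and "f0 \<in> X" "cl f0 \<in> U"
  shows "\<exists>F r. finite F \<and> F \<subseteq> P \<and> r > 0 \<and> (\<forall>f\<in>X. (\<forall>p\<in>F. p (f - f0) < ennreal r) \<longrightarrow> cl f \<in> U)"
  using assms(1,3)
proof induction
  case Empty
  then show ?case by simp
next
  case (Int U V)
  obtain F r where F: "finite F" "F \<subseteq> P" "r > 0" "\<forall>f\<in>X. (\<forall>p\<in>F. p (f - f0) < ennreal r) \<longrightarrow> cl f \<in> U"
    using Int.IH(1) Int.prems by blast
  obtain G s where G: "finite G" "G \<subseteq> P" "s > 0" "\<forall>f\<in>X. (\<forall>p\<in>G. p (f - f0) < ennreal s) \<longrightarrow> cl f \<in> V"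
    using Int.IH(2) Int.prems by blast
  have le: "ennreal (min r s) \<le> ennreal r" "ennreal (min r s) \<le> ennreal s"
    using F(3) G(3) by (auto intro!: ennreal_leI)
  show ?case
  proof (intro exI[of _ "F \<union> G"] exI[of _ "min r s"] conjI ballI impI)
    fix f assume f: "f \<in> X" "\<forall>p\<in>F \<union> G. p (f - f0) < ennreal (min r s)"
    then have "\<forall>p\<in>F. p (f - f0) < ennreal r" "\<forall>p\<in>G. p (f - f0) < ennreal s"
      using le by (auto intro: less_le_trans)
    then show "cl f \<in> U \<inter> V" using F(4) G(4) f(1) by blast
  qed (use F G in auto)
next
  case (UN \<K>)
  then obtain U where U: "U \<in> \<K>" "cl f0 \<in> U" by blast
  from UN.IH[OF this] show ?case using U by blast
next
  case (Basis U)
  then obtain p f1 r where U: "U = cl ` {g \<in> X. p (g - f1) < ennreal r}" "p \<in> P" "f1 \<in> X" "r > 0" by blast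
  then obtain g where g: "g \<in> X" "p (g - f1) < ennreal r" "cl f0 = cl g" using Basis.prems by blast
  have "p (f0 - f1) < ennreal r"
    using seminorm_cong[OF U(2) assms(2) g(1) U(3) g(3)] g(2) by simp
  then obtain s where s: "p (f0 - f1) = ennreal s" "0 \<le> s" "s < r"
    by (cases "p (f0 - f1)") (auto simp: ennreal_less_iff)
  show ?case
  proof (intro exI[of _ "{p}"] exI[of _ "r - s"] conjI ballI impI)
    fix f assume f: "f \<in> X" "\<forall>p\<in>{p}. p (f - f0) < ennreal (r - s)"
    then obtain t where t: "p (f - f0) = ennreal t" "0 \<le> t" "t < r - s"
      by (cases "p (f - f0)") (auto simp: ennreal_less_iff)
    have "p (f - f1) = p ((f - f0) + (f0 - f1))" by simp
    also have "\<dots> \<le> p (f - f0) + p (f0 - f1)"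
      by (rule seminorm_add[OF U(2)]) (use f assms U diff_mem in auto)
    also have "\<dots> = ennreal (t + s)" using s t by simp
    also have "\<dots> < ennreal r" using s t by (intro ennreal_lessI) auto
    finally show "cl f \<in> U" using f(1) U(1) by blast
  qed (use U s in auto)
qed

lemma seminorm_imp_metric:
  assumes "\<epsilon> > 0"
  shows "\<exists>F r. finite F \<and> F \<subseteq> P \<and> r > 0 \<and>
    (\<forall>f\<in>X. \<forall>g\<in>X. (\<forall>p\<in>F. p (f - g) < ennreal r) \<longrightarrow> m (cl f) (cl g) < \<epsilon>)"
proof -
  have "openin (seminorm_topology cl X P) (mball (cl 0) \<epsilon>)"
    using openin_mball mtopology_eq by metis
  then have "generate_topology_on {cl ` {g \<in> X. p (g - f) < ennreal r} | p f r. p \<in> P \<and> f \<in> X \<and> r > 0} (mball (cl 0) \<epsilon>)"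
    unfolding seminorm_topology_def openin_topology_generated_by_iff .
  moreover have "cl 0 \<in> mball (cl 0) \<epsilon>" using zero_mem assms by (simp add: in_mball)
  ultimately have "\<exists>F r. finite F \<and> F \<subseteq> P \<and> r > 0 \<and>
      (\<forall>f\<in>X. (\<forall>p\<in>F. p (f - 0) < ennreal r) \<longrightarrow> cl f \<in> mball (cl 0) \<epsilon>)"
    by (rule generated_nbhd[OF _ zero_mem])
  then obtain F r where F: "finite F" "F \<subseteq> P" "r > 0"
    "\<forall>f\<in>X. (\<forall>p\<in>F. p (f - 0) < ennreal r) \<longrightarrow> cl f \<in> mball (cl 0) \<epsilon>"
    by blast
  have "m (cl f) (cl g) < \<epsilon>" if "f \<in> X" "g \<in> X" "\<forall>p\<in>F. p (f - g) < ennreal r" for f g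
  proof -
    have "f - g \<in> X" using that diff_mem by blast
    then have "cl (f - g) \<in> mball (cl 0) \<epsilon>" using F(4) that(3) by simp
    then show ?thesis using metric_diff[OF that(1,2)] commute[of "cl 0" "cl (f - g)"] by (simp add: in_mball)
  qed
  then show ?thesis using F(1-3) by blast
qed

text \<open>Serves to rewrite the suprema over centres in the definition of universality as uniform
  seminorm bounds. An empty \<open>L\<close> is covered because its supremum in
  \<open>ennreal\<close> is 0.\<close>

lemma Sup_metric_tendsto_0_iff:
  assumes f: "\<And>n \<zeta>. \<zeta> \<in> L \<Longrightarrow> f n \<zeta> \<in> X" and g: "g \<in> X"
  shows "(\<lambda>n. SUP \<zeta>\<in>L. ennreal (m (cl (f n \<zeta>)) (cl g))) \<longlonglongrightarrow> 0 \<longleftrightarrow>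
    (\<forall>p\<in>P. \<forall>r>0. \<forall>\<^sub>F n in sequentially. \<forall>\<zeta>\<in>L. p (f n \<zeta> - g) < ennreal r)" (is "?lhs \<longleftrightarrow> ?rhs")
proof
  assume ?lhs
  show ?rhs
  proof (intro ballI allI impI)
    fix p and r :: real assume "p \<in> P" "r > 0"
    then obtain \<eta> where \<eta>: "\<eta> > 0" "\<forall>f\<in>X. \<forall>g\<in>X. m (cl f) (cl g) < \<eta> \<longrightarrow> p (f - g) < ennreal r"
      using metric_imp_seminorm by blast
    have "\<forall>\<^sub>F n in sequentially. (SUP \<zeta>\<in>L. ennreal (m (cl (f n \<zeta>)) (cl g))) < ennreal \<eta>"
      using \<open>?lhs\<close> \<eta>(1) by (intro order_tendstoD(2)) auto
    then show "\<forall>\<^sub>F n in sequentially. \<forall>\<zeta>\<in>L. p (f n \<zeta> - g) < ennreal r"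
    proof (rule eventually_mono, intro ballI)
      fix n \<zeta> assume n: "(SUP \<zeta>\<in>L. ennreal (m (cl (f n \<zeta>)) (cl g))) < ennreal \<eta>" and "\<zeta> \<in> L"
      then have "ennreal (m (cl (f n \<zeta>)) (cl g)) < ennreal \<eta>"
        using SUP_upper[of \<zeta> L "\<lambda>\<zeta>. ennreal (m (cl (f n \<zeta>)) (cl g))"] by (meson le_less_trans)
      then have "m (cl (f n \<zeta>)) (cl g) < \<eta>" by (simp add: ennreal_less_iff)
      then show "p (f n \<zeta> - g) < ennreal r" using \<eta>(2) f[OF \<open>\<zeta> \<in> L\<close>] g by blast
    qed
  qed
next
  assume rhs: ?rhs
  have *: "\<forall>\<^sub>F n in sequentially. (SUP \<zeta>\<in>L. ennreal (m (cl (f n \<zeta>)) (cl g))) \<le> ennreal \<epsilon>" if e: "\<epsilon> > 0" for \<epsilon>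
  proof -
    obtain F r where F: "finite F" "F \<subseteq> P" "r > 0"
      "\<forall>f\<in>X. \<forall>g\<in>X. (\<forall>p\<in>F. p (f - g) < ennreal r) \<longrightarrow> m (cl f) (cl g) < \<epsilon>"
      using seminorm_imp_metric[OF e] by blast
    have "\<forall>\<^sub>F n in sequentially. \<forall>p\<in>F. \<forall>\<zeta>\<in>L. p (f n \<zeta> - g) < ennreal r"
      using rhs F(2,3) by (intro eventually_ball_finite F(1)) blast
    then show ?thesis
    proof (rule eventually_mono)
      fix n assume n: "\<forall>p\<in>F. \<forall>\<zeta>\<in>L. p (f n \<zeta> - g) < ennreal r"
      have "m (cl (f n \<zeta>)) (cl g) < \<epsilon>" if "\<zeta> \<in> L" for \<zeta>
        using F(4) f[OF that] g n that by blast
      then show "(SUP \<zeta>\<in>L. ennreal (m (cl (f n \<zeta>)) (cl g))) \<le> ennreal \<epsilon>"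
        by (intro SUP_least ennreal_leI less_imp_le)
    qed
  qed
  show ?lhs
  proof (rule order_tendstoI)
    fix a :: ennreal assume "a > 0"
    then obtain \<epsilon> :: real where \<epsilon>: "\<epsilon> > 0" "ennreal \<epsilon> < a"
      using ennreal_Ex_less_of_nat dense[of 0 a]
      by (metis ennreal_0 ennreal_cases ennreal_less_zero_iff infinity_ennreal_def leD top_greatest zero_less_iff_neq_zero)
    show "\<forall>\<^sub>F n in sequentially. (SUP \<zeta>\<in>L. ennreal (m (cl (f n \<zeta>)) (cl g))) < a"
      using *[OF \<epsilon>(1)] by (rule eventually_mono) (use \<epsilon>(2) in simp)
  qed simp
qed

lemma metric_imp_seminorms:
  assumes "finite F" "F \<subseteq> P" "r > 0"
  shows "\<exists>\<eta>>0. \<forall>f\<in>X. \<forall>g\<in>X. m (cl f) (cl g) < \<eta> \<longrightarrow> (\<forall>p\<in>F. p (f - g) < ennreal r)"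
  using assms(1,2)
proof induction
  case empty
  show ?case by (intro exI[of _ 1]) auto
next
  case (insert p F)
  obtain \<eta> where \<eta>: "\<eta> > 0" "\<forall>f\<in>X. \<forall>g\<in>X. m (cl f) (cl g) < \<eta> \<longrightarrow> (\<forall>p\<in>F. p (f - g) < ennreal r)"
    using insert by blast
  obtain \<delta> where \<delta>: "\<delta> > 0" "\<forall>f\<in>X. \<forall>g\<in>X. m (cl f) (cl g) < \<delta> \<longrightarrow> p (f - g) < ennreal r"
    using metric_imp_seminorm[of p r] insert.prems assms(3) by auto
  show ?case
  proof (intro exI[of _ "min \<eta> \<delta>"] conjI ballI impI)
    show "min \<eta> \<delta> > 0" using \<eta>(1) \<delta>(1) by simp
    fix f g q assume fg: "f \<in> X" "g \<in> X" "m (cl f) (cl g) < min \<eta> \<delta>" and q: "q \<in> insert p F"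
    then have "m (cl f) (cl g) < \<eta>" "m (cl f) (cl g) < \<delta>" by simp_all
    then show "q (f - g) < ennreal r" using q \<eta>(2) \<delta>(2) fg(1,2) by blast
  qed
qed

end

section \<open>Suprema as seminorms, and the space of germs\<close>

lemma sup_on_less:
  assumes "\<And>z. z \<in> L \<Longrightarrow> cmod (g z) \<le> s" "0 \<le> s" "s < r"
  shows "sup_on L g < ennreal r"
proof -
  have "sup_on L g \<le> ennreal s"
    unfolding sup_on_def by (intro SUP_least ennreal_leI assms)
  also have "\<dots> < ennreal r" using assms by (simp add: ennreal_lessI)
  finally show ?thesis .
qed

lemma sup_on_lessD:
  assumes "sup_on L g < ennreal r" "z \<in> L"
  shows "cmod (g z) < r"
proof -
  have "ennreal (cmod (g z)) \<le> sup_on L g"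
    unfolding sup_on_def using assms(2) by (rule SUP_upper)
  then have "ennreal (cmod (g z)) < ennreal r" using assms(1) by (rule le_less_trans)
  then show ?thesis by (simp add: ennreal_less_iff)
qed

lemma sup_on_cong: "(\<And>z. z \<in> L \<Longrightarrow> f z = g z) \<Longrightarrow> sup_on L f = sup_on L g"
  unfolding sup_on_def by (rule SUP_cong) auto

lemma sup_on_zero: "(\<And>z. z \<in> L \<Longrightarrow> f z = 0) \<Longrightarrow> sup_on L f = 0"
  unfolding sup_on_def by (intro antisym SUP_least) auto

lemma sup_on_add:
  assumes "\<And>z. z \<in> L \<Longrightarrow> h z = f z + g z"
  shows "sup_on L h \<le> sup_on L f + sup_on L g"
  unfolding sup_on_def
proof (rule SUP_least)
  fix z assume z: "z \<in> L"
  have "ennreal (cmod (h z)) \<le> ennreal (cmod (f z)) + ennreal (cmod (g z))"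
    by (simp add: assms[OF z] norm_triangle_ineq flip: ennreal_plus)
  also have "\<dots> \<le> (SUP z\<in>L. ennreal (cmod (f z))) + (SUP z\<in>L. ennreal (cmod (g z)))"
    by (intro add_mono SUP_upper z)
  finally show "ennreal (cmod (h z)) \<le> (SUP z\<in>L. ennreal (cmod (f z))) + (SUP z\<in>L. ennreal (cmod (g z)))" .
qed

lemma holo_near_sep_hol:
  assumes "f \<in> holo_near K"
  obtains U where "K \<subseteq> U" "sep_hol f U" "holomorphic_several f U" "open U"
  using assms holomorphic_several_imp_sep_hol sep_hol_open unfolding holo_near_def by blast

lemma holo_near_add:
  assumes "f \<in> holo_near K" "g \<in> holo_near K"
  shows "f + g \<in> holo_near K"
proof -
  obtain U where U: "K \<subseteq> U" "holomorphic_several f U" "open U" using assms(1) by (rule holo_near_sep_hol)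
  obtain V where V: "K \<subseteq> V" "holomorphic_several g V" "open V" using assms(2) by (rule holo_near_sep_hol)
  have "holomorphic_several (\<lambda>z. f z + g z) (U \<inter> V)"
    using U V by (intro holomorphic_several_add) (auto intro: holomorphic_several_subset)
  then show ?thesis unfolding holo_near_def plus_fun_def using U V by blast
qed

lemma holo_near_cmult:
  assumes "f \<in> holo_near K"
  shows "(\<lambda>z. c * f z) \<in> holo_near K"
proof -
  obtain U where U: "K \<subseteq> U" "holomorphic_several f U" "open U" using assms(1) by (rule holo_near_sep_hol)
  then have "holomorphic_several (\<lambda>z. c * f z) U"
    by (intro holomorphic_several_mult holomorphic_several_const)
  then show ?thesis unfolding holo_near_def using U by blast
qed

lemma polynomials_holo_near: "p \<in> polynomials \<Longrightarrow> p \<in> holo_near K"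
  unfolding holo_near_def using holomorphic_several_polynomial[of p UNIV] by blast

lemma holo_near_diff:
  assumes "f \<in> holo_near K" "g \<in> holo_near K"
  shows "f - g \<in> holo_near K"
proof -
  have eq: "f - g = f + (\<lambda>z. - 1 * g z)" by (simp add: fun_eq_iff)
  show ?thesis unfolding eq by (rule holo_near_add[OF assms(1) holo_near_cmult[OF assms(2)]])
qed

lemma mixed_deriv_holo_near_add:
  assumes "f \<in> holo_near K" "g \<in> holo_near K" "z \<in> K"
  shows "mixed_deriv a (f + g) z = mixed_deriv a f z + mixed_deriv a g z"
proof -
  obtain U where U: "K \<subseteq> U" "sep_hol f U" "open U" using assms(1) by (rule holo_near_sep_hol)
  obtain V where V: "K \<subseteq> V" "sep_hol g V" "open V" using assms(2) by (rule holo_near_sep_hol)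
  show ?thesis
    unfolding mixed_deriv_eq_pd plus_fun_def
    by (rule pd_add[of _ "U \<inter> V"]) (use U V assms(3) in \<open>auto intro: sep_hol_subset\<close>)
qed

lemma mixed_deriv_holo_near_cmult:
  assumes "f \<in> holo_near K" "z \<in> K"
  shows "mixed_deriv a (\<lambda>z. c * f z) z = c * mixed_deriv a f z"
proof -
  obtain U where U: "K \<subseteq> U" "sep_hol f U" "open U" using assms(1) by (rule holo_near_sep_hol)
  show ?thesis
    unfolding mixed_deriv_eq_pd by (rule pd_cmult[of _ U]) (use U assms(2) in auto)
qed

lemma mixed_deriv_holo_near_diff:
  assumes "f \<in> holo_near K" "g \<in> holo_near K" "z \<in> K"
  shows "mixed_deriv a (f - g) z = mixed_deriv a f z - mixed_deriv a g z"
proof -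
  have "mixed_deriv a (f - g) z + mixed_deriv a g z = mixed_deriv a f z"
    using mixed_deriv_holo_near_add[OF holo_near_diff[OF assms(1,2)] assms(2,3)] by simp
  then show ?thesis by (simp add: algebra_simps)
qed

lemma mixed_deriv_zero: "mixed_deriv a 0 = 0"
  unfolding mixed_deriv_eq_pd zero_fun_def by (rule pd_zero)

lemma germ_eqD:
  assumes "germ K f = germ K g"
  obtains U where "open U" "K \<subseteq> U" "\<And>z. z \<in> U \<Longrightarrow> f z = g z"
proof -
  have "f \<in> germ K f" unfolding germ_def by (intro CollectI exI[of _ UNIV]) auto
  then show ?thesis using that assms unfolding germ_def by auto
qed

text \<open>Representatives of one germ agree on a neighbourhood of \<open>K\<close>, so on
  \<open>K\<close> they share all derivatives and not merely their values.\<close>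

lemma seminorm_space_O:
  assumes "O_metric K m"
  shows "seminorm_space (germ K) (holo_near K) (O_seminorms K) m"
proof
  show "(0 :: complex ^ 'a \<Rightarrow> complex) \<in> holo_near K"
    using polynomials_holo_near[OF polynomials_const[of 0]] by (simp add: zero_fun_def)
  fix p assume "p \<in> O_seminorms K"
  then obtain a where p: "p = (\<lambda>h. sup_on K (mixed_deriv a h))" by (auto simp: O_seminorms_def)
  show "p 0 = 0" unfolding p by (rule sup_on_zero) (simp add: mixed_deriv_zero)
  show "p (f + g) \<le> p f + p g" if "f \<in> holo_near K" "g \<in> holo_near K" for f g
    unfolding p by (rule sup_on_add) (rule mixed_deriv_holo_near_add[OF that])
  show "p (f - h) = p (g - h)"
    if fgh: "f \<in> holo_near K" "g \<in> holo_near K" "h \<in> holo_near K" and eq: "germ K f = germ K g" for f g h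
  proof -
    obtain U where U: "open U" "K \<subseteq> U" "\<And>z. z \<in> U \<Longrightarrow> f z = g z"
      using germ_eqD[OF eq] by blast
    have "mixed_deriv a (f - h) z = mixed_deriv a (g - h) z" if "z \<in> K" for z
      unfolding mixed_deriv_eq_pd by (rule pd_cong[OF U(1)]) (use U that in auto)
    then show ?thesis unfolding p by (rule sup_on_cong)
  qed
qed (use assms holo_near_add holo_near_diff in \<open>auto simp: O_metric_def\<close>)

section \<open>The space of smooth holomorphic functions\<close>

lemma closure_cprod: "cprod (\<lambda>i. closure (A i)) \<subseteq> closure (cprod A :: (complex ^ 'n::finite) set)"
proof
  fix z :: "complex ^ 'n" assume z: "z \<in> cprod (\<lambda>i. closure (A i))"
  show "z \<in> closure (cprod A)"
    unfolding closure_approachable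
  proof (intro allI impI)
    fix e :: real assume "e > 0"
    define r where "r = e / (2 * real CARD('n))"
    have "r > 0" using \<open>e > 0\<close> by (simp add: r_def)
    then have "\<forall>i. \<exists>x\<in>A i. dist x (z $ i) < r"
      using z by (simp add: closure_approachable)
    then obtain x where x: "\<And>i. x i \<in> A i \<and> dist (x i) (z $ i) < r" by metis
    have "norm (vec_lambda x - z) \<le> (\<Sum>i\<in>(UNIV::'n set). norm (x i - z $ i))"
      using norm_le_sum_components[of "vec_lambda x - z"] by simp
    also have "\<dots> \<le> (\<Sum>i\<in>(UNIV::'n set). r)"
      by (rule sum_mono) (use x in \<open>auto simp: dist_norm less_imp_le\<close>)
    also have "\<dots> < e" using \<open>e > 0\<close> by (simp add: r_def)
    finally show "\<exists>y\<in>cprod A. dist y z < e"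
      using x by (intro bexI[of _ "vec_lambda x"]) (auto simp: dist_norm)
  qed
qed

locale smooth_domain =
  fixes \<Omega> S :: "'n::finite \<Rightarrow> complex set"
  assumes open_factor: "\<And>i. open (\<Omega> i)"
    and S_open: "\<And>i. openin (top_of_set (frontier (\<Omega> i))) (S i)"
begin

abbreviation D :: "(complex ^ 'n) set" where "D \<equiv> cprod \<Omega>"
abbreviation T :: "(complex ^ 'n) set" where "T \<equiv> cprod (\<lambda>i. \<Omega> i \<union> S i)"
abbreviation A :: "(complex ^ 'n \<Rightarrow> complex) set" where "A \<equiv> A_inf \<Omega> S"
abbreviation ext where "ext \<equiv> ext_deriv \<Omega> S"

lemma open_D: "open D"
  by (rule open_cprod) (rule open_factor)

lemma D_subset_T: "D \<subseteq> T"
  by (rule cprod_mono) auto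

lemma S_frontier: "S i \<subseteq> frontier (\<Omega> i)"
  using openin_imp_subset[OF S_open] .

lemma T_closure: "T \<subseteq> closure D"
proof -
  have "T \<subseteq> cprod (\<lambda>i. closure (\<Omega> i))"
    using S_frontier closure_subset[of "\<Omega> _"] by (intro cprod_mono) (auto simp: frontier_def)
  then show ?thesis using closure_cprod by blast
qed

text \<open>Density of \<open>D\<close> in \<open>T\<close> makes the choice in
  \<open>ext_deriv\<close> immaterial on \<open>T\<close>; this allows extensions of sums, multiples
  and polynomials to be read off any continuous candidate through \<open>ext_eqI\<close>.\<close>

lemma cont_ext_unique:
  fixes g h :: "complex ^ 'n \<Rightarrow> complex"
  assumes "continuous_on T g" "continuous_on T h" "\<And>z. z \<in> D \<Longrightarrow> g z = h z" "z \<in> T"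
  shows "g z = h z"
proof -
  obtain x where x: "\<And>n. x n \<in> D" "x \<longlonglongrightarrow> z"
    using T_closure assms(4) closure_sequential by blast
  have l: "(\<lambda>n. g (x n)) \<longlonglongrightarrow> g z" "(\<lambda>n. h (x n)) \<longlonglongrightarrow> h z"
    using assms(1,2,4) x D_subset_T by (auto simp: continuous_on_sequentially o_def)
  have "(\<lambda>n. h (x n)) \<longlonglongrightarrow> g z"
    using l(1) by (simp only: assms(3)[OF x(1)])
  then show ?thesis using l(2) by (rule LIMSEQ_unique)
qed

lemma cont_ext:
  assumes "f \<in> A"
  shows "is_cont_ext \<Omega> S a f (ext a f)"
proof -
  have "\<exists>g. is_cont_ext \<Omega> S a f g" using assms by (simp add: A_inf_def)
  then show ?thesis unfolding ext_deriv_def by (rule someI_ex)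
qed

lemma continuous_on_ext: "f \<in> A \<Longrightarrow> continuous_on T (ext a f)"
  using cont_ext by (simp add: is_cont_ext_def)

lemma ext_eq: "f \<in> A \<Longrightarrow> z \<in> D \<Longrightarrow> ext a f z = mixed_deriv a f z"
  using cont_ext by (simp add: is_cont_ext_def)

lemma ext_eqI:
  assumes "is_cont_ext \<Omega> S a f g" "z \<in> T"
  shows "ext a f z = g z"
proof -
  have "is_cont_ext \<Omega> S a f (ext a f)"
    unfolding ext_deriv_def by (rule someI[of "is_cont_ext \<Omega> S a f", OF assms(1)])
  then show ?thesis
    using assms cont_ext_unique[of "ext a f" g z] by (simp add: is_cont_ext_def)
qed

lemma A_outside: "f \<in> A \<Longrightarrow> z \<notin> D \<Longrightarrow> f z = 0"
  and A_holomorphic: "f \<in> A \<Longrightarrow> holomorphic_several f D"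
  by (auto simp: A_inf_def)

lemma A_sep_hol: "f \<in> A \<Longrightarrow> sep_hol f D"
  by (simp add: A_holomorphic holomorphic_several_imp_sep_hol)

lemma A_I:
  assumes "\<And>z. z \<notin> D \<Longrightarrow> f z = 0" "holomorphic_several f D" "\<And>a. is_cont_ext \<Omega> S a f (g a)"
  shows "f \<in> A"
  using assms unfolding A_inf_def by blast

lemma cont_ext_add:
  assumes "f \<in> A" "g \<in> A"
  shows "is_cont_ext \<Omega> S a (f + g) (\<lambda>z. ext a f z + ext a g z)"
proof -
  have "mixed_deriv a (f + g) z = mixed_deriv a f z + mixed_deriv a g z" if "z \<in> D" for z
    unfolding mixed_deriv_eq_pd plus_fun_def
    by (rule pd_add[OF A_sep_hol[OF assms(1)] A_sep_hol[OF assms(2)] that])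
  then show ?thesis
    unfolding is_cont_ext_def using assms
    by (auto intro!: continuous_intros continuous_on_ext simp: ext_eq)
qed

lemma A_add:
  assumes "f \<in> A" "g \<in> A"
  shows "f + g \<in> A"
proof (rule A_I)
  show "holomorphic_several (f + g) D"
    unfolding plus_fun_def by (intro holomorphic_several_add A_holomorphic assms)
  show "(f + g) z = 0" if "z \<notin> D" for z
    by (simp add: A_outside[OF assms(1) that] A_outside[OF assms(2) that])
qed (rule cont_ext_add[OF assms])

lemma ext_add: "f \<in> A \<Longrightarrow> g \<in> A \<Longrightarrow> z \<in> T \<Longrightarrow> ext a (f + g) z = ext a f z + ext a g z"
  by (rule ext_eqI[OF cont_ext_add])

lemma cont_ext_cmult:
  assumes "f \<in> A"
  shows "is_cont_ext \<Omega> S a (\<lambda>z. c * f z) (\<lambda>z. c * ext a f z)"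
proof -
  have "mixed_deriv a (\<lambda>z. c * f z) z = c * mixed_deriv a f z" if "z \<in> D" for z
    unfolding mixed_deriv_eq_pd by (rule pd_cmult[OF A_sep_hol[OF assms] that])
  then show ?thesis
    unfolding is_cont_ext_def using assms
    by (auto intro!: continuous_intros continuous_on_ext simp: ext_eq)
qed

lemma A_cmult:
  assumes "f \<in> A"
  shows "(\<lambda>z. c * f z) \<in> A"
proof (rule A_I)
  show "holomorphic_several (\<lambda>z. c * f z) D"
    by (intro holomorphic_several_mult holomorphic_several_const open_D A_holomorphic assms)
  show "c * f z = 0" if "z \<notin> D" for z
    by (simp add: A_outside[OF assms that])
qed (rule cont_ext_cmult[OF assms])

lemma ext_cmult: "f \<in> A \<Longrightarrow> z \<in> T \<Longrightarrow> ext a (\<lambda>z. c * f z) z = c * ext a f z"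
  by (rule ext_eqI[OF cont_ext_cmult])

lemma A_diff:
  assumes "f \<in> A" "g \<in> A"
  shows "f - g \<in> A"
proof -
  have eq: "f - g = f + (\<lambda>z. - 1 * g z)" by (simp add: fun_eq_iff)
  show ?thesis unfolding eq by (rule A_add[OF assms(1) A_cmult[OF assms(2)]])
qed

lemma ext_diff:
  assumes "f \<in> A" "g \<in> A" "z \<in> T"
  shows "ext a (f - g) z = ext a f z - ext a g z"
proof -
  have "ext a (f - g) z + ext a g z = ext a f z"
    using ext_add[OF A_diff[OF assms(1,2)] assms(2,3)] by simp
  then show ?thesis by (simp add: algebra_simps)
qed

lemma cont_ext_polynomial:
  assumes "p \<in> polynomials"
  shows "is_cont_ext \<Omega> S a (restrict0 \<Omega> p) (mixed_deriv a p)"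
  unfolding is_cont_ext_def mixed_deriv_eq_pd
proof (intro conjI ballI)
  show "continuous_on T (pd (idxs a) p)"
    using sep_hol_continuous[OF sep_hol_pd[OF sep_hol_polynomial[OF assms open_UNIV]]] continuous_on_subset by blast
  show "pd (idxs a) p z = pd (idxs a) (restrict0 \<Omega> p) z" if "z \<in> D" for z
    by (rule pd_cong[OF open_D _ that]) (simp add: restrict0_def)
qed

lemma restrict0_polynomial:
  assumes "p \<in> polynomials"
  shows "restrict0 \<Omega> p \<in> A"
proof (rule A_I)
  show "holomorphic_several (restrict0 \<Omega> p) D"
    unfolding holomorphic_several_def
  proof (intro conjI ballI open_D)
    fix z assume z: "z \<in> D"
    then obtain f' where f': "(p has_derivative f') (at z)" "\<forall>c v. f' (c *s v) = c * f' v"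
      using holomorphic_several_polynomial[OF assms open_D] unfolding holomorphic_several_def by blast
    have "(restrict0 \<Omega> p has_derivative f') (at z)"
      by (rule has_derivative_transform_within_open[OF f'(1) open_D z]) (simp add: restrict0_def)
    then show "\<exists>f'. (restrict0 \<Omega> p has_derivative f') (at z) \<and> (\<forall>c v. f' (c *s v) = c * f' v)"
      using f'(2) by blast
  qed
qed (use cont_ext_polynomial[OF assms] in \<open>auto simp: restrict0_def\<close>)

lemma ext_polynomial: "p \<in> polynomials \<Longrightarrow> z \<in> T \<Longrightarrow> ext a (restrict0 \<Omega> p) z = mixed_deriv a p z"
  by (rule ext_eqI[OF cont_ext_polynomial])

lemma A_zero: "0 \<in> A"
proof -
  have "restrict0 \<Omega> (\<lambda>z. 0) = 0" by (simp add: restrict0_def fun_eq_iff)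
  then show ?thesis using restrict0_polynomial[OF polynomials_const[of 0]] by simp
qed

lemma seminorm_space_A:
  assumes "A_inf_metric \<Omega> S d"
  shows "seminorm_space (\<lambda>f. f) A (A_inf_seminorms \<Omega> S) d"
proof
  fix p assume "p \<in> A_inf_seminorms \<Omega> S"
  then obtain L a where p: "p = (\<lambda>f. sup_on L (ext a f))" "L \<subseteq> T" by (auto simp: A_inf_seminorms_def)
  show "p 0 = 0" unfolding p
  proof (rule sup_on_zero)
    fix z assume "z \<in> L"
    have "ext a (0 + 0) z = ext a 0 z + ext a 0 z"
      by (rule ext_add[OF A_zero A_zero subsetD[OF p(2) \<open>z \<in> L\<close>]])
    then show "ext a 0 z = 0" by simp
  qed
  show "p (f + g) \<le> p f + p g" if "f \<in> A" "g \<in> A" for f g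
    unfolding p by (rule sup_on_add) (use ext_add[OF that] p(2) in blast)
qed (use assms A_zero A_add A_diff in \<open>auto simp: A_inf_metric_def\<close>)

end

subsection \<open>Completeness\<close>

text \<open>Cauchy estimates bound the derivatives of \<open>F n - f\<close> on \<open>L\<close> by
  its size on the larger compact set \<open>B\<close>, with a constant independent of
  \<open>n\<close>.\<close>

lemma uniform_limit_pd:
  assumes F: "\<And>n. sep_hol (F n) U" and f: "sep_hol f U"
    and lim: "\<And>L. compact L \<Longrightarrow> L \<subseteq> U \<Longrightarrow> uniform_limit L F f sequentially"
    and L: "compact L" "L \<subseteq> U"
  shows "uniform_limit L (\<lambda>n. pd is (F n)) (pd is f) sequentially"
proof -
  obtain V B where V: "open V" "compact B" "L \<subseteq> V" "V \<subseteq> B" "B \<subseteq> U"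
    using compact_between[OF L(1) sep_hol_open[OF f] L(2)] by blast
  obtain e where e: "e > 0" "(\<Union>x\<in>L. cball x e) \<subseteq> V"
    using compact_subset_open_imp_cball_epsilon_subset[OF L(1) V(1,3)] by blast
  obtain C where C: "C > 0" "\<forall>f U z M. sep_hol f U \<longrightarrow> cball z e \<subseteq> U \<longrightarrow> (\<forall>w\<in>cball z e. norm (f w) \<le> M)
    \<longrightarrow> norm (pd is f z) \<le> C * M"
    using pd_bound[OF e(1), of "is"] by blast
  show ?thesis
  proof (rule uniform_limitI)
    fix \<epsilon> :: real assume "\<epsilon> > 0"
    then have "\<forall>\<^sub>F n in sequentially. \<forall>w\<in>B. dist (F n w) (f w) < \<epsilon> / (2 * C)"
      using C(1) by (intro uniform_limitD[OF lim[OF V(2,5)]]) auto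
    then show "\<forall>\<^sub>F n in sequentially. \<forall>z\<in>L. dist (pd is (F n) z) (pd is f z) < \<epsilon>"
    proof (rule eventually_mono, intro ballI)
      fix n z assume n: "\<forall>w\<in>B. dist (F n w) (f w) < \<epsilon> / (2 * C)" and z: "z \<in> L"
      have sub: "cball z e \<subseteq> B" using e(2) z V(4) by blast
      have "norm (pd is (\<lambda>z. F n z - f z) z) \<le> C * (\<epsilon> / (2 * C))"
      proof (rule C(2)[rule_format])
        show "sep_hol (\<lambda>z. F n z - f z) U" by (rule sep_hol_diff[OF F f])
        show "cball z e \<subseteq> U" using sub V(5) by blast
        show "norm (F n w - f w) \<le> \<epsilon> / (2 * C)" if "w \<in> cball z e" for w
          using n[rule_format, OF subsetD[OF sub that]] by (simp add: dist_norm)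
      qed
      also have "\<dots> < \<epsilon>" using C(1) \<open>\<epsilon> > 0\<close> by simp
      finally show "dist (pd is (F n) z) (pd is f z) < \<epsilon>"
        using pd_diff[OF F[of n] f, of z "is"] z L(2) by (auto simp: dist_norm)
    qed
  qed
qed

lemma sep_hol_limit:
  assumes F: "\<And>n. sep_hol (F n) U"
    and lim: "\<And>L. compact L \<Longrightarrow> L \<subseteq> U \<Longrightarrow> uniform_limit L F f sequentially"
  shows "sep_hol f U"
proof (rule sep_hol_local)
  show U: "open U" using F sep_hol_open by blast
  fix z assume "z \<in> U"
  then obtain e where e: "e > 0" "cball z e \<subseteq> U" using U open_contains_cball by blast
  have "sep_hol f (ball z e)"
  proof (rule sep_hol_uniform_limit)
    show "sep_hol (F n) (ball z e)" for n
      by (rule sep_hol_subset[OF F]) (use e ball_subset_cball in blast)+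
    show "uniform_limit (ball z e) F f sequentially"
      by (rule uniform_limit_on_subset[OF lim[of "cball z e"]]) (use e in auto)
  qed
  then show "\<exists>V. z \<in> V \<and> sep_hol f V" using e(1) centre_in_ball by blast
qed

text \<open>The limit is so far only separately holomorphic. Its total derivative comes from the
  theorem on sequences of derivatives: by Cauchy estimates the partial derivatives of
  \<open>F n\<close> converge uniformly on a ball, and they determine the total derivatives.\<close>

lemma holomorphic_several_limit:
  fixes F :: "nat \<Rightarrow> complex ^ 'n::finite \<Rightarrow> complex"
  assumes F: "\<And>n. holomorphic_several (F n) U"
    and lim: "\<And>L. compact L \<Longrightarrow> L \<subseteq> U \<Longrightarrow> uniform_limit L F f sequentially"
  shows "holomorphic_several f U"
  unfolding holomorphic_several_def
proof (intro conjI ballI)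
  have Fs: "sep_hol (F n) U" for n using F holomorphic_several_imp_sep_hol by blast
  have fs: "sep_hol f U" by (rule sep_hol_limit[OF Fs lim])
  then show U: "open U" by (rule sep_hol_open)
  fix z assume z: "z \<in> U"
  then obtain e where e: "e > 0" "cball z e \<subseteq> U" using U open_contains_cball by blast
  define f' where "f' x v = (\<Sum>i\<in>UNIV. v $ i * partial_deriv i f x)" for x and v :: "complex ^ 'n"
  have pl: "uniform_limit (cball z e) (\<lambda>n. partial_deriv i (F n)) (partial_deriv i f) sequentially" for i
    using uniform_limit_pd[OF Fs fs lim, of "cball z e" "[i]"] e by simp
  have "\<exists>g. \<forall>x\<in>ball z e. (\<lambda>n. F n x) \<longlonglongrightarrow> g x \<and> (g has_derivative f' x) (at x within ball z e)"
  proof (rule has_derivative_sequence)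
    show "(F n has_derivative (\<lambda>v. \<Sum>i\<in>UNIV. v $ i * partial_deriv i (F n) x)) (at x within ball z e)"
      if "x \<in> ball z e" for n x
    proof -
      have "x \<in> U" using that e(2) ball_subset_cball by blast
      then show ?thesis
        using holomorphic_several_has_derivative[OF F] has_derivative_at_withinI by blast
    qed
    fix \<epsilon> :: real assume "\<epsilon> > 0"
    define \<delta> where "\<delta> = \<epsilon> / real CARD('n)"
    have "\<delta> > 0" using \<open>\<epsilon> > 0\<close> by (simp add: \<delta>_def)
    then have "\<forall>\<^sub>F n in sequentially. \<forall>i\<in>UNIV. \<forall>x\<in>cball z e. dist (partial_deriv i (F n) x) (partial_deriv i f x) < \<delta>"
      by (intro eventually_ball_finite ballI uniform_limitD[OF pl]) auto
    then show "\<forall>\<^sub>F n in sequentially. \<forall>x\<in>ball z e. \<forall>h.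
        norm ((\<Sum>i\<in>UNIV. h $ i * partial_deriv i (F n) x) - f' x h) \<le> \<epsilon> * norm h"
    proof (rule eventually_mono, intro ballI allI)
      fix n x and h :: "complex ^ 'n"
      assume n: "\<forall>i\<in>UNIV. \<forall>x\<in>cball z e. dist (partial_deriv i (F n) x) (partial_deriv i f x) < \<delta>"
        and x: "x \<in> ball z e"
      have "norm ((\<Sum>i\<in>UNIV. h $ i * partial_deriv i (F n) x) - f' x h)
          = norm (\<Sum>i\<in>UNIV. h $ i * (partial_deriv i (F n) x - partial_deriv i f x))"
        by (simp add: f'_def sum_subtractf right_diff_distrib)
      also have "\<dots> \<le> (\<Sum>i\<in>(UNIV :: 'n set). norm h * \<delta>)"
      proof (rule sum_norm_le)
        fix i
        have "norm (partial_deriv i (F n) x - partial_deriv i f x) \<le> \<delta>"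
          using n x by (auto simp: dist_norm intro: less_imp_le)
        then show "norm (h $ i * (partial_deriv i (F n) x - partial_deriv i f x)) \<le> norm h * \<delta>"
          unfolding norm_mult by (intro mult_mono Finite_Cartesian_Product.norm_nth_le) auto
      qed
      also have "\<dots> = \<epsilon> * norm h" by (simp add: \<delta>_def)
      finally show "norm ((\<Sum>i\<in>UNIV. h $ i * partial_deriv i (F n) x) - f' x h) \<le> \<epsilon> * norm h" .
    qed
  next
    show "(\<lambda>n. F n z) \<longlonglongrightarrow> f z"
      using tendsto_uniform_limitI[OF lim[of "{z}"]] z by auto
  qed (use e in auto)
  then obtain g where g: "\<forall>x\<in>ball z e. (\<lambda>n. F n x) \<longlonglongrightarrow> g x \<and> (g has_derivative f' x) (at x within ball z e)" by blast
  have "g x = f x" if "x \<in> ball z e" for x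
  proof -
    have "x \<in> U" using that e(2) ball_subset_cball by blast
    then have "(\<lambda>n. F n x) \<longlonglongrightarrow> f x" using tendsto_uniform_limitI[OF lim[of "{x}"]] by auto
    then show ?thesis using g that LIMSEQ_unique by blast
  qed
  moreover have "(g has_derivative f' z) (at z)"
    using g e(1) at_within_open[of z "ball z e"] by (metis centre_in_ball open_ball)
  ultimately have "(f has_derivative f' z) (at z)"
    using e(1) by (auto intro: has_derivative_transform_within_open[of g "f' z" z UNIV "ball z e" f])
  moreover have "f' z (c *s v) = c * f' z v" for c v
    by (simp add: f'_def sum_distrib_left mult.assoc)
  ultimately show "\<exists>f'. (f has_derivative f') (at z) \<and> (\<forall>c v. f' (c *s v) = c * f' v)" by blast
qed

context smooth_domain
begin

lemma seminorms_I: "compact L \<Longrightarrow> L \<subseteq> T \<Longrightarrow> (\<lambda>f. sup_on L (ext a f)) \<in> A_inf_seminorms \<Omega> S"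
  unfolding A_inf_seminorms_def by blast

text \<open>Along a Cauchy sequence the extended derivatives converge uniformly on every compact
  subset of \<open>T\<close>, to limits \<open>g a\<close>. Convergence of derivatives inside
  \<open>D\<close> identifies \<open>g a\<close> with the derivative of the limit function, so
  \<open>g a\<close> is the extension demanded by membership in \<open>A\<close>.\<close>

lemma A_mcomplete:
  assumes "A_inf_metric \<Omega> S d"
  shows "Metric_space.mcomplete A d"
proof -
  interpret M: seminorm_space "\<lambda>f. f" A "A_inf_seminorms \<Omega> S" d
    by (rule seminorm_space_A[OF assms])
  have "Metric_space.mcomplete ((\<lambda>f. f) ` A) d"
    unfolding M.mcomplete_def
  proof (intro allI impI)
    fix \<sigma> assume cau: "M.MCauchy \<sigma>"
    then have "range \<sigma> \<subseteq> (\<lambda>f. f) ` A" unfolding M.MCauchy_def by blast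
    then have \<sigma>: "\<sigma> n \<in> A" for n by auto
    define g where "g a z = lim (\<lambda>n. ext a (\<sigma> n) z)" for a z
    have unif: "uniform_limit L (\<lambda>n. ext a (\<sigma> n)) (g a) sequentially" if L: "compact L" "L \<subseteq> T" for a L
    proof -
      have "uniformly_Cauchy_on L (\<lambda>n. ext a (\<sigma> n))"
      proof (rule uniformly_Cauchy_onI)
        fix e :: real assume "e > 0"
        then obtain \<eta> where \<eta>: "\<eta> > 0" "\<forall>f\<in>A. \<forall>g\<in>A. d f g < \<eta> \<longrightarrow> sup_on L (ext a (f - g)) < ennreal e"
          using M.metric_imp_seminorm[OF seminorms_I[OF L], of e a] by blast
        obtain N where N: "\<forall>n n'. N \<le> n \<longrightarrow> N \<le> n' \<longrightarrow> d (\<sigma> n) (\<sigma> n') < \<eta>"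
          using cau \<eta>(1) unfolding M.MCauchy_def by blast
        have "dist (ext a (\<sigma> n) z) (ext a (\<sigma> n') z) < e" if "z \<in> L" "N \<le> n" "N \<le> n'" for n n' z
        proof -
          have "sup_on L (ext a (\<sigma> n - \<sigma> n')) < ennreal e" using N \<eta>(2) \<sigma> that by blast
          then have "cmod (ext a (\<sigma> n - \<sigma> n') z) < e" using that(1) by (rule sup_on_lessD)
          then show ?thesis
            by (simp add: ext_diff[OF \<sigma>[of n] \<sigma>[of n'] subsetD[OF L(2) that(1)]] dist_norm)
        qed
        then show "\<exists>M. \<forall>x\<in>L. \<forall>m\<ge>M. \<forall>n\<ge>M. dist (ext a (\<sigma> m) x) (ext a (\<sigma> n) x) < e" by blast
      qed
      then have "uniformly_convergent_on L (\<lambda>n. ext a (\<sigma> n))"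
        by (rule Cauchy_uniformly_convergent)
      then show ?thesis unfolding g_def uniformly_convergent_uniform_limit_iff .
    qed
    have contg: "continuous_on T (g a)" for a
      unfolding continuous_on_sequentially
    proof (intro allI ballI impI, elim conjE)
      fix x z assume z: "z \<in> T" and x: "\<forall>n. x n \<in> T" "x \<longlonglongrightarrow> z"
      \<comment> \<open>A convergent sequence together with its limit is compact, so uniform
        convergence on compact sets yields sequential continuity on \<open>T\<close> without a
        compact neighbourhood of \<open>z\<close>.\<close>
      have L: "compact (insert z (range x))" "insert z (range x) \<subseteq> T"
        using compact_sequence_with_limit[OF x(2)] x(1) z by auto
      have "continuous_on (insert z (range x)) (g a)"
      proof (rule uniform_limit_theorem[OF _ unif[OF L]])
        show "\<forall>\<^sub>F n in sequentially. continuous_on (insert z (range x)) (ext a (\<sigma> n))"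
          by (intro always_eventually allI continuous_on_subset[OF continuous_on_ext[OF \<sigma>] L(2)])
      qed simp
      then show "(g a \<circ> x) \<longlonglongrightarrow> g a z"
        unfolding continuous_on_sequentially using x(2) by blast
    qed
    define f where "f z = (if z \<in> D then g 0 z else 0)" for z
    have idx0: "idxs (0 :: nat ^ 'n) = []" by (simp add: idxs_def)
    have lim: "uniform_limit L \<sigma> f sequentially" if "compact L" "L \<subseteq> D" for L
    proof -
      have "uniform_limit L (\<lambda>n. ext 0 (\<sigma> n)) (g 0) sequentially"
        using unif that D_subset_T by blast
      then show ?thesis
        by (rule uniform_limit_cong'[THEN iffD1, rotated -1])
          (use that(2) in \<open>auto simp: f_def ext_eq[OF \<sigma>] mixed_deriv_eq_pd idx0\<close>)
    qed
    have hol: "holomorphic_several f D"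
      by (rule holomorphic_several_limit[OF A_holomorphic[OF \<sigma>] lim])
    have fs: "sep_hol f D" using hol by (rule holomorphic_several_imp_sep_hol)
    have ext_g: "is_cont_ext \<Omega> S a f (g a)" for a
      unfolding is_cont_ext_def
    proof (intro conjI contg ballI)
      fix z assume z: "z \<in> D"
      have "uniform_limit {z} (\<lambda>n. pd (idxs a) (\<sigma> n)) (pd (idxs a) f) sequentially"
        by (rule uniform_limit_pd[OF A_sep_hol[OF \<sigma>] fs lim]) (use z in auto)
      then have 1: "(\<lambda>n. mixed_deriv a (\<sigma> n) z) \<longlonglongrightarrow> mixed_deriv a f z"
        unfolding mixed_deriv_eq_pd by (rule tendsto_uniform_limitI) simp
      have "z \<in> T" using z D_subset_T by blast
      then have "uniform_limit {z} (\<lambda>n. ext a (\<sigma> n)) (g a) sequentially"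
        by (intro unif) auto
      then have "(\<lambda>n. ext a (\<sigma> n) z) \<longlonglongrightarrow> g a z"
        by (rule tendsto_uniform_limitI) simp
      then have "(\<lambda>n. mixed_deriv a (\<sigma> n) z) \<longlonglongrightarrow> g a z"
        by (simp add: ext_eq[OF \<sigma> z])
      then show "g a z = mixed_deriv a f z" using 1 LIMSEQ_unique by blast
    qed
    have fA: "f \<in> A" by (rule A_I[OF _ hol ext_g]) (simp only: f_def if_False)
    have "limitin M.mtopology \<sigma> f sequentially"
      unfolding M.limitin_metric
    proof (intro conjI allI impI)
      show "f \<in> (\<lambda>f. f) ` A" using fA by simp
      fix \<epsilon> :: real assume "\<epsilon> > 0"
      obtain F r where F: "finite F" "F \<subseteq> A_inf_seminorms \<Omega> S" "r > 0"
        "\<forall>f\<in>A. \<forall>g\<in>A. (\<forall>p\<in>F. p (f - g) < ennreal r) \<longrightarrow> d f g < \<epsilon>"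
        using M.seminorm_imp_metric[OF \<open>\<epsilon> > 0\<close>] by blast
      have "\<forall>\<^sub>F n in sequentially. \<forall>p\<in>F. p (\<sigma> n - f) < ennreal r"
      proof (intro eventually_ball_finite F(1) ballI)
        fix p assume "p \<in> F"
        then obtain L a where p: "p = (\<lambda>f. sup_on L (ext a f))" "compact L" "L \<subseteq> T"
          using F(2) by (auto simp: A_inf_seminorms_def)
        have "\<forall>\<^sub>F n in sequentially. \<forall>z\<in>L. dist (ext a (\<sigma> n) z) (g a z) < r/2"
          by (rule uniform_limitD[OF unif[OF p(2,3)]]) (use F(3) in simp)
        then show "\<forall>\<^sub>F n in sequentially. p (\<sigma> n - f) < ennreal r"
        proof (rule eventually_mono)
          fix n assume n: "\<forall>z\<in>L. dist (ext a (\<sigma> n) z) (g a z) < r/2"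
          have "cmod (ext a (\<sigma> n - f) z) \<le> r/2" if "z \<in> L" for z
            using n[rule_format, OF that]
            by (simp add: ext_diff[OF \<sigma>[of n] fA subsetD[OF p(3) that]] ext_eqI[OF ext_g subsetD[OF p(3) that]] dist_norm)
          then show "p (\<sigma> n - f) < ennreal r"
            unfolding p(1) by (rule sup_on_less) (use F(3) in auto)
        qed
      qed
      then show "\<forall>\<^sub>F n in sequentially. \<sigma> n \<in> (\<lambda>f. f) ` A \<and> d (\<sigma> n) f < \<epsilon>"
      proof (rule eventually_mono)
        fix n assume "\<forall>p\<in>F. p (\<sigma> n - f) < ennreal r"
        then have "d (\<sigma> n) f < \<epsilon>" using F(4) fA \<sigma>[of n] by blast
        then show "\<sigma> n \<in> (\<lambda>f. f) ` A \<and> d (\<sigma> n) f < \<epsilon>" using \<sigma>[of n] by simp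
      qed
    qed
    then show "\<exists>x. limitin M.mtopology \<sigma> x sequentially" by blast
  qed
  then show ?thesis by simp
qed

end

section \<open>Approximation of polynomials and germs in all derivatives\<close>

text \<open>The exhausting sets are discs minus the domain and minus finitely many small discs, the latter
  chosen along a compact connected subset of the complement of \<open>K\<close> that joins the domain to infinity.\<close>

lemma planar_exhaustion:
  fixes \<Omega> S :: "complex set"
  assumes \<Omega>: "open \<Omega>" "connected \<Omega>" "\<Omega> \<noteq> {}"
  shows "\<exists>\<C>. countable \<C> \<and> (\<forall>C\<in>\<C>. compact C \<and> connected (- C) \<and> C \<inter> (\<Omega> \<union> closure S) = {}) \<and>
    (\<forall>K. compact K \<longrightarrow> connected (- K) \<longrightarrow> K \<inter> (\<Omega> \<union> closure S) = {} \<longrightarrow> (\<exists>C\<in>\<C>. K \<subseteq> C))"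
proof -
  obtain D :: "complex set" where D: "countable D" "\<And>X. open X \<Longrightarrow> X \<noteq> {} \<Longrightarrow> \<exists>d\<in>D. d \<in> X"
    using countable_dense_setE by blast
  define \<B> where "\<B> = (\<lambda>(x, n). ball x (1 / real (Suc n))) ` (D \<times> UNIV)"
  have B: "countable \<B>" "\<And>b. b \<in> \<B> \<Longrightarrow> open b \<and> connected b"
    unfolding \<B>_def using D(1) by auto
  \<comment> \<open>The discs in \<open>F\<close> belong to a countable family and \<open>R\<close>
    is a natural number, so there are countably many candidates; the suitable ones are selected
    afterwards.\<close>
  define \<C>0 where "\<C>0 = (\<lambda>(R, F). cball 0 (real R) - (\<Omega> \<union> \<Union>F)) ` (UNIV \<times> {F. finite F \<and> F \<subseteq> \<B>})"
  define \<C> where "\<C> = {C \<in> \<C>0. compact C \<and> connected (- C) \<and> C \<inter> (\<Omega> \<union> closure S) = {}}"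
  have "countable \<C>0"
    unfolding \<C>0_def using countable_Collect_finite_subset[OF B(1)] by (intro countable_image countable_SIGMA) auto
  then have "countable \<C>" unfolding \<C>_def by (rule countable_subset[rotated]) auto
  moreover have "\<exists>C\<in>\<C>. K \<subseteq> C" if K: "compact K" "connected (- K)" "K \<inter> (\<Omega> \<union> closure S) = {}" for K
  proof -
    obtain r where r: "K \<subseteq> ball 0 r" using bounded_subset_ballD[OF compact_imp_bounded[OF K(1)]] by blast
    obtain R :: nat where R: "r \<le> real R" using real_arch_simple by blast
    obtain a where a: "a \<in> \<Omega>" using \<Omega>(3) by blast
    define p where "p = complex_of_real (real R + 1)"
    have p: "norm p > real R" by (simp add: p_def del: of_real_add)
    have KR: "K \<subseteq> cball 0 (real R)" using r R by force
    have "compact (insert a (insert p (closure S \<inter> cball 0 (real R))))"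
      by (simp add: closed_Int_compact)
    moreover have "insert a (insert p (closure S \<inter> cball 0 (real R))) \<subseteq> - K"
      using K(3) a p KR by auto
    \<comment> \<open>The set \<open>C\<close> joins a point of the domain, a point outside the
      large disc and the part of \<open>closure S\<close> inside that disc. Covering it by small
      discs off \<open>K\<close> therefore removes \<open>closure S\<close> and makes the total
      removed set connected with the exterior.\<close>
    ultimately obtain C where C: "compact C" "connected C" "insert a (insert p (closure S \<inter> cball 0 (real R))) \<subseteq> C" "C \<subseteq> - K"
      using compact_connected_superset[of "- K"] K by (metis compact_imp_closed open_Compl)
    define \<B>' where "\<B>' = {b \<in> \<B>. b \<subseteq> - K \<and> b \<inter> C \<noteq> {}}"
    have cover: "C \<subseteq> \<Union>\<B>'"
    proof
      fix x assume x: "x \<in> C"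
      then have "x \<in> - K" using C(4) by blast
      moreover have "open (- K)" using K(1) compact_imp_closed by blast
      ultimately obtain e where e: "e > 0" "ball x e \<subseteq> - K" using open_contains_ball by blast
      obtain n where n: "1 / real (Suc n) < e / 2" using nat_approx_posE[of "e/2"] e(1) by auto
      have "ball x (1 / real (Suc n)) \<noteq> {}" by simp
      then obtain y where y: "y \<in> D" "y \<in> ball x (1 / real (Suc n))" using D(2) open_ball by blast
      have "ball y (1 / real (Suc n)) \<subseteq> ball x e"
      proof
        fix z assume "z \<in> ball y (1 / real (Suc n))"
        then show "z \<in> ball x e" using y(2) n dist_triangle[of x z y] by simp
      qed
      moreover have xy: "x \<in> ball y (1 / real (Suc n))" using y(2) by (simp add: dist_commute)
      moreover have "ball y (1 / real (Suc n)) \<in> \<B>"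
        unfolding \<B>_def by (rule image_eqI[of _ _ "(y, n)"]) (use y(1) in auto)
      ultimately have "ball y (1 / real (Suc n)) \<in> \<B>'"
        unfolding \<B>'_def using e(2) x by blast
      then show "x \<in> \<Union>\<B>'" using xy by (rule UnionI)
    qed
    have oB: "open b" if "b \<in> \<B>'" for b
      using that B(2) unfolding \<B>'_def by simp
    obtain F where F: "F \<subseteq> \<B>'" "finite F" "C \<subseteq> \<Union>F"
      by (rule compactE[OF C(1) cover oB])
    have W: "\<Union>F = (\<Union>b\<in>F. C \<union> b)" using F(3) C(3) by auto
    have "connected (\<Union>F)"
      unfolding W
    proof (rule connected_Union)
      fix s assume "s \<in> (\<lambda>b. C \<union> b) ` F"
      then obtain b where b: "b \<in> F" "s = C \<union> b" by blast
      then have "b \<in> \<B>'" using F(1) by (auto dest: subsetD)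
      then have "connected b" "C \<inter> b \<noteq> {}" using B(2) unfolding \<B>'_def by auto
      then show "connected s" unfolding b(2) by (intro connected_Un C(2))
    next
      show "\<Inter> ((\<lambda>b. C \<union> b) ` F) \<noteq> {}" using C(3) by blast
    qed
    moreover have aF: "a \<in> \<Union>F" "p \<in> \<Union>F" using C(3) F(3) by auto
    ultimately have "connected (\<Omega> \<union> \<Union>F)" using a \<Omega>(2) by (intro connected_Un) auto
    moreover have "connected (- cball (0::complex) (real R))"
      by (intro path_connected_imp_connected path_connected_complement_bounded_convex) auto
    moreover have "p \<in> - cball 0 (real R)" using p by simp
    ultimately have "connected (- cball 0 (real R) \<union> (\<Omega> \<union> \<Union>F))"
      using aF by (intro connected_Un[of "- cball 0 (real R)" "\<Omega> \<union> \<Union>F"]) blast+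
    moreover define K' where "K' = cball 0 (real R) - (\<Omega> \<union> \<Union>F)"
    moreover have "- K' = - cball 0 (real R) \<union> (\<Omega> \<union> \<Union>F)" unfolding K'_def by auto
    ultimately have "connected (- K')" by simp
    moreover have "open (\<Omega> \<union> \<Union>F)"
      by (intro open_Un \<Omega>(1) open_Union ballI oB subsetD[OF F(1)])
    then have "compact K'" unfolding K'_def by (intro compact_diff) auto
    moreover have "K' \<inter> (\<Omega> \<union> closure S) = {}" unfolding K'_def using C(3) F(3) by auto
    moreover have FB: "F \<subseteq> \<B>" "\<Union>F \<subseteq> - K" using F(1) unfolding \<B>'_def by auto
    then have "K' \<in> \<C>0"
      unfolding K'_def \<C>0_def using F(2) by (intro image_eqI[of _ _ "(R, F)"]) auto
    ultimately have "K' \<in> \<C>" unfolding \<C>_def by blast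
    moreover have "K \<subseteq> K'"
      unfolding K'_def using KR K(3) FB(2) by blast
    ultimately show ?thesis by blast
  qed
  ultimately show ?thesis
    by (intro exI[of _ \<C>]) (auto simp: \<C>_def)
qed

section \<open>Cauchy estimates and polynomial approximation of derivatives\<close>

lemma mixed_deriv_uniform:
  assumes "e > 0" "finite B"
  shows "\<exists>C>0. \<forall>a\<in>B. \<forall>f U z M. sep_hol f U \<longrightarrow> cball z e \<subseteq> U \<longrightarrow> (\<forall>w\<in>cball z e. norm (f w) \<le> M)
    \<longrightarrow> norm (mixed_deriv a f z) \<le> C * M"
proof -
  have "\<exists>C>0. \<forall>f U z M. sep_hol f U \<longrightarrow> cball z e \<subseteq> U \<longrightarrow> (\<forall>w\<in>cball z e. norm (f w) \<le> M)
    \<longrightarrow> norm (mixed_deriv a f z) \<le> C * M" for a :: "nat ^ 'a"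
    unfolding mixed_deriv_eq_pd by (rule pd_bound[OF assms(1)])
  then obtain C where C: "\<And>a :: nat ^ 'a. C a > 0" "\<And>a f U z M. sep_hol f U \<Longrightarrow> cball z e \<subseteq> U \<Longrightarrow>
    (\<forall>w\<in>cball z e. norm (f w) \<le> M) \<Longrightarrow> norm (mixed_deriv a f z) \<le> C a * M"
    by metis
  define c where "c = (\<Sum>a\<in>B. C a) + 1"
  have "C a \<le> c" if "a \<in> B" for a
    unfolding c_def using member_le_sum[OF that, of C] C(1) assms(2) by (simp add: less_imp_le add_increasing2)
  moreover have "c > 0" unfolding c_def using C(1) by (intro add_nonneg_pos sum_nonneg) (auto intro: less_imp_le)
  moreover have "norm (mixed_deriv a f z) \<le> c * M"
    if "a \<in> B" and f: "sep_hol f U" "cball z e \<subseteq> U" "\<forall>w\<in>cball z e. norm (f w) \<le> M" for a f U z M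
  proof -
    \<comment> \<open>The centre lies in the ball, so \<open>M\<close> is nonnegative and enlarging
      the constant only weakens the bound.\<close>
    have "norm (f z) \<le> M" using f(3) assms(1) by simp
    then have "0 \<le> M" using norm_ge_zero order_trans by blast
    then have "C a * M \<le> c * M" using \<open>\<And>a. a \<in> B \<Longrightarrow> C a \<le> c\<close>[OF that(1)] by (rule mult_right_mono[rotated])
    then show ?thesis using C(2)[OF f, of a] by simp
  qed
  ultimately show ?thesis by blast
qed

text \<open>Closeness of values on the open set \<open>V\<close> passes to derivatives on
  \<open>K\<close>, because balls of one fixed radius around \<open>K\<close> lie in
  \<open>V\<close> and Cauchy estimates apply on them.\<close>

lemma approximable_mixed_deriv:
  assumes "approximable polynomials V h" "sep_hol h V" "compact K" "K \<subseteq> V" "finite B" "\<epsilon> > 0"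
  shows "\<exists>p\<in>polynomials. \<forall>a\<in>B. \<forall>z\<in>K. cmod (mixed_deriv a p z - mixed_deriv a h z) < \<epsilon>"
proof -
  obtain e where e: "e > 0" "(\<Union>x\<in>K. cball x e) \<subseteq> V"
    using compact_subset_open_imp_cball_epsilon_subset[OF assms(3) sep_hol_open[OF assms(2)] assms(4)] by blast
  obtain C where C: "C > 0" "\<forall>a\<in>B. \<forall>f U z M. sep_hol f U \<longrightarrow> cball z e \<subseteq> U \<longrightarrow> (\<forall>w\<in>cball z e. norm (f w) \<le> M)
    \<longrightarrow> norm (mixed_deriv a f z) \<le> C * M"
    using mixed_deriv_uniform[OF e(1) assms(5)] by blast
  have "\<epsilon> / (2 * C) > 0" using assms(6) C(1) by simp
  then obtain p where p: "p \<in> polynomials" "\<forall>z\<in>V. norm (h z - p z) < \<epsilon> / (2 * C)"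
    using assms(1) unfolding approximable_def by blast
  have ps: "sep_hol p V" using p(1) sep_hol_open[OF assms(2)] by (rule sep_hol_polynomial)
  have "cmod (mixed_deriv a p z - mixed_deriv a h z) < \<epsilon>" if "a \<in> B" "z \<in> K" for a z
  proof -
    have sub: "cball z e \<subseteq> V" using e(2) that(2) by blast
    have "norm (mixed_deriv a (\<lambda>z. p z - h z) z) \<le> C * (\<epsilon> / (2 * C))"
    proof (rule C(2)[rule_format, OF that(1)])
      show "sep_hol (\<lambda>z. p z - h z) V" by (rule sep_hol_diff[OF ps assms(2)])
      show "norm (p w - h w) \<le> \<epsilon> / (2 * C)" if "w \<in> cball z e" for w
        using p(2)[rule_format, OF subsetD[OF sub that]] by (simp add: norm_minus_commute)
    qed (fact sub)
    also have "\<dots> < \<epsilon>" using C(1) assms(6) by simp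
    finally show ?thesis
      using pd_diff[OF ps assms(2), of z "idxs a"] that(2) assms(4) by (simp add: mixed_deriv_eq_pd subset_iff)
  qed
  then show ?thesis using p(1) by blast
qed

lemma holo_near_approx:
  fixes K :: "'n::finite \<Rightarrow> complex set"
  assumes K: "\<And>i. compact (K i)" "\<And>i. connected (- K i)" and h: "h \<in> holo_near (cprod K)" and "finite B" "\<epsilon> > 0"
  shows "\<exists>p\<in>polynomials. \<forall>a\<in>B. \<forall>z\<in>cprod K. cmod (mixed_deriv a p z - mixed_deriv a h z) < \<epsilon>"
proof -
  obtain U where U: "cprod K \<subseteq> U" "sep_hol h U" using h by (rule holo_near_sep_hol)
  obtain V where V: "open V" "cprod K \<subseteq> V" "V \<subseteq> U" "approximable polynomials V h"
    using runge_several[OF K U(2,1)] by blast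
  have "sep_hol h V" using U(2) V(1,3) by (rule sep_hol_subset)
  then show ?thesis
    using approximable_mixed_deriv[OF V(4) _ compact_cprod[of K] V(2) assms(4,5)] K(1) by blast
qed

lemma mixed_deriv_polynomial_bounded:
  assumes "p \<in> polynomials" "compact K"
  shows "\<exists>M. \<forall>z\<in>K. cmod (mixed_deriv a p z) \<le> M"
proof -
  have "continuous_on UNIV (mixed_deriv a p)"
    unfolding mixed_deriv_eq_pd by (rule sep_hol_continuous[OF sep_hol_pd[OF sep_hol_polynomial[OF assms(1) open_UNIV]]])
  then have "compact (mixed_deriv a p ` K)"
    using assms(2) compact_continuous_image continuous_on_subset by blast
  then show ?thesis using compact_imp_bounded bounded_iff by (metis imageI)
qed

lemma mixed_deriv_polynomial_sum:
  assumes "\<And>k. k \<in> F \<Longrightarrow> f k \<in> polynomials"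
  shows "mixed_deriv a (\<lambda>z. \<Sum>k\<in>F. c k * f k z) z = (\<Sum>k\<in>F. c k * mixed_deriv a (f k) z)"
proof -
  have fs: "sep_hol (f k) UNIV" if "k \<in> F" for k
    using assms[OF that] by (simp add: sep_hol_polynomial)
  have "mixed_deriv a (\<lambda>z. \<Sum>k\<in>F. c k * f k z) z = (\<Sum>k\<in>F. mixed_deriv a (\<lambda>z. c k * f k z) z)"
    unfolding mixed_deriv_eq_pd by (rule pd_sum[of UNIV]) (auto intro: sep_hol_cmult fs)
  also have "\<dots> = (\<Sum>k\<in>F. c k * mixed_deriv a (f k) z)"
    unfolding mixed_deriv_eq_pd by (rule sum.cong) (auto intro: pd_cmult[OF fs])
  finally show ?thesis .
qed

text \<open>Coefficients are drawn from a countable dense set of complex numbers. For a given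
  \<open>p\<close> only its finitely many monomials enter, and their derivatives are bounded on
  \<open>K\<close>. Restricting the coefficient function to \<open>F\<close> makes it extensional,
  as \<open>PiE\<close> demands.\<close>

lemma countable_dense_polynomials:
  "\<exists>Q. countable Q \<and> Q \<noteq> {} \<and> Q \<subseteq> (polynomials :: (complex ^ 'n::finite \<Rightarrow> complex) set) \<and>
    (\<forall>p\<in>polynomials. \<forall>K B \<epsilon>. compact K \<longrightarrow> finite B \<longrightarrow> \<epsilon> > 0 \<longrightarrow>
      (\<exists>q\<in>Q. \<forall>a\<in>B. \<forall>z\<in>K. cmod (mixed_deriv a q z - mixed_deriv a p z) < \<epsilon>))"
proof -
  obtain D :: "complex set" where D: "countable D" "\<And>X. open X \<Longrightarrow> X \<noteq> {} \<Longrightarrow> \<exists>d\<in>D. d \<in> X"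
    using countable_dense_setE by blast
  define Q :: "(complex ^ 'n \<Rightarrow> complex) set" where
    "Q = (\<Union>F\<in>{F. finite F}. (\<lambda>c z. \<Sum>a\<in>F. c a * monomial a z) ` PiE F (\<lambda>_. D))"
  have "countable Q"
    unfolding Q_def
  proof (rule countable_UN)
    show "countable {F :: (nat ^ 'n) set. finite F}" by (rule countable_Collect_finite)
    show "countable ((\<lambda>c z. \<Sum>a\<in>F. c a * monomial a z) ` PiE F (\<lambda>_. D))" if "F \<in> {F. finite F}" for F :: "(nat ^ 'n) set"
      using that D(1) by (intro countable_image countable_PiE) auto
  qed
  moreover have "Q \<noteq> {}" unfolding Q_def by (auto intro!: exI[of _ "{}"])
  moreover have "Q \<subseteq> polynomials" unfolding Q_def by (auto intro!: polynomials_sum)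
  moreover have appr: "\<exists>q\<in>Q. \<forall>a\<in>B. \<forall>z\<in>K. cmod (mixed_deriv a q z - mixed_deriv a p z) < \<epsilon>"
    if p: "p \<in> polynomials" and K: "compact K" and B: "finite B" and e: "\<epsilon> > 0" for p K B \<epsilon>
  proof -
    obtain F c where F: "finite F" "p = (\<lambda>z. \<Sum>a\<in>F. c a * monomial a z)"
      using p by (auto simp: polynomials_def)
    have "\<exists>M. \<forall>z\<in>K. cmod (mixed_deriv a (monomial b) z) \<le> M" for a b :: "nat ^ 'n"
      by (rule mixed_deriv_polynomial_bounded[OF polynomials_monomial K])
    then obtain M where M: "\<And>a b z. z \<in> K \<Longrightarrow> cmod (mixed_deriv a (monomial b) z) \<le> M a b" by metis
    define M' where "M' = (\<Sum>a\<in>B. \<Sum>b\<in>F. \<bar>M a b\<bar>) + 1"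
    have M': "M' > 0" unfolding M'_def by (intro add_nonneg_pos sum_nonneg) auto
    define \<delta> where "\<delta> = \<epsilon> / M'"
    have "\<delta> > 0" using e M' by (simp add: \<delta>_def)
    then have "\<exists>x\<in>D. x \<in> ball (c b) \<delta>" for b by (intro D(2)) auto
    then obtain c' where c': "\<And>b. c' b \<in> D" "\<And>b. cmod (c b - c' b) < \<delta>"
      by (metis dist_norm mem_ball)
    define q where "q = (\<lambda>z. \<Sum>a\<in>F. restrict c' F a * monomial a z)"
    have "q \<in> Q" unfolding Q_def q_def
      by (intro UN_I[of F] imageI) (use F c' in auto)
    moreover have "cmod (mixed_deriv a q z - mixed_deriv a p z) < \<epsilon>" if a: "a \<in> B" and z: "z \<in> K" for a z
    proof -
      have "mixed_deriv a q z - mixed_deriv a p z = (\<Sum>b\<in>F. (restrict c' F b - c b) * mixed_deriv a (monomial b) z)"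
        unfolding q_def F(2)
        by (simp add: mixed_deriv_polynomial_sum[OF polynomials_monomial] sum_subtractf left_diff_distrib)
      also have "cmod \<dots> \<le> (\<Sum>b\<in>F. \<delta> * \<bar>M a b\<bar>)"
      proof (rule sum_norm_le)
        fix b assume b: "b \<in> F"
        have "cmod (mixed_deriv a (monomial b) z) \<le> \<bar>M a b\<bar>" using M[OF z, of a b] by linarith
        moreover have "cmod (restrict c' F b - c b) \<le> \<delta>" using c'(2)[of b] b by (simp add: norm_minus_commute)
        ultimately show "cmod ((restrict c' F b - c b) * mixed_deriv a (monomial b) z) \<le> \<delta> * \<bar>M a b\<bar>"
          unfolding norm_mult using \<open>\<delta> > 0\<close> by (intro mult_mono) auto
      qed
      also have "\<dots> = \<delta> * (\<Sum>b\<in>F. \<bar>M a b\<bar>)" by (simp add: sum_distrib_left)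
      also have "\<dots> \<le> \<delta> * (\<Sum>a\<in>B. \<Sum>b\<in>F. \<bar>M a b\<bar>)"
        using \<open>\<delta> > 0\<close> member_le_sum[OF a, of "\<lambda>a. \<Sum>b\<in>F. \<bar>M a b\<bar>"] B
        by (intro mult_left_mono) (auto intro: sum_nonneg)
      also have "\<dots> < \<delta> * M'" using \<open>\<delta> > 0\<close> by (simp add: M'_def)
      also have "\<dots> = \<epsilon>" using M' by (simp add: \<delta>_def)
      finally show ?thesis .
    qed
    ultimately show ?thesis by blast
  qed
  ultimately show ?thesis by (intro exI[of _ Q] conjI ballI allI impI appr)
qed

text \<open>\<open>L'\<close> is the complement of the component of \<open>- L\<close> that contains
  \<open>C\<close>. As \<open>C\<close> is unbounded, this component is the unbounded one and
  swallows the exterior of a disc, so \<open>L'\<close> is bounded; inside a bounded component this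
  would fail.\<close>

lemma filled_compact:
  fixes L C :: "complex set"
  assumes L: "compact L" and C: "connected C" "\<not> bounded C" "C \<subseteq> - L"
  obtains L' where "compact L'" "L \<subseteq> L'" "L' \<inter> C = {}" "connected (- L')"
proof -
  have "C \<noteq> {}" using C(2) by auto
  then obtain x where x: "x \<in> C" by blast
  define U where "U = connected_component_set (- L) x"
  have CU: "C \<subseteq> U" unfolding U_def using C x by (intro connected_component_maximal)
  have unb: "\<not> bounded U" using C(2) bounded_subset[OF _ CU] by blast
  obtain R where R: "L \<subseteq> ball 0 R" using bounded_subset_ballD[OF compact_imp_bounded[OF L]] by blast
  have "- U \<subseteq> ball 0 R"
  proof
    fix y assume y: "y \<in> - U"
    show "y \<in> ball 0 R"
    proof (rule ccontr)
      assume yR: "y \<notin> ball 0 R"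
      have E: "connected (- ball (0::complex) R)"
        by (intro path_connected_imp_connected path_connected_complement_bounded_convex) auto
      have "- ball 0 R \<subseteq> connected_component_set (- L) y"
        using E R yR by (intro connected_component_maximal) auto
      moreover have "\<not> bounded (- ball (0::complex) R)"
        by (meson bounded_ball cobounded_imp_unbounded)
      ultimately have "\<not> bounded (connected_component_set (- L) y)"
        by (meson bounded_subset)
      then have "connected_component_set (- L) y = U"
        unfolding U_def using unb L compact_imp_bounded
        by (intro cobounded_unique_unbounded_component) (auto simp: U_def)
      moreover have "y \<in> connected_component_set (- L) y" using R yR by auto
      ultimately show False using y by blast
    qed
  qed
  moreover have "open U" unfolding U_def using L compact_imp_closed by (intro open_connected_component) auto
  ultimately have "compact (- U)"
    by (meson bounded_ball bounded_subset closed_Compl compact_eq_bounded_closed)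
  moreover have "L \<subseteq> - U" unfolding U_def using connected_component_subset by blast
  moreover have "connected (- (- U))" unfolding U_def by simp
  moreover have "- U \<inter> C = {}" using CU by blast
  ultimately show ?thesis by (intro that)
qed

text \<open>The radii of the Cauchy estimates and the bound \<open>M\<close> for
  \<open>p - q\<close> on the compact sets \<open>A1\<close>, \<open>A2\<close> are fixed before
  \<open>\<phi>\<close>; control of \<open>\<phi>\<close> on open neighbourhoods then yields all
  derivatives of orders in \<open>B\<close>.\<close>

lemma polynomial_separation:
  fixes K :: "'n::finite \<Rightarrow> complex set" and L :: "(complex ^ 'n) set"
  assumes K: "\<And>i. compact (K i)" "connected (- K i0)" and L: "compact L"
    and C: "connected C" "\<not> bounded C" "K i0 \<subseteq> C" "\<And>z. z \<in> L \<Longrightarrow> z $ i0 \<notin> C"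
    and p: "p \<in> polynomials" and q: "q \<in> polynomials" and B: "finite B" and e: "\<epsilon> > 0"
  shows "\<exists>P\<in>polynomials. \<forall>a\<in>B. (\<forall>z\<in>cprod K. cmod (mixed_deriv a P z - mixed_deriv a q z) < \<epsilon>) \<and>
    (\<forall>z\<in>L. cmod (mixed_deriv a P z - mixed_deriv a p z) < \<epsilon>)"
proof -
  have "compact ((\<lambda>z. z $ i0) ` L)"
    using L by (intro compact_continuous_image continuous_intros)
  moreover have "C \<subseteq> - (\<lambda>z. z $ i0) ` L" using C(4) by auto
  ultimately obtain L' where L': "compact L'" "(\<lambda>z. z $ i0) ` L \<subseteq> L'" "L' \<inter> C = {}" "connected (- L')"
    using filled_compact[OF _ C(1,2)] by metis
  have disj: "K i0 \<inter> L' = {}" using L'(3) C(3) by blast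
  \<comment> \<open>Janiszewski's theorem: two disjoint compact sets, neither of which separates the
    plane, do not separate it together.\<close>
  then have "connected (- (K i0 \<union> L'))"
    using Janiszewski_connected[OF K(1) compact_imp_closed[OF L'(1)] _ K(2) L'(4)] by simp
  then obtain V W where VW: "open V" "open W" "K i0 \<subseteq> V" "L' \<subseteq> W"
    "\<And>\<epsilon>. \<epsilon> > 0 \<Longrightarrow> \<exists>p. (\<forall>z\<in>V. norm (poly p z) < \<epsilon>) \<and> (\<forall>z\<in>W. norm (1 - poly p z) < \<epsilon>)"
    using runge_separation[OF K(1) L'(1) disj] by metis
  define V' W' where "V' = {z :: complex ^ 'n. z $ i0 \<in> V}" and "W' = {z :: complex ^ 'n. z $ i0 \<in> W}"
  have "V' = (\<lambda>z. z $ i0) -` V" "W' = (\<lambda>z. z $ i0) -` W" by (auto simp: V'_def W'_def)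
  then have op: "open V'" "open W'" using VW(1,2) by (auto intro!: open_vimage continuous_intros)
  have sub: "cprod K \<subseteq> V'" "L \<subseteq> W'" using VW(3,4) L'(2) by (auto simp: V'_def W'_def)
  have cK: "compact (cprod K)" using K(1) by (rule compact_cprod)
  obtain V1 A1 where V1: "open V1" "compact A1" "cprod K \<subseteq> V1" "V1 \<subseteq> A1" "A1 \<subseteq> V'"
    using compact_between[OF cK op(1) sub(1)] by blast
  obtain W1 A2 where W1: "open W1" "compact A2" "L \<subseteq> W1" "W1 \<subseteq> A2" "A2 \<subseteq> W'"
    using compact_between[OF L op(2) sub(2)] by blast
  obtain e1 where e1: "e1 > 0" "(\<Union>x\<in>cprod K. cball x e1) \<subseteq> V1"
    using compact_subset_open_imp_cball_epsilon_subset[OF cK V1(1,3)] by blast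
  obtain e2 where e2: "e2 > 0" "(\<Union>x\<in>L. cball x e2) \<subseteq> W1"
    using compact_subset_open_imp_cball_epsilon_subset[OF L W1(1,3)] by blast
  obtain C1 where C1: "C1 > 0" "\<forall>a\<in>B. \<forall>f U z M. sep_hol f U \<longrightarrow> cball z e1 \<subseteq> U \<longrightarrow>
      (\<forall>w\<in>cball z e1. norm (f w) \<le> M) \<longrightarrow> norm (mixed_deriv a f z) \<le> C1 * M"
    using mixed_deriv_uniform[OF e1(1) B] by blast
  obtain C2 where C2: "C2 > 0" "\<forall>a\<in>B. \<forall>f U z M. sep_hol f U \<longrightarrow> cball z e2 \<subseteq> U \<longrightarrow>
      (\<forall>w\<in>cball z e2. norm (f w) \<le> M) \<longrightarrow> norm (mixed_deriv a f z) \<le> C2 * M"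
    using mixed_deriv_uniform[OF e2(1) B] by blast
  have "compact ((\<lambda>z. p z - q z) ` (A1 \<union> A2))"
    using V1(2) W1(2) by (intro compact_continuous_image compact_Un continuous_on_polynomial polynomials_diff p q)
  then have "bounded ((\<lambda>z. p z - q z) ` (A1 \<union> A2))" by (rule compact_imp_bounded)
  then obtain M0 where M0: "\<forall>y\<in>(\<lambda>z. p z - q z) ` (A1 \<union> A2). norm y \<le> M0"
    unfolding bounded_iff by (rule exE)
  define M where "M = \<bar>M0\<bar> + 1"
  have M: "M > 0" "\<And>z. z \<in> A1 \<union> A2 \<Longrightarrow> norm (p z - q z) \<le> M"
  proof -
    show "M > 0" by (simp add: M_def)
    fix z assume "z \<in> A1 \<union> A2"
    then have "norm (p z - q z) \<le> M0" using M0 by (intro bspec[OF M0] imageI)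
    then show "norm (p z - q z) \<le> M" by (simp add: M_def)
  qed
  \<comment> \<open>The product \<open>\<eta> * M\<close> bounds \<open>P - q\<close> near the
    product \<open>K\<close> and \<open>P - p\<close> near \<open>L\<close>; it has to stay below
    \<open>\<epsilon>\<close> after multiplication by either Cauchy constant.\<close>
  define \<eta> where "\<eta> = \<epsilon> / (2 * (C1 + C2) * M)"
  have \<eta>: "\<eta> > 0" "C1 * (\<eta> * M) < \<epsilon>" "C2 * (\<eta> * M) < \<epsilon>"
  proof -
    show "\<eta> > 0" unfolding \<eta>_def using e C1(1) C2(1) M(1) by (intro divide_pos_pos mult_pos_pos add_pos_pos) auto
    have eq: "\<eta> * M = \<epsilon> / (2 * (C1 + C2))" unfolding \<eta>_def using M(1) by simp
    show "C1 * (\<eta> * M) < \<epsilon>" "C2 * (\<eta> * M) < \<epsilon>"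
      unfolding eq using e C1(1) C2(1) by (simp_all add: divide_simps add_pos_pos)
  qed
  obtain \<phi> where \<phi>: "\<And>z. z \<in> V \<Longrightarrow> norm (poly \<phi> z) < \<eta>" "\<And>z. z \<in> W \<Longrightarrow> norm (1 - poly \<phi> z) < \<eta>"
    using VW(5)[OF \<eta>(1)] by blast
  define P where "P z = q z + poly \<phi> (z $ i0) * (p z - q z)" for z
  have P: "P \<in> polynomials"
    unfolding P_def by (intro polynomials_add polynomials_mult polynomials_diff polynomials_coord_poly p q)
  have sh: "sep_hol P UNIV" "sep_hol p UNIV" "sep_hol q UNIV" using P p q by (auto intro: sep_hol_polynomial)
  have "cmod (mixed_deriv a P z - mixed_deriv a q z) < \<epsilon>" if a: "a \<in> B" and z: "z \<in> cprod K" for a z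
  proof -
    have "norm (mixed_deriv a (\<lambda>z. P z - q z) z) \<le> C1 * (\<eta> * M)"
    proof (rule C1(2)[rule_format, OF a sep_hol_diff[OF sh(1,3)] subset_UNIV])
      fix w assume "w \<in> cball z e1"
      then have w: "w \<in> A1" using e1(2) z V1(4) by blast
      then have "w $ i0 \<in> V" using V1(5) by (auto simp: V'_def)
      then have "norm (poly \<phi> (w $ i0)) * norm (p w - q w) \<le> \<eta> * M"
        using less_imp_le[OF \<phi>(1)] M(2)[of w] w \<eta>(1) by (intro mult_mono) simp_all
      then show "norm (P w - q w) \<le> \<eta> * M" by (simp add: P_def norm_mult)
    qed
    then show ?thesis
      using \<eta>(2) pd_diff[OF sh(1,3), of z "idxs a"] by (simp add: mixed_deriv_eq_pd)
  qed
  moreover have "cmod (mixed_deriv a P z - mixed_deriv a p z) < \<epsilon>" if a: "a \<in> B" and z: "z \<in> L" for a z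
  proof -
    have "norm (mixed_deriv a (\<lambda>z. P z - p z) z) \<le> C2 * (\<eta> * M)"
    proof (rule C2(2)[rule_format, OF a sep_hol_diff[OF sh(1,2)] subset_UNIV])
      fix w assume "w \<in> cball z e2"
      then have w: "w \<in> A2" using e2(2) z W1(4) by blast
      then have "w $ i0 \<in> W" using W1(5) by (auto simp: W'_def)
      then have "norm (1 - poly \<phi> (w $ i0)) * norm (p w - q w) \<le> \<eta> * M"
        using less_imp_le[OF \<phi>(2)] M(2)[of w] w \<eta>(1) by (intro mult_mono) simp_all
      moreover have "P w - p w = - ((1 - poly \<phi> (w $ i0)) * (p w - q w))" by (simp add: P_def algebra_simps)
      then have "norm (P w - p w) = norm (1 - poly \<phi> (w $ i0)) * norm (p w - q w)" by (simp add: norm_mult)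
      ultimately show "norm (P w - p w) \<le> \<eta> * M" by simp
    qed
    then show ?thesis
      using \<eta>(3) pd_diff[OF sh(1,2), of z "idxs a"] by (simp add: mixed_deriv_eq_pd)
  qed
  ultimately show ?thesis using P by blast
qed

section \<open>Universal Taylor series\<close>

text \<open>A finite exhaustion of the multi-indices by one natural number, so that the same
  \<open>s\<close> can later govern orders of derivatives, compact sets and errors.\<close>

definition degree_box :: "nat \<Rightarrow> (nat ^ 'n::finite) set" where
  "degree_box s = {a. \<forall>i. a $ i \<le> s}"

lemma finite_degree_box: "finite (degree_box s)"
  unfolding degree_box_def using finite_vec_le[of "\<chi> i. s"] by simp

lemma degree_box_exhaust: "\<exists>s0. \<forall>s\<ge>s0. a \<in> degree_box s"
proof -
  have "a $ i \<le> (\<Sum>j\<in>UNIV. a $ j)" for i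
    by (rule member_le_sum) auto
  then show ?thesis
    unfolding degree_box_def by (intro exI[of _ "\<Sum>j\<in>UNIV. a $ j"]) (auto intro: order_trans)
qed

locale taylor_setting = smooth_domain \<Omega> S for \<Omega> S :: "'n::finite \<Rightarrow> complex set" +
  fixes N :: "nat \<Rightarrow> nat ^ 'n" and d :: "(complex ^ 'n \<Rightarrow> complex) \<Rightarrow> (complex ^ 'n \<Rightarrow> complex) \<Rightarrow> real"
    and \<rho> :: "(complex ^ 'n) set \<Rightarrow> (complex ^ 'n \<Rightarrow> complex) set \<Rightarrow> (complex ^ 'n \<Rightarrow> complex) set \<Rightarrow> real"
  assumes connected_factor: "\<And>i. connected (\<Omega> i)" and nonempty_factor: "\<And>i. \<Omega> i \<noteq> {}"
    and connected_compl: "\<And>i. connected (- (\<Omega> i \<union> S i))"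
    and bounded_compl: "\<And>i. bounded (- (\<Omega> i \<union> S i)) \<Longrightarrow> \<Omega> i \<union> closure (S i) = UNIV"
    and bij_N: "bij N"
    and d_metric: "A_inf_metric \<Omega> S d"
    and rho_metric: "\<And>K. compact K \<Longrightarrow> O_metric K (\<rho> K)"
begin

sublocale MA: Metric_space A d
  using seminorm_space.inv_metric[OF seminorm_space_A[OF d_metric]] by (simp add: invariant_metric_for_def)

sublocale M: seminorm_space "\<lambda>f. f" A "A_inf_seminorms \<Omega> S" d
  by (rule seminorm_space_A[OF d_metric])

abbreviation X where "X \<equiv> X_inf \<Omega> S"
abbreviation XT where "XT \<equiv> X_inf_topology \<Omega> S"
abbreviation PS where "PS n f \<zeta> \<equiv> partial_sum \<Omega> S N n f \<zeta>"

lemma A_topology: "A_inf_topology \<Omega> S = MA.mtopology"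
  using M.mtopology_eq by (simp add: A_inf_topology_def)

lemma topspace_A: "topspace (A_inf_topology \<Omega> S) = A"
  unfolding A_topology by simp

lemma X_subset_A: "X \<subseteq> A"
  unfolding X_inf_def using closure_of_subset_topspace[of "A_inf_topology \<Omega> S"] by (simp add: topspace_A)

lemma polynomial_in_X: "p \<in> polynomials \<Longrightarrow> restrict0 \<Omega> p \<in> X"
  unfolding X_inf_def
  using closure_of_subset[of "restrict0 \<Omega> ` polynomials" "A_inf_topology \<Omega> S"] restrict0_polynomial
  by (auto simp: topspace_A)

lemma topspace_X: "topspace XT = X"
  unfolding X_inf_topology_def using X_subset_A by (auto simp: topspace_A)

text \<open>\<open>X\<close> is defined as a closure, hence closed in a complete space; Baire's
  theorem is applied to it as a space in its own right.\<close>

lemma completely_metrizable_X: "completely_metrizable_space XT"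
proof -
  have "MA.mcomplete" using A_mcomplete[OF d_metric] by simp
  then have "completely_metrizable_space MA.mtopology"
    by (rule MA.completely_metrizable_space_mtopology)
  then show ?thesis
    unfolding X_inf_topology_def A_topology[symmetric]
    by (intro completely_metrizable_space_closedin) (auto simp: X_inf_def A_topology)
qed

lemma X_iff: "f \<in> X \<longleftrightarrow> f \<in> A \<and> (\<forall>\<epsilon>>0. \<exists>p\<in>polynomials. d f (restrict0 \<Omega> p) < \<epsilon>)"
  unfolding X_inf_def A_topology MA.metric_closure_of
  using restrict0_polynomial by (auto simp: MA.in_mball; meson)

text \<open>Polynomials are dense in \<open>X\<close> by definition, so a subset that comes
  arbitrarily near to each polynomial is dense.\<close>

lemma dense_in_X:
  assumes "U \<subseteq> X" "\<And>p \<epsilon>. p \<in> polynomials \<Longrightarrow> \<epsilon> > 0 \<Longrightarrow> \<exists>g\<in>U. d (restrict0 \<Omega> p) g < \<epsilon>"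
  shows "XT closure_of U = X"
proof -
  have "X \<subseteq> MA.mtopology closure_of U"
  proof
    fix f assume f: "f \<in> X"
    show "f \<in> MA.mtopology closure_of U"
      unfolding MA.metric_closure_of
    proof (intro CollectI conjI allI impI)
      show fA: "f \<in> A" using f X_subset_A by auto
      fix r :: real assume "r > 0"
      then obtain p where p: "p \<in> polynomials" "d f (restrict0 \<Omega> p) < r/2"
        using f X_iff half_gt_zero by blast
      obtain g where g: "g \<in> U" "d (restrict0 \<Omega> p) g < r/2"
        using assms(2)[OF p(1), of "r/2"] \<open>r > 0\<close> by auto
      have mem: "restrict0 \<Omega> p \<in> A" "g \<in> A"
        using restrict0_polynomial[OF p(1)] g(1) assms(1) X_subset_A by auto
      have "d f g < r" using MA.triangle[OF fA mem] p(2) g(2) by simp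
      then have "g \<in> MA.mball f r" using fA mem(2) by (simp add: MA.in_mball)
      then show "\<exists>y\<in>U. y \<in> MA.mball f r" using g(1) by blast
    qed
  qed
  moreover have "XT closure_of U = X \<inter> MA.mtopology closure_of U"
    unfolding X_inf_topology_def A_topology
    using closure_of_subtopology_open[of MA.mtopology X U] assms(1) by blast
  ultimately show ?thesis by blast
qed

lemma d_translate:
  assumes "f \<in> A" "g \<in> A" "h \<in> A"
  shows "d (f + h) (g + h) = d f g"
  using M.inv_metric assms unfolding invariant_metric_for_def by blast

lemma X_add:
  assumes "f \<in> X" "g \<in> X"
  shows "f + g \<in> X"
  unfolding X_iff
proof (intro conjI allI impI)
  have fg: "f \<in> A" "g \<in> A" using assms X_subset_A by auto
  then show fgA: "f + g \<in> A" by (rule A_add)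
  fix \<epsilon> :: real assume "\<epsilon> > 0"
  then have "\<epsilon>/2 > 0" by simp
  obtain p where p: "p \<in> polynomials" "d f (restrict0 \<Omega> p) < \<epsilon>/2"
    using assms(1) \<open>\<epsilon>/2 > 0\<close> unfolding X_iff by blast
  obtain q where q: "q \<in> polynomials" "d g (restrict0 \<Omega> q) < \<epsilon>/2"
    using assms(2) \<open>\<epsilon>/2 > 0\<close> unfolding X_iff by blast
  have pq: "restrict0 \<Omega> p \<in> A" "restrict0 \<Omega> q \<in> A" using p q restrict0_polynomial by auto
  have eq: "restrict0 \<Omega> (\<lambda>z. p z + q z) = restrict0 \<Omega> p + restrict0 \<Omega> q"
    by (simp add: restrict0_def fun_eq_iff)
  have "d (f + g) (restrict0 \<Omega> p + restrict0 \<Omega> q)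
      \<le> d (f + g) (restrict0 \<Omega> p + g) + d (restrict0 \<Omega> p + g) (restrict0 \<Omega> p + restrict0 \<Omega> q)"
    by (rule MA.triangle) (use A_add fg pq in auto)
  also have "d (f + g) (restrict0 \<Omega> p + g) = d f (restrict0 \<Omega> p)"
    by (rule d_translate[OF fg(1) pq(1) fg(2)])
  also have "d (restrict0 \<Omega> p + g) (restrict0 \<Omega> p + restrict0 \<Omega> q) = d g (restrict0 \<Omega> q)"
    using d_translate[OF fg(2) pq(2) pq(1)] by (simp add: add.commute)
  finally have "d (f + g) (restrict0 \<Omega> (\<lambda>z. p z + q z)) < \<epsilon>"
    unfolding eq using p(2) q(2) by linarith
  then show "\<exists>p\<in>polynomials. d (f + g) (restrict0 \<Omega> p) < \<epsilon>"
    using polynomials_add[OF p(1) q(1)] by blast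
qed

text \<open>The metric is translation invariant but not homogeneous, so scaling is carried out on
  finitely many seminorms. Adding 1 to \<open>cmod c\<close> keeps the divisor positive for
  \<open>c = 0\<close>.\<close>

lemma X_cmult:
  assumes "f \<in> X"
  shows "(\<lambda>z. c * f z) \<in> X"
  unfolding X_iff
proof (intro conjI allI impI)
  have f: "f \<in> A" using assms X_subset_A by auto
  then show cf: "(\<lambda>z. c * f z) \<in> A" by (rule A_cmult)
  fix \<epsilon> :: real assume "\<epsilon> > 0"
  obtain F r where F: "finite F" "F \<subseteq> A_inf_seminorms \<Omega> S" "r > 0"
    "\<forall>f\<in>A. \<forall>g\<in>A. (\<forall>p\<in>F. p (f - g) < ennreal r) \<longrightarrow> d f g < \<epsilon>"
    using M.seminorm_imp_metric[OF \<open>\<epsilon> > 0\<close>] by blast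
  define r' where "r' = r / (cmod c + 1)"
  have r': "r' > 0" "cmod c * r' < r"
    using F(3) by (auto simp: r'_def divide_simps add_nonneg_pos)
  obtain \<eta> where \<eta>: "\<eta> > 0" "\<forall>f\<in>A. \<forall>g\<in>A. d f g < \<eta> \<longrightarrow> (\<forall>p\<in>F. p (f - g) < ennreal r')"
    using M.metric_imp_seminorms[OF F(1,2) r'(1)] by blast
  obtain p where p: "p \<in> polynomials" "d f (restrict0 \<Omega> p) < \<eta>"
    using assms \<eta>(1) unfolding X_iff by blast
  have pA: "restrict0 \<Omega> p \<in> A" using p(1) by (rule restrict0_polynomial)
  have eq: "restrict0 \<Omega> (\<lambda>z. c * p z) = (\<lambda>z. c * restrict0 \<Omega> p z)"
    by (simp add: restrict0_def fun_eq_iff)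
  have diff: "(\<lambda>z. c * f z) - (\<lambda>z. c * restrict0 \<Omega> p z) = (\<lambda>z. c * (f - restrict0 \<Omega> p) z)"
    by (simp add: fun_eq_iff right_diff_distrib)
  have "s ((\<lambda>z. c * f z) - (\<lambda>z. c * restrict0 \<Omega> p z)) < ennreal r" if s: "s \<in> F" for s
  proof -
    obtain L a where La: "s = (\<lambda>f. sup_on L (ext a f))" "L \<subseteq> T"
      using s F(2) by (auto simp: A_inf_seminorms_def)
    have "s (f - restrict0 \<Omega> p) < ennreal r'" using \<eta>(2) f pA p(2) s by blast
    then have "cmod (ext a (f - restrict0 \<Omega> p) z) \<le> r'" if "z \<in> L" for z
      using sup_on_lessD[of L _ r' z] that unfolding La(1) by (simp add: less_imp_le)
    then have "cmod (ext a (\<lambda>z. c * (f - restrict0 \<Omega> p) z) z) \<le> cmod c * r'" if "z \<in> L" for z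
      using ext_cmult[OF A_diff[OF f pA] subsetD[OF La(2) that], of a c] that
      by (simp add: norm_mult mult_left_mono)
    then show ?thesis unfolding La(1) diff by (rule sup_on_less) (use r' in auto)
  qed
  then have "d (\<lambda>z. c * f z) (\<lambda>z. c * restrict0 \<Omega> p z) < \<epsilon>"
    using F(4) cf A_cmult[OF pA] by blast
  then show "\<exists>p\<in>polynomials. d (\<lambda>z. c * f z) (restrict0 \<Omega> p) < \<epsilon>"
    unfolding eq[symmetric] using polynomials_cmult[OF p(1)] by blast
qed

lemma zero_in_X: "0 \<in> X"
proof -
  have "restrict0 \<Omega> (\<lambda>z. 0) = 0" by (simp add: restrict0_def fun_eq_iff)
  then show ?thesis using polynomial_in_X[OF polynomials_const[of 0]] by simp
qed

subsection \<open>Partial sums\<close>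

lemma PS_polynomial: "PS n f \<zeta> \<in> polynomials"
  unfolding partial_sum_def
  by (intro polynomials_finite_sum polynomials_cmult polynomials_monomial_shift)

lemma mixed_deriv_PS:
  "mixed_deriv a (PS n f \<zeta>) z
    = (\<Sum>j\<le>n. taylor_coeff \<Omega> S (N j) f \<zeta> * mixed_deriv a (\<lambda>z. monomial (N j) (z - \<zeta>)) z)"
  unfolding partial_sum_def by (rule mixed_deriv_polynomial_sum[OF polynomials_monomial_shift])

lemma mixed_deriv_PS_add:
  assumes "f \<in> A" "g \<in> A" "\<zeta> \<in> T"
  shows "mixed_deriv a (PS n (f + g) \<zeta>) z = mixed_deriv a (PS n f \<zeta>) z + mixed_deriv a (PS n g \<zeta>) z"
  unfolding mixed_deriv_PS taylor_coeff_def ext_add[OF assms]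
  by (simp add: add_divide_distrib distrib_right sum.distrib)

lemma mixed_deriv_PS_cmult:
  assumes "f \<in> A" "\<zeta> \<in> T"
  shows "mixed_deriv a (PS n (\<lambda>z. c * f z) \<zeta>) z = c * mixed_deriv a (PS n f \<zeta>) z"
  unfolding mixed_deriv_PS taylor_coeff_def ext_cmult[OF assms]
  by (simp add: sum_distrib_left mult.assoc)

text \<open>Initial segments of the enumeration eventually contain the finite set of multi-indices
  from \<open>polynomial_taylor\<close>; that set does not depend on the centre, hence neither does
  \<open>n0\<close>.\<close>

lemma PS_restrict0:
  assumes "p \<in> polynomials"
  shows "\<exists>n0. \<forall>n\<ge>n0. \<forall>\<zeta>\<in>T. PS n (restrict0 \<Omega> p) \<zeta> = p"
proof -
  obtain F where F: "finite F \<and> (\<forall>M. finite M \<longrightarrow> F \<subseteq> M \<longrightarrow> (\<forall>\<zeta> z.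
    (\<Sum>a\<in>M. mixed_deriv a p \<zeta> / (\<Prod>i\<in>UNIV. fact (a $ i)) * monomial a (z - \<zeta>)) = p z))"
    using polynomial_taylor[OF assms] by (rule exE)
  have "finite (inv N ` F)" using F by simp
  then obtain n0 where n0: "\<forall>j\<in>inv N ` F. j \<le> n0" by (meson finite_nat_set_iff_bounded_le)
  have "PS n (restrict0 \<Omega> p) \<zeta> = p" if "n \<ge> n0" "\<zeta> \<in> T" for n \<zeta>
  proof
    fix z
    have FN: "F \<subseteq> N ` {..n}"
    proof
      fix a assume "a \<in> F"
      then have "inv N a \<le> n" using n0 that(1) by auto
      moreover have "N (inv N a) = a" using bij_N by (simp add: bij_is_surj surj_f_inv_f)
      ultimately show "a \<in> N ` {..n}" by (metis atMost_iff imageI)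
    qed
    have inj: "inj_on N {..n}" using bij_N bij_is_inj inj_on_subset by blast
    have "PS n (restrict0 \<Omega> p) \<zeta> z
        = (\<Sum>j\<le>n. mixed_deriv (N j) p \<zeta> / (\<Prod>i\<in>UNIV. fact (N j $ i)) * monomial (N j) (z - \<zeta>))"
      unfolding partial_sum_def taylor_coeff_def ext_polynomial[OF assms that(2)] ..
    also have "\<dots> = (\<Sum>a\<in>N ` {..n}. mixed_deriv a p \<zeta> / (\<Prod>i\<in>UNIV. fact (a $ i)) * monomial a (z - \<zeta>))"
      by (simp add: sum.reindex[OF inj])
    also have "\<dots> = p z" using F FN by simp
    finally show "PS n (restrict0 \<Omega> p) \<zeta> z = p z" .
  qed
  then show ?thesis by blast
qed

text \<open>Cauchy estimates on unit balls around the points of \<open>K\<close>: there the argument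
  \<open>w - \<zeta>\<close> stays in \<open>cball 0 (2 * R + 1)\<close> for every centre in
  \<open>L\<close>, so the bound is independent of the centre.\<close>

lemma monomial_shift_bound:
  assumes "compact L" "compact (K :: (complex ^ 'n) set)"
  shows "\<exists>B. \<forall>\<zeta>\<in>L. \<forall>z\<in>K. cmod (mixed_deriv a (\<lambda>w. monomial b (w - \<zeta>)) z) \<le> B"
proof -
  obtain R where R: "\<forall>x\<in>L \<union> K. norm x \<le> R"
    using compact_imp_bounded[OF compact_Un[OF assms]] unfolding bounded_iff by blast
  have "compact (monomial b ` cball 0 (2 * R + 1))"
    by (intro compact_continuous_image continuous_on_polynomial polynomials_monomial compact_cball)
  then obtain M0 where M0: "\<forall>y\<in>monomial b ` cball 0 (2 * R + 1). norm y \<le> M0"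
    using compact_imp_bounded bounded_iff by metis
  obtain C where C: "\<forall>f U z M. sep_hol f U \<longrightarrow> cball z 1 \<subseteq> U \<longrightarrow> (\<forall>w\<in>cball z 1. norm (f w) \<le> M)
    \<longrightarrow> norm (mixed_deriv a f z) \<le> C * M"
    using mixed_deriv_uniform[of 1 "{a}"] by auto
  have "cmod (mixed_deriv a (\<lambda>w. monomial b (w - \<zeta>)) z) \<le> C * M0" if "\<zeta> \<in> L" "z \<in> K" for \<zeta> z
  proof (rule C[rule_format])
    show "sep_hol (\<lambda>w. monomial b (w - \<zeta>)) UNIV"
      by (rule sep_hol_polynomial[OF polynomials_monomial_shift]) simp
    fix w assume w: "w \<in> cball z 1"
    have "norm (w - \<zeta>) \<le> norm (w - z) + norm z + norm \<zeta>"
      using norm_triangle_ineq4[of w \<zeta>] norm_triangle_ineq[of "w - z" z] by simp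
    also have "\<dots> \<le> 1 + R + R" using w R that by (intro add_mono) (auto simp: dist_norm norm_minus_commute)
    finally have "w - \<zeta> \<in> cball 0 (2 * R + 1)" by simp
    then show "norm (monomial b (w - \<zeta>)) \<le> M0" using M0 by blast
  qed simp
  then show ?thesis by blast
qed

text \<open>For fixed \<open>n\<close> only finitely many Taylor coefficients occur, each controlled
  over all of \<open>L\<close> by one seminorm; dividing by factorials does not increase it. This
  continuity in \<open>f\<close>, uniform in the centre, is what makes the sets of the category
  argument open.\<close>

lemma PS_perturb:
  assumes L: "compact L" "L \<subseteq> T" and K: "compact K" and "finite B" "\<delta> > 0"
  shows "\<exists>\<eta>>0. \<forall>f\<in>A. \<forall>g\<in>A. d f g < \<eta> \<longrightarrow> (\<forall>\<zeta>\<in>L. \<forall>a\<in>B. \<forall>z\<in>K.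
    cmod (mixed_deriv a (PS n f \<zeta>) z - mixed_deriv a (PS n g \<zeta>) z) \<le> \<delta>)"
proof -
  obtain c where c: "\<And>a b \<zeta> z. \<zeta> \<in> L \<Longrightarrow> z \<in> K \<Longrightarrow> cmod (mixed_deriv a (\<lambda>w. monomial b (w - \<zeta>)) z) \<le> c a b"
    using monomial_shift_bound[OF L(1) K] by metis
  define c' where "c' = (\<Sum>a\<in>B. \<Sum>j\<le>n. \<bar>c a (N j)\<bar>) + 1"
  have c': "c' > 0" unfolding c'_def by (intro add_nonneg_pos sum_nonneg) auto
  define r where "r = \<delta> / c'"
  have r: "r > 0" using c' \<open>\<delta> > 0\<close> by (simp add: r_def)
  define F where "F = (\<lambda>j f. sup_on L (ext (N j) f)) ` {..n}"
  have F: "finite F" "F \<subseteq> A_inf_seminorms \<Omega> S"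
    using seminorms_I[OF L] by (auto simp: F_def)
  obtain \<eta> where \<eta>: "\<eta> > 0" "\<forall>f\<in>A. \<forall>g\<in>A. d f g < \<eta> \<longrightarrow> (\<forall>p\<in>F. p (f - g) < ennreal r)"
    using M.metric_imp_seminorms[OF F r] by blast
  have "cmod (mixed_deriv a (PS n f \<zeta>) z - mixed_deriv a (PS n g \<zeta>) z) \<le> \<delta>"
    if fg: "f \<in> A" "g \<in> A" "d f g < \<eta>" and \<zeta>: "\<zeta> \<in> L" and a: "a \<in> B" and z: "z \<in> K" for f g \<zeta> a z
  proof -
    have \<zeta>T: "\<zeta> \<in> T" using \<zeta> L(2) by blast
    have tc: "cmod (taylor_coeff \<Omega> S (N j) f \<zeta> - taylor_coeff \<Omega> S (N j) g \<zeta>) \<le> r" if "j \<le> n" for j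
    proof -
      have mem: "(\<lambda>f. sup_on L (ext (N j) f)) \<in> F" unfolding F_def using that by blast
      have "sup_on L (ext (N j) (f - g)) < ennreal r"
        by (rule \<eta>(2)[rule_format, OF fg mem])
      then have "cmod (ext (N j) (f - g) \<zeta>) < r" using \<zeta> by (rule sup_on_lessD)
      then have *: "cmod (ext (N j) f \<zeta> - ext (N j) g \<zeta>) \<le> r" by (simp add: ext_diff[OF fg(1,2) \<zeta>T])
      have "1 \<le> (\<Prod>i\<in>UNIV. fact (N j $ i) :: real)" by (rule prod_ge_1) simp
      moreover have "cmod (\<Prod>i\<in>UNIV. fact (N j $ i)) = (\<Prod>i\<in>UNIV. fact (N j $ i))"
        by (simp add: prod_norm[symmetric])
      ultimately have "cmod ((ext (N j) f \<zeta> - ext (N j) g \<zeta>) / (\<Prod>i\<in>UNIV. fact (N j $ i))) \<le> cmod (ext (N j) f \<zeta> - ext (N j) g \<zeta>)"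
        unfolding norm_divide by (simp add: divide_le_eq mult_right_le_one_le mult_le_cancel_left1)
      then show ?thesis using * by (simp add: taylor_coeff_def diff_divide_distrib)
    qed
    have "cmod (mixed_deriv a (PS n f \<zeta>) z - mixed_deriv a (PS n g \<zeta>) z)
        = cmod (\<Sum>j\<le>n. (taylor_coeff \<Omega> S (N j) f \<zeta> - taylor_coeff \<Omega> S (N j) g \<zeta>) * mixed_deriv a (\<lambda>z. monomial (N j) (z - \<zeta>)) z)"
      unfolding mixed_deriv_PS by (simp add: sum_subtractf left_diff_distrib)
    also have "\<dots> \<le> (\<Sum>j\<le>n. r * \<bar>c a (N j)\<bar>)"
    proof (rule sum_norm_le)
      fix j assume j: "j \<in> {..n}"
      have "cmod (mixed_deriv a (\<lambda>z. monomial (N j) (z - \<zeta>)) z) \<le> \<bar>c a (N j)\<bar>"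
        using c[OF \<zeta> z, of a "N j"] by linarith
      then show "cmod ((taylor_coeff \<Omega> S (N j) f \<zeta> - taylor_coeff \<Omega> S (N j) g \<zeta>) * mixed_deriv a (\<lambda>z. monomial (N j) (z - \<zeta>)) z) \<le> r * \<bar>c a (N j)\<bar>"
        unfolding norm_mult using tc j r by (intro mult_mono) auto
    qed
    also have "\<dots> = r * (\<Sum>j\<le>n. \<bar>c a (N j)\<bar>)" by (simp add: sum_distrib_left)
    also have "\<dots> \<le> r * (\<Sum>a\<in>B. \<Sum>j\<le>n. \<bar>c a (N j)\<bar>)"
      using r member_le_sum[OF a, of "\<lambda>a. \<Sum>j\<le>n. \<bar>c a (N j)\<bar>"] \<open>finite B\<close>
      by (intro mult_left_mono) (auto intro: sum_nonneg)
    also have "\<dots> \<le> r * c'" using r by (intro mult_left_mono) (auto simp: c'_def)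
    also have "\<dots> = \<delta>" using c' by (simp add: r_def)
    finally show ?thesis .
  qed
  then show ?thesis using \<eta>(1) by blast
qed

subsection \<open>Universality in terms of sets of indices\<close>

definition adm :: "('n \<Rightarrow> complex set) \<Rightarrow> bool" where
  "adm K \<longleftrightarrow> (\<forall>i. compact (K i) \<and> connected (- K i)) \<and> cprod K \<inter> cprod (\<lambda>i. \<Omega> i \<union> closure (S i)) = {}"

text \<open>If every coordinate had a common point, these points would assemble to a common point of
  the two products.\<close>

lemma adm_factor:
  assumes "adm K"
  obtains i0 where "K i0 \<inter> (\<Omega> i0 \<union> closure (S i0)) = {}"
proof -
  have "\<exists>i. K i \<inter> (\<Omega> i \<union> closure (S i)) = {}"
  proof (rule ccontr)
    assume "\<not> ?thesis"
    then have "\<forall>i. \<exists>x. x \<in> K i \<inter> (\<Omega> i \<union> closure (S i))" by blast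
    then obtain x where x: "\<And>i. x i \<in> K i \<inter> (\<Omega> i \<union> closure (S i))" by metis
    then have "vec_lambda x \<in> cprod K" "vec_lambda x \<in> cprod (\<lambda>i. \<Omega> i \<union> closure (S i))" by auto
    then show False using assms unfolding adm_def by blast
  qed
  then show ?thesis using that by blast
qed

text \<open>Index sets replace sequences so that passing to a subsequence becomes monotonicity. One
  compact \<open>L\<close> supplies both the centres and the points of comparison; different sets
  for the two roles are handled by their union.\<close>

definition converges_along :: "(complex ^ 'n) set \<Rightarrow> (complex ^ 'n \<Rightarrow> complex) \<Rightarrow> (complex ^ 'n \<Rightarrow> complex) \<Rightarrow> nat set \<Rightarrow> bool" where
  "converges_along K h f \<nu> \<longleftrightarrow> (\<forall>L a \<epsilon>. compact L \<longrightarrow> L \<subseteq> T \<longrightarrow> \<epsilon> > 0 \<longrightarrow> (\<exists>n0. \<forall>n\<in>\<nu>. n \<ge> n0 \<longrightarrow>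
    (\<forall>\<zeta>\<in>L. (\<forall>z\<in>K. cmod (mixed_deriv a (PS n f \<zeta>) z - mixed_deriv a h z) < \<epsilon>) \<and>
           (\<forall>z\<in>L. cmod (mixed_deriv a (PS n f \<zeta>) z - ext a f z) < \<epsilon>))))"

lemma converges_alongD:
  assumes "converges_along K h f \<nu>" "compact L" "L \<subseteq> T" "\<epsilon> > 0"
  obtains n0 where "\<And>n \<zeta> z. n \<in> \<nu> \<Longrightarrow> n \<ge> n0 \<Longrightarrow> \<zeta> \<in> L \<Longrightarrow> z \<in> K \<Longrightarrow> cmod (mixed_deriv a (PS n f \<zeta>) z - mixed_deriv a h z) < \<epsilon>"
    "\<And>n \<zeta> z. n \<in> \<nu> \<Longrightarrow> n \<ge> n0 \<Longrightarrow> \<zeta> \<in> L \<Longrightarrow> z \<in> L \<Longrightarrow> cmod (mixed_deriv a (PS n f \<zeta>) z - ext a f z) < \<epsilon>"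
proof -
  have "\<exists>n0. \<forall>n\<in>\<nu>. n \<ge> n0 \<longrightarrow>
    (\<forall>\<zeta>\<in>L. (\<forall>z\<in>K. cmod (mixed_deriv a (PS n f \<zeta>) z - mixed_deriv a h z) < \<epsilon>) \<and>
           (\<forall>z\<in>L. cmod (mixed_deriv a (PS n f \<zeta>) z - ext a f z) < \<epsilon>))"
    using assms unfolding converges_along_def by simp
  then obtain n0 where n0: "\<forall>n\<in>\<nu>. n \<ge> n0 \<longrightarrow>
    (\<forall>\<zeta>\<in>L. (\<forall>z\<in>K. cmod (mixed_deriv a (PS n f \<zeta>) z - mixed_deriv a h z) < \<epsilon>) \<and>
           (\<forall>z\<in>L. cmod (mixed_deriv a (PS n f \<zeta>) z - ext a f z) < \<epsilon>))" by (rule exE)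
  show ?thesis by (rule that[of n0]) (simp_all add: n0)
qed

lemma converges_alongI:
  assumes "\<And>L a \<epsilon>. compact L \<Longrightarrow> L \<subseteq> T \<Longrightarrow> \<epsilon> > 0 \<Longrightarrow> \<exists>n0. \<forall>n\<in>\<nu>. n \<ge> n0 \<longrightarrow>
    (\<forall>\<zeta>\<in>L. (\<forall>z\<in>K. cmod (mixed_deriv a (PS n f \<zeta>) z - mixed_deriv a h z) < \<epsilon>) \<and>
           (\<forall>z\<in>L. cmod (mixed_deriv a (PS n f \<zeta>) z - ext a f z) < \<epsilon>))"
  shows "converges_along K h f \<nu>"
  unfolding converges_along_def by (intro allI impI assms)

lemma converges_along_mono:
  assumes "converges_along K h f \<nu>" "K' \<subseteq> K" "\<nu>' \<subseteq> \<nu>"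
  shows "converges_along K' h f \<nu>'"
proof (rule converges_alongI)
  fix L :: "(complex ^ 'n) set" and a :: "nat ^ 'n" and \<epsilon> :: real assume L: "compact L" "L \<subseteq> T" "\<epsilon> > 0"
  obtain n0 where n0: "\<And>n \<zeta> z. n \<in> \<nu> \<Longrightarrow> n \<ge> n0 \<Longrightarrow> \<zeta> \<in> L \<Longrightarrow> z \<in> K \<Longrightarrow> cmod (mixed_deriv a (PS n f \<zeta>) z - mixed_deriv a h z) < \<epsilon>"
    "\<And>n \<zeta> z. n \<in> \<nu> \<Longrightarrow> n \<ge> n0 \<Longrightarrow> \<zeta> \<in> L \<Longrightarrow> z \<in> L \<Longrightarrow> cmod (mixed_deriv a (PS n f \<zeta>) z - ext a f z) < \<epsilon>"
    using converges_alongD[OF assms(1) L, of a] by metis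
  show "\<exists>n0. \<forall>n\<in>\<nu>'. n \<ge> n0 \<longrightarrow>
    (\<forall>\<zeta>\<in>L. (\<forall>z\<in>K'. cmod (mixed_deriv a (PS n f \<zeta>) z - mixed_deriv a h z) < \<epsilon>) \<and>
           (\<forall>z\<in>L. cmod (mixed_deriv a (PS n f \<zeta>) z - ext a f z) < \<epsilon>))"
    by (intro exI[of _ n0] ballI impI conjI n0) (use assms(2,3) in auto)
qed

lemma converges_along_add:
  assumes "converges_along K h f \<nu>" "converges_along K h' f' \<nu>" and A: "f \<in> A" "f' \<in> A"
    and h: "h \<in> holo_near K" "h' \<in> holo_near K"
  shows "converges_along K (h + h') (f + f') \<nu>"
proof (rule converges_alongI)
  fix L :: "(complex ^ 'n) set" and a :: "nat ^ 'n" and \<epsilon> :: real assume L: "compact L" "L \<subseteq> T" "\<epsilon> > 0"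
  have e2: "\<epsilon>/2 > 0" using L(3) by simp
  obtain n0 where n0: "\<And>n \<zeta> z. n \<in> \<nu> \<Longrightarrow> n \<ge> n0 \<Longrightarrow> \<zeta> \<in> L \<Longrightarrow> z \<in> K \<Longrightarrow> cmod (mixed_deriv a (PS n f \<zeta>) z - mixed_deriv a h z) < \<epsilon>/2"
    "\<And>n \<zeta> z. n \<in> \<nu> \<Longrightarrow> n \<ge> n0 \<Longrightarrow> \<zeta> \<in> L \<Longrightarrow> z \<in> L \<Longrightarrow> cmod (mixed_deriv a (PS n f \<zeta>) z - ext a f z) < \<epsilon>/2"
    using converges_alongD[OF assms(1) L(1,2) e2, of a] by metis
  obtain n1 where n1: "\<And>n \<zeta> z. n \<in> \<nu> \<Longrightarrow> n \<ge> n1 \<Longrightarrow> \<zeta> \<in> L \<Longrightarrow> z \<in> K \<Longrightarrow> cmod (mixed_deriv a (PS n f' \<zeta>) z - mixed_deriv a h' z) < \<epsilon>/2"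
    "\<And>n \<zeta> z. n \<in> \<nu> \<Longrightarrow> n \<ge> n1 \<Longrightarrow> \<zeta> \<in> L \<Longrightarrow> z \<in> L \<Longrightarrow> cmod (mixed_deriv a (PS n f' \<zeta>) z - ext a f' z) < \<epsilon>/2"
    using converges_alongD[OF assms(2) L(1,2) e2, of a] by metis
  have tri: "cmod (x + x' - (y + y')) < \<epsilon>" if "cmod (x - y) < \<epsilon>/2" "cmod (x' - y') < \<epsilon>/2" for x x' y y'
    using norm_triangle_ineq[of "x - y" "x' - y'"] that by (simp add: algebra_simps)
  show "\<exists>n0. \<forall>n\<in>\<nu>. n \<ge> n0 \<longrightarrow>
    (\<forall>\<zeta>\<in>L. (\<forall>z\<in>K. cmod (mixed_deriv a (PS n (f + f') \<zeta>) z - mixed_deriv a (h + h') z) < \<epsilon>) \<and>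
           (\<forall>z\<in>L. cmod (mixed_deriv a (PS n (f + f') \<zeta>) z - ext a (f + f') z) < \<epsilon>))"
  proof (intro exI[of _ "max n0 n1"] ballI impI conjI)
    fix n \<zeta> assume n: "n \<in> \<nu>" "n \<ge> max n0 n1" and \<zeta>: "\<zeta> \<in> L"
    have \<zeta>T: "\<zeta> \<in> T" using \<zeta> L(2) by blast
    have nn: "n \<ge> n0" "n \<ge> n1" using n(2) by auto
    show "cmod (mixed_deriv a (PS n (f + f') \<zeta>) z - mixed_deriv a (h + h') z) < \<epsilon>" if z: "z \<in> K" for z
      unfolding mixed_deriv_PS_add[OF A \<zeta>T] mixed_deriv_holo_near_add[OF h z]
      by (rule tri[OF n0(1)[OF n(1) nn(1) \<zeta> z] n1(1)[OF n(1) nn(2) \<zeta> z]])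
    show "cmod (mixed_deriv a (PS n (f + f') \<zeta>) z - ext a (f + f') z) < \<epsilon>" if z: "z \<in> L" for z
      unfolding mixed_deriv_PS_add[OF A \<zeta>T] ext_add[OF A subsetD[OF L(2) z]]
      by (rule tri[OF n0(2)[OF n(1) nn(1) \<zeta> z] n1(2)[OF n(1) nn(2) \<zeta> z]])
  qed
qed

lemma converges_along_cmult:
  assumes "converges_along K h f \<nu>" and A: "f \<in> A" and h: "h \<in> holo_near K"
  shows "converges_along K (\<lambda>z. c * h z) (\<lambda>z. c * f z) \<nu>"
proof (rule converges_alongI)
  fix L :: "(complex ^ 'n) set" and a :: "nat ^ 'n" and \<epsilon> :: real assume L: "compact L" "L \<subseteq> T" "\<epsilon> > 0"
  have c1: "cmod c + 1 > 0" by (simp add: add_nonneg_pos)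
  then have e2: "\<epsilon> / (cmod c + 1) > 0" using L(3) by simp
  obtain n0 where n0: "\<And>n \<zeta> z. n \<in> \<nu> \<Longrightarrow> n \<ge> n0 \<Longrightarrow> \<zeta> \<in> L \<Longrightarrow> z \<in> K \<Longrightarrow> cmod (mixed_deriv a (PS n f \<zeta>) z - mixed_deriv a h z) < \<epsilon> / (cmod c + 1)"
    "\<And>n \<zeta> z. n \<in> \<nu> \<Longrightarrow> n \<ge> n0 \<Longrightarrow> \<zeta> \<in> L \<Longrightarrow> z \<in> L \<Longrightarrow> cmod (mixed_deriv a (PS n f \<zeta>) z - ext a f z) < \<epsilon> / (cmod c + 1)"
    using converges_alongD[OF assms(1) L(1,2) e2, of a] by metis
  have tri: "cmod (c * x - c * y) < \<epsilon>" if "cmod (x - y) < \<epsilon> / (cmod c + 1)" for x y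
  proof -
    have "cmod (c * x - c * y) = cmod c * cmod (x - y)" by (metis norm_mult right_diff_distrib)
    also have "\<dots> \<le> cmod c * (\<epsilon> / (cmod c + 1))" using that by (intro mult_left_mono) auto
    also have "\<dots> < \<epsilon>" using c1 L(3) by (simp add: field_simps)
    finally show ?thesis .
  qed
  show "\<exists>n0. \<forall>n\<in>\<nu>. n \<ge> n0 \<longrightarrow>
    (\<forall>\<zeta>\<in>L. (\<forall>z\<in>K. cmod (mixed_deriv a (PS n (\<lambda>z. c * f z) \<zeta>) z - mixed_deriv a (\<lambda>z. c * h z) z) < \<epsilon>) \<and>
           (\<forall>z\<in>L. cmod (mixed_deriv a (PS n (\<lambda>z. c * f z) \<zeta>) z - ext a (\<lambda>z. c * f z) z) < \<epsilon>))"
  proof (intro exI[of _ n0] ballI impI conjI)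
    fix n \<zeta> assume n: "n \<in> \<nu>" "n \<ge> n0" and \<zeta>: "\<zeta> \<in> L"
    have \<zeta>T: "\<zeta> \<in> T" using \<zeta> L(2) by blast
    show "cmod (mixed_deriv a (PS n (\<lambda>z. c * f z) \<zeta>) z - mixed_deriv a (\<lambda>z. c * h z) z) < \<epsilon>" if z: "z \<in> K" for z
      unfolding mixed_deriv_PS_cmult[OF A \<zeta>T] mixed_deriv_holo_near_cmult[OF h z]
      by (rule tri[OF n0(1)[OF n \<zeta> z]])
    show "cmod (mixed_deriv a (PS n (\<lambda>z. c * f z) \<zeta>) z - ext a (\<lambda>z. c * f z) z) < \<epsilon>" if z: "z \<in> L" for z
      unfolding mixed_deriv_PS_cmult[OF A \<zeta>T] ext_cmult[OF A subsetD[OF L(2) z]]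
      by (rule tri[OF n0(2)[OF n \<zeta> z]])
  qed
qed

text \<open>Eliminates both metrics: each limit becomes a family of uniform seminorm bounds, and for
  a strictly increasing \<open>l\<close> late positions and large indices are the same
  thing.\<close>

lemma metric_limits_iff:
  assumes K: "compact K" and h: "h \<in> holo_near K" and f: "f \<in> A" and l: "strict_mono l"
  shows "(\<forall>L. compact L \<and> L \<subseteq> T \<longrightarrow>
      (\<lambda>n. SUP \<zeta>\<in>L. ennreal (\<rho> K (germ K (PS (l n) f \<zeta>)) (germ K h))) \<longlonglongrightarrow> 0 \<and>
      (\<lambda>n. SUP \<zeta>\<in>L. ennreal (d (restrict0 \<Omega> (PS (l n) f \<zeta>)) f)) \<longlonglongrightarrow> 0)
    \<longleftrightarrow> converges_along K h f (range l)"
proof -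
  interpret O: seminorm_space "germ K" "holo_near K" "O_seminorms K" "\<rho> K"
    by (rule seminorm_space_O[OF rho_metric[OF K]])
  have o: "(\<lambda>n. SUP \<zeta>\<in>L. ennreal (\<rho> K (germ K (PS (l n) f \<zeta>)) (germ K h))) \<longlonglongrightarrow> 0 \<longleftrightarrow>
      (\<forall>p\<in>O_seminorms K. \<forall>r>0. \<forall>\<^sub>F n in sequentially. \<forall>\<zeta>\<in>L. p (PS (l n) f \<zeta> - h) < ennreal r)" for L
    by (rule O.Sup_metric_tendsto_0_iff) (use PS_polynomial polynomials_holo_near h in blast)+
  have m: "(\<lambda>n. SUP \<zeta>\<in>L. ennreal (d (restrict0 \<Omega> (PS (l n) f \<zeta>)) f)) \<longlonglongrightarrow> 0 \<longleftrightarrow>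
      (\<forall>p\<in>A_inf_seminorms \<Omega> S. \<forall>r>0. \<forall>\<^sub>F n in sequentially. \<forall>\<zeta>\<in>L. p (restrict0 \<Omega> (PS (l n) f \<zeta>) - f) < ennreal r)" for L
    by (rule M.Sup_metric_tendsto_0_iff) (use PS_polynomial restrict0_polynomial f in blast)+
  have o_diff: "mixed_deriv a (PS n f \<zeta> - h) z = mixed_deriv a (PS n f \<zeta>) z - mixed_deriv a h z" if "z \<in> K" for a n \<zeta> z
    by (rule mixed_deriv_holo_near_diff[OF polynomials_holo_near[OF PS_polynomial] h that])
  have m_diff: "ext a (restrict0 \<Omega> (PS n f \<zeta>) - f) z = mixed_deriv a (PS n f \<zeta>) z - ext a f z" if "z \<in> T" for a n \<zeta> z
    by (simp add: ext_diff[OF restrict0_polynomial[OF PS_polynomial] f that] ext_polynomial[OF PS_polynomial that])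
  show ?thesis
  proof
    assume lim: "\<forall>L. compact L \<and> L \<subseteq> T \<longrightarrow>
      (\<lambda>n. SUP \<zeta>\<in>L. ennreal (\<rho> K (germ K (PS (l n) f \<zeta>)) (germ K h))) \<longlonglongrightarrow> 0 \<and>
      (\<lambda>n. SUP \<zeta>\<in>L. ennreal (d (restrict0 \<Omega> (PS (l n) f \<zeta>)) f)) \<longlonglongrightarrow> 0"
    show "converges_along K h f (range l)"
    proof (rule converges_alongI)
      fix L :: "(complex ^ 'n) set" and a :: "nat ^ 'n" and \<epsilon> :: real assume L: "compact L" "L \<subseteq> T" "\<epsilon> > 0"
      note limL = lim[THEN spec, THEN mp, OF conjI[OF L(1,2)]]
      have mem: "(\<lambda>h. sup_on K (mixed_deriv a h)) \<in> O_seminorms K" unfolding O_seminorms_def by blast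
      have 1: "\<forall>\<^sub>F n in sequentially. \<forall>\<zeta>\<in>L. sup_on K (mixed_deriv a (PS (l n) f \<zeta> - h)) < ennreal \<epsilon>"
        by (rule mp[OF spec[OF bspec[OF iffD1[OF o conjunct1[OF limL]] mem]] L(3)])
      have 2: "\<forall>\<^sub>F n in sequentially. \<forall>\<zeta>\<in>L. sup_on L (ext a (restrict0 \<Omega> (PS (l n) f \<zeta>) - f)) < ennreal \<epsilon>"
        by (rule mp[OF spec[OF bspec[OF iffD1[OF m conjunct2[OF limL]] seminorms_I[OF L(1,2)]]] L(3)])
      obtain k0 where k0: "\<And>k. k \<ge> k0 \<Longrightarrow> (\<forall>\<zeta>\<in>L. sup_on K (mixed_deriv a (PS (l k) f \<zeta> - h)) < ennreal \<epsilon>) \<and>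
          (\<forall>\<zeta>\<in>L. sup_on L (ext a (restrict0 \<Omega> (PS (l k) f \<zeta>) - f)) < ennreal \<epsilon>)"
        using eventually_conj[OF 1 2] unfolding eventually_sequentially by blast
      show "\<exists>n0. \<forall>n\<in>range l. n \<ge> n0 \<longrightarrow>
        (\<forall>\<zeta>\<in>L. (\<forall>z\<in>K. cmod (mixed_deriv a (PS n f \<zeta>) z - mixed_deriv a h z) < \<epsilon>) \<and>
           (\<forall>z\<in>L. cmod (mixed_deriv a (PS n f \<zeta>) z - ext a f z) < \<epsilon>))"
      proof (intro exI[of _ "l k0"] ballI impI conjI)
        fix n \<zeta> assume "n \<in> range l" "n \<ge> l k0" and \<zeta>: "\<zeta> \<in> L"
        then obtain k where k: "n = l k" "k \<ge> k0" using strict_mono_less_eq[OF l] by blast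
        note kk = k0[OF k(2)]
        show "cmod (mixed_deriv a (PS n f \<zeta>) z - mixed_deriv a h z) < \<epsilon>" if "z \<in> K" for z
          using sup_on_lessD[OF bspec[OF conjunct1[OF kk] \<zeta>] that] by (simp add: o_diff[OF that] k(1))
        show "cmod (mixed_deriv a (PS n f \<zeta>) z - ext a f z) < \<epsilon>" if "z \<in> L" for z
          using sup_on_lessD[OF bspec[OF conjunct2[OF kk] \<zeta>] that] by (simp add: m_diff[OF subsetD[OF L(2) that]] k(1))
      qed
    qed
  next
    assume conv: "converges_along K h f (range l)"
    show "\<forall>L. compact L \<and> L \<subseteq> T \<longrightarrow>
      (\<lambda>n. SUP \<zeta>\<in>L. ennreal (\<rho> K (germ K (PS (l n) f \<zeta>)) (germ K h))) \<longlonglongrightarrow> 0 \<and>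
      (\<lambda>n. SUP \<zeta>\<in>L. ennreal (d (restrict0 \<Omega> (PS (l n) f \<zeta>)) f)) \<longlonglongrightarrow> 0"
      unfolding o m
    proof (intro allI impI conjI ballI; elim conjE)
      fix L p and r :: real assume L: "compact L" "L \<subseteq> T" and p: "p \<in> O_seminorms K" and r: "r > 0"
      obtain a where a: "p = (\<lambda>h. sup_on K (mixed_deriv a h))" using p by (auto simp: O_seminorms_def)
      have r2: "r/2 > 0" using r by simp
      obtain n0 where n0: "\<And>n \<zeta> z. n \<in> range l \<Longrightarrow> n \<ge> n0 \<Longrightarrow> \<zeta> \<in> L \<Longrightarrow> z \<in> K \<Longrightarrow> cmod (mixed_deriv a (PS n f \<zeta>) z - mixed_deriv a h z) < r/2"
        using converges_alongD[OF conv L r2, of a] by metis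
      show "\<forall>\<^sub>F n in sequentially. \<forall>\<zeta>\<in>L. p (PS (l n) f \<zeta> - h) < ennreal r"
      proof (rule eventually_sequentiallyI[of n0], intro ballI)
        fix k \<zeta> assume "k \<ge> n0" and \<zeta>: "\<zeta> \<in> L"
        then have k: "l k \<ge> n0" using seq_suble[OF l, of k] by simp
        show "p (PS (l k) f \<zeta> - h) < ennreal r"
          unfolding a
        proof (rule sup_on_less[where s = "r/2"])
          show "cmod (mixed_deriv a (PS (l k) f \<zeta> - h) z) \<le> r/2" if "z \<in> K" for z
            using n0[OF rangeI k \<zeta> that] by (simp add: o_diff[OF that])
        qed (use r in auto)
      qed
    next
      fix L p and r :: real assume L: "compact L" "L \<subseteq> T" and p: "p \<in> A_inf_seminorms \<Omega> S" and r: "r > 0"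
      obtain L' a where a: "p = (\<lambda>f. sup_on L' (ext a f))" "compact L'" "L' \<subseteq> T"
        using p by (auto simp: A_inf_seminorms_def)
      have r2: "r/2 > 0" using r by simp
      \<comment> \<open>A seminorm has its own compact set \<open>L'\<close>, while the centres
        range over \<open>L\<close>; the union serves as both.\<close>
      have LL: "compact (L \<union> L')" "L \<union> L' \<subseteq> T" using L a by auto
      obtain n0 where n0: "\<And>n \<zeta> z. n \<in> range l \<Longrightarrow> n \<ge> n0 \<Longrightarrow> \<zeta> \<in> L \<union> L' \<Longrightarrow> z \<in> L \<union> L' \<Longrightarrow> cmod (mixed_deriv a (PS n f \<zeta>) z - ext a f z) < r/2"
        using converges_alongD[OF conv LL r2, of a] by metis
      show "\<forall>\<^sub>F n in sequentially. \<forall>\<zeta>\<in>L. p (restrict0 \<Omega> (PS (l n) f \<zeta>) - f) < ennreal r"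
      proof (rule eventually_sequentiallyI[of n0], intro ballI)
        fix k \<zeta> assume "k \<ge> n0" and \<zeta>: "\<zeta> \<in> L"
        then have k: "l k \<ge> n0" using seq_suble[OF l, of k] by simp
        show "p (restrict0 \<Omega> (PS (l k) f \<zeta>) - f) < ennreal r"
          unfolding a(1)
        proof (rule sup_on_less[where s = "r/2"])
          show "cmod (ext a (restrict0 \<Omega> (PS (l k) f \<zeta>) - f) z) \<le> r/2" if "z \<in> L'" for z
            using n0[OF rangeI k UnI1[OF \<zeta>] UnI2[OF that]] by (simp add: m_diff[OF subsetD[OF a(3) that]])
        qed (use r in auto)
      qed
    qed
  qed
qed

text \<open>An infinite set of naturals is the range of its increasing enumeration, so sequences in
  \<open>\<mu>\<close> can be traded for infinite subsets, which are easier to shrink and to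
  share.\<close>

lemma universal_iff:
  assumes f: "f \<in> A"
  shows "universal \<Omega> S N \<mu> d \<rho> f \<longleftrightarrow>
    (\<forall>K. adm K \<longrightarrow> (\<forall>h\<in>holo_near (cprod K). \<exists>\<nu>\<subseteq>\<mu>. infinite \<nu> \<and> converges_along (cprod K) h f \<nu>))"
proof -
  have *: "(\<exists>l. strict_mono l \<and> range l \<subseteq> \<mu> \<and> (\<forall>L. compact L \<and> L \<subseteq> T \<longrightarrow>
      (\<lambda>n. SUP \<zeta>\<in>L. ennreal (\<rho> (cprod K) (germ (cprod K) (PS (l n) f \<zeta>)) (germ (cprod K) h))) \<longlonglongrightarrow> 0 \<and>
      (\<lambda>n. SUP \<zeta>\<in>L. ennreal (d (restrict0 \<Omega> (PS (l n) f \<zeta>)) f)) \<longlonglongrightarrow> 0))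
    \<longleftrightarrow> (\<exists>\<nu>\<subseteq>\<mu>. infinite \<nu> \<and> converges_along (cprod K) h f \<nu>)" (is "?l \<longleftrightarrow> ?r")
    if "adm K" and h: "h \<in> holo_near (cprod K)" for K h
  proof -
    have K: "compact (cprod K)" using that(1) unfolding adm_def by (intro compact_cprod) blast
    have "?l \<longleftrightarrow> (\<exists>l::nat \<Rightarrow> nat. strict_mono l \<and> range l \<subseteq> \<mu> \<and> converges_along (cprod K) h f (range l))"
      by (intro ex_cong1 conj_cong refl metric_limits_iff[OF K h f])
    also have "\<dots> \<longleftrightarrow> ?r"
    proof
      assume "\<exists>l::nat \<Rightarrow> nat. strict_mono l \<and> range l \<subseteq> \<mu> \<and> converges_along (cprod K) h f (range l)"
      then obtain l :: "nat \<Rightarrow> nat" where l: "strict_mono l" "range l \<subseteq> \<mu>" "converges_along (cprod K) h f (range l)" by blast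
      then show ?r using range_inj_infinite[OF strict_mono_imp_inj_on[OF l(1)]] by blast
    next
      assume ?r
      then obtain \<nu> where \<nu>: "\<nu> \<subseteq> \<mu>" "infinite \<nu>" "converges_along (cprod K) h f \<nu>" by blast
      then show "\<exists>l::nat \<Rightarrow> nat. strict_mono l \<and> range l \<subseteq> \<mu> \<and> converges_along (cprod K) h f (range l)"
        using strict_mono_enumerate[OF \<nu>(2)] range_enumerate[OF \<nu>(2)] by (intro exI[of _ "enumerate \<nu>"]) simp
    qed
    finally show ?thesis .
  qed
  show ?thesis
    unfolding universal_def adm_def[symmetric]
  proof (intro iffI allI impI ballI)
    fix K h
    assume u: "\<forall>K. (\<forall>i. compact (K i) \<and> connected (- K i)) \<longrightarrow>
       cprod K \<inter> cprod (\<lambda>i. \<Omega> i \<union> closure (S i)) = {} \<longrightarrow>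
       (\<forall>h\<in>holo_near (cprod K). \<exists>l. strict_mono l \<and> range l \<subseteq> \<mu> \<and>
         (\<forall>L. compact L \<and> L \<subseteq> T \<longrightarrow>
           (\<lambda>n. SUP \<zeta>\<in>L. ennreal (\<rho> (cprod K) (germ (cprod K) (PS (l n) f \<zeta>)) (germ (cprod K) h))) \<longlonglongrightarrow> 0 \<and>
           (\<lambda>n. SUP \<zeta>\<in>L. ennreal (d (restrict0 \<Omega> (PS (l n) f \<zeta>)) f)) \<longlonglongrightarrow> 0))"
      and K: "adm K" and h: "h \<in> holo_near (cprod K)"
    show "\<exists>\<nu>\<subseteq>\<mu>. infinite \<nu> \<and> converges_along (cprod K) h f \<nu>"
      using u[rule_format, of K h] K h unfolding *[OF K h, symmetric] adm_def by simp
  next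
    fix K h
    assume u: "\<forall>K. adm K \<longrightarrow> (\<forall>h\<in>holo_near (cprod K). \<exists>\<nu>\<subseteq>\<mu>. infinite \<nu> \<and> converges_along (cprod K) h f \<nu>)"
      and K: "\<forall>i. compact (K i) \<and> connected (- K i)" "cprod K \<inter> cprod (\<lambda>i. \<Omega> i \<union> closure (S i)) = {}"
      and h: "h \<in> holo_near (cprod K)"
    have "adm K" using K unfolding adm_def by blast
    then show "\<exists>l. strict_mono l \<and> range l \<subseteq> \<mu> \<and> (\<forall>L. compact L \<and> L \<subseteq> T \<longrightarrow>
      (\<lambda>n. SUP \<zeta>\<in>L. ennreal (\<rho> (cprod K) (germ (cprod K) (PS (l n) f \<zeta>)) (germ (cprod K) h))) \<longlonglongrightarrow> 0 \<and>
      (\<lambda>n. SUP \<zeta>\<in>L. ennreal (d (restrict0 \<Omega> (PS (l n) f \<zeta>)) f)) \<longlonglongrightarrow> 0)"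
      unfolding *[OF \<open>adm K\<close> h] using u h by blast
  qed
qed

text \<open>The complement of \<open>\<Omega> i0 \<union> S i0\<close> is the connected unbounded
  set of \<open>polynomial_separation\<close>: it contains \<open>K i0\<close> and misses the
  projection of \<open>L\<close>.\<close>

lemma separation_adm:
  assumes K: "adm K" and L: "compact L" "L \<subseteq> T" and p: "p \<in> polynomials" and q: "q \<in> polynomials"
    and B: "finite B" and e: "\<epsilon> > 0"
  shows "\<exists>P\<in>polynomials. \<forall>a\<in>B. (\<forall>z\<in>cprod K. cmod (mixed_deriv a P z - mixed_deriv a q z) < \<epsilon>) \<and>
    (\<forall>z\<in>L. cmod (mixed_deriv a P z - mixed_deriv a p z) < \<epsilon>)"
proof -
  obtain i0 where i0: "K i0 \<inter> (\<Omega> i0 \<union> closure (S i0)) = {}" using adm_factor[OF K] by blast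
  show ?thesis
  proof (cases "bounded (- (\<Omega> i0 \<union> S i0))")
    case True
    \<comment> \<open>A bounded complement makes \<open>\<Omega> i0 \<union> closure (S i0)\<close>
      the whole plane, so the product is empty and \<open>p\<close> itself can be taken.\<close>
    then have "K i0 = {}" using bounded_compl i0 by auto
    then have "cprod K = {}" unfolding cprod_def by auto
    then show ?thesis using p e by (intro bexI[of _ p]) auto
  next
    case False
    have Kc: "\<And>i. compact (K i)" "connected (- K i0)" using K unfolding adm_def by auto
    have "S i0 \<subseteq> closure (S i0)" by (rule closure_subset)
    then have sub: "K i0 \<subseteq> - (\<Omega> i0 \<union> S i0)" using i0 by blast
    have out: "z $ i0 \<notin> - (\<Omega> i0 \<union> S i0)" if "z \<in> L" for z
    proof -
      have "z \<in> T" using that L(2) by blast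
      then show ?thesis unfolding cprod_def by simp
    qed
    show ?thesis
      by (rule polynomial_separation[of K i0 L "- (\<Omega> i0 \<union> S i0)", OF Kc L(1) connected_compl False sub out p q B e])
  qed
qed

text \<open>Enlarging the compact set and adding orders only strengthens an estimate; a metric
  neighbourhood can thus be handed to the separation lemma as one pair \<open>L\<close>,
  \<open>B\<close>.\<close>

lemma finite_seminorms:
  assumes "finite F" "F \<subseteq> A_inf_seminorms \<Omega> S"
  shows "\<exists>L B. compact L \<and> L \<subseteq> T \<and> finite B \<and> (\<forall>p\<in>F. \<exists>L0 a. p = (\<lambda>f. sup_on L0 (ext a f)) \<and> L0 \<subseteq> L \<and> a \<in> B)"
  using assms
proof induction
  case empty
  show ?case by (intro exI[of _ "{}"]) auto
next
  case (insert p F)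
  obtain L B where L: "compact L" "L \<subseteq> T" "finite B" "\<forall>p\<in>F. \<exists>L0 a. p = (\<lambda>f. sup_on L0 (ext a f)) \<and> L0 \<subseteq> L \<and> a \<in> B"
    using insert.IH insert.prems by blast
  obtain L1 a1 where 1: "p = (\<lambda>f. sup_on L1 (ext a1 f))" "compact L1" "L1 \<subseteq> T"
    using insert.prems unfolding A_inf_seminorms_def by blast
  show ?case
  proof (rule exI[of _ "L \<union> L1"], rule exI[of _ "insert a1 B"], intro conjI ballI)
    fix q assume "q \<in> insert p F"
    then consider "q = p" | "q \<in> F" by blast
    then show "\<exists>L0 a. q = (\<lambda>f. sup_on L0 (ext a f)) \<and> L0 \<subseteq> L \<union> L1 \<and> a \<in> insert a1 B"
    proof cases
      case 1
      then show ?thesis using \<open>p = (\<lambda>f. sup_on L1 (ext a1 f))\<close> by (intro exI[of _ L1] exI[of _ a1]) auto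
    next
      case 2
      then obtain L0 a where "q = (\<lambda>f. sup_on L0 (ext a f))" "L0 \<subseteq> L" "a \<in> B" using L(4) by blast
      then show ?thesis by (intro exI[of _ L0] exI[of _ a]) auto
    qed
  qed (use L 1 in auto)
qed

end

section \<open>Category argument with countable test families\<close>

locale universal_setting = taylor_setting \<Omega> S N d \<rho>
  for \<Omega> S :: "'n::finite \<Rightarrow> complex set" and N d \<rho> +
  fixes Ls :: "nat \<Rightarrow> (complex ^ 'n) set" and Q :: "(complex ^ 'n \<Rightarrow> complex) set" and KK :: "nat \<Rightarrow> 'n \<Rightarrow> complex set"
  assumes Ls_compact: "\<And>s. compact (Ls s)" and Ls_T: "\<And>s. Ls s \<subseteq> T"
    and Ls_exhaust: "\<And>L. compact L \<Longrightarrow> L \<subseteq> T \<Longrightarrow> \<exists>s0. \<forall>s\<ge>s0. L \<subseteq> Ls s"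
    and Q_countable: "countable Q" and Q_nonempty: "Q \<noteq> {}" and Q_polynomials: "Q \<subseteq> polynomials"
    and Q_dense: "\<And>p K B \<epsilon>. p \<in> polynomials \<Longrightarrow> compact K \<Longrightarrow> finite B \<Longrightarrow> \<epsilon> > 0 \<Longrightarrow>
      \<exists>q\<in>Q. \<forall>a\<in>B. \<forall>z\<in>K. cmod (mixed_deriv a q z - mixed_deriv a p z) < \<epsilon>"
    and KK_adm: "\<And>m. adm (KK m)" and KK_exhaust: "\<And>K. adm K \<Longrightarrow> \<exists>m. \<forall>i. K i \<subseteq> KK m i"
begin

text \<open>One number \<open>s\<close> limits the centres, the points of comparison in
  \<open>T\<close> and the orders of differentiation, so that letting \<open>s\<close> grow exhausts
  all of them together.\<close>

definition near :: "(complex ^ 'n) set \<Rightarrow> (complex ^ 'n \<Rightarrow> complex) \<Rightarrow> nat \<Rightarrow> nat \<Rightarrow> real \<Rightarrow> (complex ^ 'n \<Rightarrow> complex) \<Rightarrow> bool" where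
  "near K q s n r f \<longleftrightarrow> (\<forall>\<zeta>\<in>Ls s. \<forall>a\<in>degree_box s.
     (\<forall>z\<in>K. cmod (mixed_deriv a (PS n f \<zeta>) z - mixed_deriv a q z) \<le> r) \<and>
     (\<forall>z\<in>Ls s. cmod (mixed_deriv a (PS n f \<zeta>) z - ext a f z) \<le> r))"

text \<open>The gap between \<open>r\<close> and \<open>1 / real (Suc s)\<close> makes the set open,
  and \<open>n \<ge> s\<close> makes the indices found for growing \<open>s\<close>
  unbounded.\<close>

definition approximants :: "nat set \<Rightarrow> (complex ^ 'n) set \<Rightarrow> (complex ^ 'n \<Rightarrow> complex) \<Rightarrow> nat \<Rightarrow> (complex ^ 'n \<Rightarrow> complex) set" where
  "approximants \<nu> K q s = {f \<in> X. \<exists>n\<in>\<nu>. n \<ge> s \<and> (\<exists>r < 1 / real (Suc s). near K q s n r f)}"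

lemma near_perturb:
  assumes "compact K" "f \<in> A" "near K q s n r f" "r < R"
  shows "\<exists>\<eta>>0. \<forall>g\<in>A. d f g < \<eta> \<longrightarrow> (\<exists>r<R. near K q s n r g)"
proof -
  \<comment> \<open>Passing from \<open>f\<close> to \<open>g\<close> costs at most
    \<open>\<delta>\<close> in the partial sum and \<open>\<delta>\<close> in the extension, so the
    new bound \<open>r + 2 * \<delta>\<close> still lies below \<open>R\<close>.\<close>
  define \<delta> where "\<delta> = (R - r) / 3"
  have \<delta>: "\<delta> > 0" using assms(4) by (simp add: \<delta>_def)
  have \<delta>R: "r + 2 * \<delta> < R" using assms(4) unfolding \<delta>_def by argo
  obtain \<eta>1 where \<eta>1: "\<eta>1 > 0" "\<forall>f\<in>A. \<forall>g\<in>A. d f g < \<eta>1 \<longrightarrow> (\<forall>\<zeta>\<in>Ls s. \<forall>a\<in>degree_box s. \<forall>z\<in>K \<union> Ls s.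
    cmod (mixed_deriv a (PS n f \<zeta>) z - mixed_deriv a (PS n g \<zeta>) z) \<le> \<delta>)"
    using PS_perturb[OF Ls_compact[of s] Ls_T[of s] compact_Un[OF assms(1) Ls_compact[of s]] finite_degree_box[of s] \<delta>, of n]
    by (rule exE) blast
  define F where "F = (\<lambda>a f. sup_on (Ls s) (ext a f)) ` degree_box s"
  have F: "finite F" "F \<subseteq> A_inf_seminorms \<Omega> S"
    unfolding F_def using finite_degree_box seminorms_I[OF Ls_compact Ls_T] by auto
  obtain \<eta>2 where \<eta>2: "\<eta>2 > 0" "\<forall>f\<in>A. \<forall>g\<in>A. d f g < \<eta>2 \<longrightarrow> (\<forall>p\<in>F. p (f - g) < ennreal \<delta>)"
    using M.metric_imp_seminorms[OF F \<delta>] by blast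
  have "near K q s n (r + 2 * \<delta>) g" if g: "g \<in> A" "d f g < \<eta>1" "d f g < \<eta>2" for g
    unfolding near_def
  proof (intro ballI conjI)
    fix \<zeta> and a :: "nat ^ 'n" assume \<zeta>: "\<zeta> \<in> Ls s" and a: "a \<in> degree_box s"
    have 1: "cmod (mixed_deriv a (PS n f \<zeta>) z - mixed_deriv a (PS n g \<zeta>) z) \<le> \<delta>" if "z \<in> K \<union> Ls s" for z
      using \<eta>1(2)[rule_format, OF assms(2) g(1,2) \<zeta> a that] .
    have mem: "(\<lambda>f. sup_on (Ls s) (ext a f)) \<in> F" unfolding F_def using a by blast
    have "sup_on (Ls s) (ext a (f - g)) < ennreal \<delta>"
      by (rule \<eta>2(2)[rule_format, OF assms(2) g(1,3) mem])
    then have 2: "cmod (ext a f z - ext a g z) \<le> \<delta>" if "z \<in> Ls s" for z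
      using sup_on_lessD[of "Ls s" _ \<delta> z] that ext_diff[OF assms(2) g(1) subsetD[OF Ls_T that], of a] by fastforce
    show "cmod (mixed_deriv a (PS n g \<zeta>) z - mixed_deriv a q z) \<le> r + 2 * \<delta>" if z: "z \<in> K" for z
    proof -
      have "cmod (mixed_deriv a (PS n f \<zeta>) z - mixed_deriv a q z) \<le> r"
        using assms(3) \<zeta> a z unfolding near_def by blast
      then show ?thesis
        using 1[OF UnI1[OF z]] \<delta>
          norm_triangle_ineq[of "mixed_deriv a (PS n g \<zeta>) z - mixed_deriv a (PS n f \<zeta>) z" "mixed_deriv a (PS n f \<zeta>) z - mixed_deriv a q z"]
        by (simp add: norm_minus_commute)
    qed
    show "cmod (mixed_deriv a (PS n g \<zeta>) z - ext a g z) \<le> r + 2 * \<delta>" if z: "z \<in> Ls s" for z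
    proof -
      have "cmod (mixed_deriv a (PS n f \<zeta>) z - ext a f z) \<le> r"
        using assms(3) \<zeta> a z unfolding near_def by blast
      then show ?thesis
        using 1[OF UnI2[OF z]] 2[OF z]
          norm_triangle_ineq[of "mixed_deriv a (PS n g \<zeta>) z - mixed_deriv a (PS n f \<zeta>) z" "mixed_deriv a (PS n f \<zeta>) z - ext a f z"]
          norm_triangle_ineq[of "mixed_deriv a (PS n g \<zeta>) z - ext a f z" "ext a f z - ext a g z"]
        by (simp add: norm_minus_commute)
    qed
  qed
  then show ?thesis
    using \<eta>1(1) \<eta>2(1) \<delta>R by (intro exI[of _ "min \<eta>1 \<eta>2"]) auto
qed

lemma openin_approximants:
  assumes "compact K"
  shows "openin XT (approximants \<nu> K q s)"
proof -
  define U where "U = {f \<in> A. \<exists>n\<in>\<nu>. n \<ge> s \<and> (\<exists>r < 1 / real (Suc s). near K q s n r f)}"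
  have "openin MA.mtopology U"
    unfolding MA.openin_mtopology
  proof (intro conjI allI impI)
    show "U \<subseteq> A" unfolding U_def by blast
    fix f assume "f \<in> U"
    then obtain n r where f: "f \<in> A" "n \<in> \<nu>" "n \<ge> s" "r < 1 / real (Suc s)" "near K q s n r f"
      unfolding U_def by blast
    obtain \<eta> where \<eta>: "\<eta> > 0" "\<forall>g\<in>A. d f g < \<eta> \<longrightarrow> (\<exists>r<1 / real (Suc s). near K q s n r g)"
      using near_perturb[OF assms f(1,5,4)] by blast
    have "MA.mball f \<eta> \<subseteq> U"
    proof
      fix g assume "g \<in> MA.mball f \<eta>"
      then have "g \<in> A" "d f g < \<eta>" by auto
      then show "g \<in> U" unfolding U_def using \<eta>(2) f(2,3) by blast
    qed
    then show "\<exists>r>0. MA.mball f r \<subseteq> U" using \<eta>(1) by blast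
  qed
  moreover have "approximants \<nu> K q s = U \<inter> X"
    unfolding approximants_def U_def using X_subset_A by blast
  ultimately show ?thesis
    unfolding X_inf_topology_def A_topology openin_subtopology by blast
qed

text \<open>A polynomial \<open>P\<close> near \<open>p\<close> on \<open>L\<close> and near
  \<open>q\<close> on the product equals its own partial sums from some index on. The comparison
  with the extension is then exact, and the one with \<open>q\<close> is inherited from
  \<open>P\<close>; an infinite \<open>\<nu>\<close> contains a sufficiently large index.\<close>

lemma approximants_dense:
  assumes K: "adm K" and \<nu>: "infinite \<nu>" and q: "q \<in> polynomials"
  shows "XT closure_of (approximants \<nu> (cprod K) q s) = X"
proof (rule dense_in_X)
  show "approximants \<nu> (cprod K) q s \<subseteq> X" unfolding approximants_def by blast
  fix p :: "complex ^ 'n \<Rightarrow> complex" and \<epsilon> :: real assume p: "p \<in> polynomials" and "\<epsilon> > 0"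
  obtain F r where F: "finite F" "F \<subseteq> A_inf_seminorms \<Omega> S" "r > 0"
    "\<forall>f\<in>A. \<forall>g\<in>A. (\<forall>p\<in>F. p (f - g) < ennreal r) \<longrightarrow> d f g < \<epsilon>"
    using M.seminorm_imp_metric[OF \<open>\<epsilon> > 0\<close>] by blast
  obtain L B where L: "compact L" "L \<subseteq> T" "finite B"
    "\<forall>p\<in>F. \<exists>L0 a. p = (\<lambda>f. sup_on L0 (ext a f)) \<and> L0 \<subseteq> L \<and> a \<in> B"
    using finite_seminorms[OF F(1,2)] by blast
  \<comment> \<open>The first bound serves closeness to \<open>p\<close> in the metric, the second
    leaves a strict gap below \<open>1 / real (Suc s)\<close>.\<close>
  define e where "e = min (r/2) (1 / (2 * real (Suc s)))"
  have e: "e > 0" "e \<le> r/2" "e < 1 / real (Suc s)" using F(3) by (auto simp: e_def field_simps min_def)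
  obtain P where P: "P \<in> polynomials" "\<forall>a\<in>B \<union> degree_box s. (\<forall>z\<in>cprod K. cmod (mixed_deriv a P z - mixed_deriv a q z) < e) \<and>
    (\<forall>z\<in>L. cmod (mixed_deriv a P z - mixed_deriv a p z) < e)"
    using separation_adm[OF K L(1,2) p q _ e(1), of "B \<union> degree_box s"] L(3) finite_degree_box by blast
  have A: "restrict0 \<Omega> p \<in> A" "restrict0 \<Omega> P \<in> A" using p P(1) restrict0_polynomial by auto
  have "t (restrict0 \<Omega> p - restrict0 \<Omega> P) < ennreal r" if t: "t \<in> F" for t
  proof -
    obtain L0 a where La: "t = (\<lambda>f. sup_on L0 (ext a f))" "L0 \<subseteq> L" "a \<in> B" using L(4) t by blast
    show ?thesis
      unfolding La(1)
    proof (rule sup_on_less[where s = "r/2"])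
      fix z assume "z \<in> L0"
      then have z: "z \<in> L" using La(2) by blast
      then have zT: "z \<in> T" using L(2) by blast
      have "cmod (mixed_deriv a P z - mixed_deriv a p z) < e" using P(2) La(3) z by blast
      then show "cmod (ext a (restrict0 \<Omega> p - restrict0 \<Omega> P) z) \<le> r/2"
        using e(2) by (simp add: ext_diff[OF A zT] ext_polynomial[OF p zT] ext_polynomial[OF P(1) zT] norm_minus_commute)
    qed (use F(3) in auto)
  qed
  then have "d (restrict0 \<Omega> p) (restrict0 \<Omega> P) < \<epsilon>" using F(4) A by blast
  moreover have "restrict0 \<Omega> P \<in> approximants \<nu> (cprod K) q s"
  proof -
    obtain n0 where n0: "\<forall>n\<ge>n0. \<forall>\<zeta>\<in>T. PS n (restrict0 \<Omega> P) \<zeta> = P" using PS_restrict0[OF P(1)] by blast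
    obtain n where n: "n \<in> \<nu>" "n \<ge> max n0 s" using \<nu> unfolding infinite_nat_iff_unbounded_le by blast
    have "near (cprod K) q s n e (restrict0 \<Omega> P)"
      unfolding near_def
    proof (intro ballI conjI)
      fix \<zeta> and a :: "nat ^ 'n" assume \<zeta>: "\<zeta> \<in> Ls s" and a: "a \<in> degree_box s"
      have "\<zeta> \<in> T" using \<zeta> Ls_T by blast
      then have PS: "PS n (restrict0 \<Omega> P) \<zeta> = P" using n0 n(2) by auto
      show "cmod (mixed_deriv a (PS n (restrict0 \<Omega> P) \<zeta>) z - mixed_deriv a q z) \<le> e" if "z \<in> cprod K" for z
        unfolding PS using P(2) a that by (meson UnI2 less_imp_le)
      show "cmod (mixed_deriv a (PS n (restrict0 \<Omega> P) \<zeta>) z - ext a (restrict0 \<Omega> P) z) \<le> e" if "z \<in> Ls s" for z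
        unfolding PS using e(1) by (simp add: ext_polynomial[OF P(1) subsetD[OF Ls_T that]])
    qed
    then show ?thesis
      unfolding approximants_def using polynomial_in_X[OF P(1)] n e(3) by auto
  qed
  ultimately show "\<exists>g\<in>approximants \<nu> (cprod K) q s. d (restrict0 \<Omega> p) g < \<epsilon>" by blast
qed

lemma converges_along_imp_approximants:
  assumes f: "f \<in> X" and "converges_along K q f \<nu>" "infinite \<nu>" "\<nu> \<subseteq> \<mu>"
  shows "f \<in> approximants \<mu> K q s"
proof -
  define r where "r = 1 / (2 * real (Suc s))"
  have r: "r > 0" "r < 1 / real (Suc s)" by (auto simp: r_def field_simps)
  have "\<exists>n0. \<forall>n\<in>\<nu>. n \<ge> n0 \<longrightarrow> (\<forall>\<zeta>\<in>Ls s. (\<forall>z\<in>K. cmod (mixed_deriv a (PS n f \<zeta>) z - mixed_deriv a q z) < r) \<and>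
      (\<forall>z\<in>Ls s. cmod (mixed_deriv a (PS n f \<zeta>) z - ext a f z) < r))" for a
    using assms(2) Ls_compact Ls_T r(1) unfolding converges_along_def by blast
  then obtain n0 where n0: "\<And>a n. n \<in> \<nu> \<Longrightarrow> n \<ge> n0 a \<Longrightarrow> (\<forall>\<zeta>\<in>Ls s. (\<forall>z\<in>K. cmod (mixed_deriv a (PS n f \<zeta>) z - mixed_deriv a q z) < r) \<and>
      (\<forall>z\<in>Ls s. cmod (mixed_deriv a (PS n f \<zeta>) z - ext a f z) < r))"
    by metis
  \<comment> \<open>A sum of naturals dominates each of its terms, which replaces a maximum over the
    box; adding \<open>s\<close> secures \<open>n \<ge> s\<close>.\<close>
  define n1 where "n1 = (\<Sum>a\<in>degree_box s. n0 a) + s"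
  obtain n where n: "n \<in> \<nu>" "n \<ge> n1" using assms(3) unfolding infinite_nat_iff_unbounded_le by blast
  have sn: "n \<ge> s" using n(2) unfolding n1_def by linarith
  have ge: "n \<ge> n0 a" if "a \<in> degree_box s" for a
  proof -
    have "n0 a \<le> (\<Sum>a\<in>degree_box s. n0 a)"
      by (rule member_le_sum[OF that]) (simp_all add: finite_degree_box)
    then show ?thesis using n(2) unfolding n1_def by linarith
  qed
  have "near K q s n r f"
    unfolding near_def
  proof (intro ballI)
    fix \<zeta> and a :: "nat ^ 'n" assume \<zeta>: "\<zeta> \<in> Ls s" and a: "a \<in> degree_box s"
    show "(\<forall>z\<in>K. cmod (mixed_deriv a (PS n f \<zeta>) z - mixed_deriv a q z) \<le> r) \<and>
      (\<forall>z\<in>Ls s. cmod (mixed_deriv a (PS n f \<zeta>) z - ext a f z) \<le> r)"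
      using n0[OF n(1) ge[OF a]] \<zeta> by (simp add: less_imp_le)
  qed
  then show ?thesis
    unfolding approximants_def using f n(1) assms(4) r(2) sn by blast
qed

text \<open>The germ \<open>h\<close> may fail to extend to \<open>KK m\<close>, so it is replaced
  on \<open>K\<close> by polynomials \<open>q s\<close> from \<open>Q\<close>, accurate to
  \<open>1 / real (Suc s)\<close> in the derivatives indexed by \<open>degree_box s\<close>. The
  index supplied for \<open>q s\<close> at level \<open>s\<close> then follows \<open>h\<close> with
  an error below twice that amount.\<close>

lemma approximants_imp_converges_along:
  assumes K: "adm K" "\<And>i. K i \<subseteq> KK m i" and h: "h \<in> holo_near (cprod K)"
    and f: "\<And>q s. q \<in> Q \<Longrightarrow> f \<in> approximants \<mu> (cprod (KK m)) q s"
  shows "\<exists>\<nu>\<subseteq>\<mu>. infinite \<nu> \<and> converges_along (cprod K) h f \<nu>"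
proof -
  have Kc: "\<And>i. compact (K i)" "\<And>i. connected (- K i)" using K(1) unfolding adm_def by auto
  have sub: "cprod K \<subseteq> cprod (KK m)" using K(2) by (rule cprod_mono)
  have "\<exists>q\<in>Q. \<forall>a\<in>degree_box s. \<forall>z\<in>cprod K. cmod (mixed_deriv a q z - mixed_deriv a h z) < 1 / real (Suc s)" for s
  proof -
    define e where "e = 1 / (2 * real (Suc s))"
    have e: "e > 0" "e + e = 1 / real (Suc s)" by (auto simp: e_def field_simps)
    obtain p where p: "p \<in> polynomials" "\<forall>a\<in>degree_box s. \<forall>z\<in>cprod K. cmod (mixed_deriv a p z - mixed_deriv a h z) < e"
      using holo_near_approx[OF Kc h finite_degree_box e(1)] by blast
    obtain q where q: "q \<in> Q" "\<forall>a\<in>degree_box s. \<forall>z\<in>cprod K. cmod (mixed_deriv a q z - mixed_deriv a p z) < e"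
      using Q_dense[OF p(1) compact_cprod[of K, OF Kc(1)] finite_degree_box e(1)] by blast
    have "cmod (mixed_deriv a q z - mixed_deriv a h z) < 1 / real (Suc s)" if "a \<in> degree_box s" "z \<in> cprod K" for a z
    proof -
      have "cmod (mixed_deriv a q z - mixed_deriv a p z) < e" "cmod (mixed_deriv a p z - mixed_deriv a h z) < e"
        using p(2) q(2) that by blast+
      then show ?thesis
        using norm_triangle_ineq[of "mixed_deriv a q z - mixed_deriv a p z" "mixed_deriv a p z - mixed_deriv a h z"] e(2)
        by simp
    qed
    then show ?thesis using q(1) by blast
  qed
  then obtain q where q: "\<And>s. q s \<in> Q" "\<And>s a z. a \<in> degree_box s \<Longrightarrow> z \<in> cprod K \<Longrightarrow> cmod (mixed_deriv a (q s) z - mixed_deriv a h z) < 1 / real (Suc s)"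
    by metis
  have "\<exists>n\<in>\<mu>. n \<ge> s \<and> (\<exists>r < 1 / real (Suc s). near (cprod (KK m)) (q s) s n r f)" for s
    using f[OF q(1), of s s] unfolding approximants_def by blast
  then obtain n r where n: "\<And>s. n s \<in> \<mu>" "\<And>s. n s \<ge> s" "\<And>s. r s < 1 / real (Suc s)" "\<And>s. near (cprod (KK m)) (q s) s (n s) (r s) f"
    by metis
  have "infinite (range n)"
    unfolding infinite_nat_iff_unbounded_le using n(2) by blast
  moreover have "converges_along (cprod K) h f (range n)"
  proof (rule converges_alongI)
    fix L :: "(complex ^ 'n) set" and a :: "nat ^ 'n" and \<epsilon> :: real assume L: "compact L" "L \<subseteq> T" "\<epsilon> > 0"
    obtain s1 where s1: "\<And>s. s \<ge> s1 \<Longrightarrow> L \<subseteq> Ls s" using Ls_exhaust[OF L(1,2)] by blast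
    obtain s2 where s2: "\<And>s. s \<ge> s2 \<Longrightarrow> a \<in> degree_box s" using degree_box_exhaust[of a] by blast
    obtain s3 where s3: "1 / real (Suc s3) < \<epsilon>/2" using nat_approx_posE[of "\<epsilon>/2"] L(3) by auto
    define s0 where "s0 = max s1 (max s2 s3)"
    \<comment> \<open>This exceeds every \<open>n s\<close> with \<open>s < s0\<close>, so an index
      \<open>k \<ge> n0\<close> in the range comes from some \<open>s \<ge> s0\<close> even though
      \<open>n\<close> need not be monotone.\<close>
    define n0 where "n0 = Suc (\<Sum>s<s0. n s)"
    show "\<exists>n0. \<forall>k\<in>range n. k \<ge> n0 \<longrightarrow>
      (\<forall>\<zeta>\<in>L. (\<forall>z\<in>cprod K. cmod (mixed_deriv a (PS k f \<zeta>) z - mixed_deriv a h z) < \<epsilon>) \<and>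
         (\<forall>z\<in>L. cmod (mixed_deriv a (PS k f \<zeta>) z - ext a f z) < \<epsilon>))"
    proof (intro exI[of _ n0] ballI impI)
      fix k \<zeta> assume "k \<in> range n" and kn: "k \<ge> n0" and \<zeta>: "\<zeta> \<in> L"
      then obtain s where s: "k = n s" by blast
      have "s \<ge> s0"
      proof (rule ccontr)
        assume "\<not> s \<ge> s0"
        then have "n s \<le> (\<Sum>s<s0. n s)" by (intro member_le_sum) auto
        then show False using kn s unfolding n0_def by simp
      qed
      then have ss: "s \<ge> s1" "s \<ge> s2" "s \<ge> s3" unfolding s0_def by auto
      have "1 / real (Suc s) \<le> 1 / real (Suc s3)" using ss(3) by (simp add: frac_le)
      then have small: "1 / real (Suc s) < \<epsilon>/2" using s3 by simp
      have \<zeta>s: "\<zeta> \<in> Ls s" using \<zeta> s1[OF ss(1)] by blast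
      have nr: "\<forall>z\<in>cprod (KK m). cmod (mixed_deriv a (PS k f \<zeta>) z - mixed_deriv a (q s) z) \<le> r s"
        "\<forall>z\<in>Ls s. cmod (mixed_deriv a (PS k f \<zeta>) z - ext a f z) \<le> r s"
        using n(4)[of s] \<zeta>s s2[OF ss(2)] unfolding near_def s by blast+
      show "(\<forall>z\<in>cprod K. cmod (mixed_deriv a (PS k f \<zeta>) z - mixed_deriv a h z) < \<epsilon>) \<and>
         (\<forall>z\<in>L. cmod (mixed_deriv a (PS k f \<zeta>) z - ext a f z) < \<epsilon>)"
      proof (intro conjI ballI)
        fix z assume z: "z \<in> cprod K"
        have "cmod (mixed_deriv a (PS k f \<zeta>) z - mixed_deriv a (q s) z) \<le> r s" using nr(1) z sub by blast
        then show "cmod (mixed_deriv a (PS k f \<zeta>) z - mixed_deriv a h z) < \<epsilon>"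
          using q(2)[OF s2[OF ss(2)] z] n(3)[of s] small
            norm_triangle_ineq[of "mixed_deriv a (PS k f \<zeta>) z - mixed_deriv a (q s) z" "mixed_deriv a (q s) z - mixed_deriv a h z"]
          by simp
      next
        fix z assume "z \<in> L"
        then have "cmod (mixed_deriv a (PS k f \<zeta>) z - ext a f z) \<le> r s" using nr(2) s1[OF ss(1)] by blast
        then show "cmod (mixed_deriv a (PS k f \<zeta>) z - ext a f z) < \<epsilon>"
          using n(3)[of s] small L(3) by linarith
      qed
    qed
  qed
  moreover have "range n \<subseteq> \<mu>" using n(1) by blast
  ultimately show ?thesis by blast
qed

text \<open>The index set may vary with the product \<open>KK m\<close>, because the chain of
  universal functions thins the indices separately for each product.\<close>

definition residual :: "(nat \<Rightarrow> nat set) \<Rightarrow> (complex ^ 'n \<Rightarrow> complex) set set" where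
  "residual \<nu> = (\<lambda>(m, q, s). approximants (\<nu> m) (cprod (KK m)) q s) ` (UNIV \<times> Q \<times> UNIV)"

lemma mem_Inter_residual:
  "f \<in> \<Inter>(residual \<nu>) \<longleftrightarrow> (\<forall>m. \<forall>q\<in>Q. \<forall>s. f \<in> approximants (\<nu> m) (cprod (KK m)) q s)"
  unfolding residual_def by auto

lemma Inter_residual_subset_X: "\<Inter>(residual \<nu>) \<subseteq> X"
proof
  fix f assume "f \<in> \<Inter>(residual \<nu>)"
  then obtain q where "f \<in> approximants (\<nu> 0) (cprod (KK 0)) q 0"
    using Q_nonempty unfolding mem_Inter_residual by blast
  then show "f \<in> X" unfolding approximants_def by blast
qed

lemma residual_props:
  shows "countable (residual \<nu>)" "residual \<nu> \<noteq> {}" "\<And>U. U \<in> residual \<nu> \<Longrightarrow> openin XT U"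
proof -
  show "countable (residual \<nu>)" unfolding residual_def using Q_countable by simp
  show "residual \<nu> \<noteq> {}" unfolding residual_def using Q_nonempty by auto
  have "compact (cprod (KK m))" for m using KK_adm unfolding adm_def by (intro compact_cprod) blast
  then show "openin XT U" if "U \<in> residual \<nu>" for U
    using that unfolding residual_def by (auto intro: openin_approximants)
qed

lemma residual_dense:
  assumes "\<And>m. infinite (\<nu> m)"
  shows "XT closure_of (\<Inter>(residual \<nu>)) = X"
proof -
  have "XT closure_of (\<Inter>(residual \<nu>)) = topspace XT"
  proof (rule Baire_category)
    show "completely_metrizable_space XT \<or> locally_compact_space XT \<and> regular_space XT"
      using completely_metrizable_X by blast
    show "countable (residual \<nu>)" by (rule residual_props)
    show "openin XT U \<and> XT closure_of U = topspace XT" if Ures: "U \<in> residual \<nu>" for U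
    proof
      show "openin XT U" using Ures by (rule residual_props)
      obtain m q s where U: "U = approximants (\<nu> m) (cprod (KK m)) q s" "q \<in> Q"
        using Ures unfolding residual_def by auto
      show "XT closure_of U = topspace XT"
        unfolding U(1) topspace_X by (rule approximants_dense[OF KK_adm assms subsetD[OF Q_polynomials U(2)]])
    qed
  qed
  then show ?thesis by (simp add: topspace_X)
qed

text \<open>One inclusion tests universality on the polynomials of \<open>Q\<close>; the other
  passes from these tests to arbitrary germs on smaller products. The right-hand side shows at once
  the \<open>G\<^sub>\<delta>\<close> property and, by Baire's theorem, density.\<close>

lemma universal_eq_residual: "{f \<in> X. universal \<Omega> S N \<mu> d \<rho> f} = \<Inter>(residual (\<lambda>_. \<mu>))"
proof (intro equalityI subsetI)
  fix f assume "f \<in> {f \<in> X. universal \<Omega> S N \<mu> d \<rho> f}"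
  then have f: "f \<in> X" "f \<in> A" "universal \<Omega> S N \<mu> d \<rho> f" using X_subset_A by auto
  show "f \<in> \<Inter>(residual (\<lambda>_. \<mu>))"
    unfolding mem_Inter_residual
  proof (intro allI ballI)
    fix m q s assume "q \<in> Q"
    then have "q \<in> holo_near (cprod (KK m))" using Q_polynomials polynomials_holo_near by blast
    then obtain \<nu> where "\<nu> \<subseteq> \<mu>" "infinite \<nu>" "converges_along (cprod (KK m)) q f \<nu>"
      using f(3)[unfolded universal_iff[OF f(2)]] KK_adm[of m] by blast
    then show "f \<in> approximants \<mu> (cprod (KK m)) q s"
      using converges_along_imp_approximants[OF f(1)] by blast
  qed
next
  fix f assume f: "f \<in> \<Inter>(residual (\<lambda>_. \<mu>))"
  then have fX: "f \<in> X" using Inter_residual_subset_X by blast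
  then have fA: "f \<in> A" using X_subset_A by blast
  have "universal \<Omega> S N \<mu> d \<rho> f"
    unfolding universal_iff[OF fA]
  proof (intro allI impI ballI)
    fix K h assume K: "adm K" and h: "h \<in> holo_near (cprod K)"
    obtain m where m: "\<And>i. K i \<subseteq> KK m i" using KK_exhaust[OF K] by blast
    show "\<exists>\<nu>\<subseteq>\<mu>. infinite \<nu> \<and> converges_along (cprod K) h f \<nu>"
      by (rule approximants_imp_converges_along[OF K m h]) (use f in \<open>unfold mem_Inter_residual, blast\<close>)
  qed
  then show "f \<in> {f \<in> X. universal \<Omega> S N \<mu> d \<rho> f}" using fX by blast
qed


section \<open>Construction of the dense subspace\<close>

lemma dense_metric:
  assumes "XT closure_of U = X" "f \<in> X" "\<epsilon> > 0"
  obtains g where "g \<in> U" "d f g < \<epsilon>"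
proof -
  have "f \<in> MA.mtopology closure_of U"
    using assms(1,2) closure_of_subtopology_subset[of "A_inf_topology \<Omega> S" X U]
    unfolding X_inf_topology_def A_topology by blast
  then obtain g where "g \<in> U" "g \<in> MA.mball f \<epsilon>"
    using assms(3) unfolding MA.metric_closure_of by blast
  then show ?thesis using that by (simp add: MA.in_mball)
qed

lemma Q_dense_metric:
  assumes p: "p \<in> polynomials" and "\<epsilon> > 0"
  obtains q where "q \<in> Q" "d (restrict0 \<Omega> p) (restrict0 \<Omega> q) < \<epsilon>"
proof -
  obtain F r where F: "finite F" "F \<subseteq> A_inf_seminorms \<Omega> S" "r > 0"
    "\<forall>f\<in>A. \<forall>g\<in>A. (\<forall>p\<in>F. p (f - g) < ennreal r) \<longrightarrow> d f g < \<epsilon>"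
    using M.seminorm_imp_metric[OF \<open>\<epsilon> > 0\<close>] by blast
  obtain L B where L: "compact L" "L \<subseteq> T" "finite B"
    "\<forall>p\<in>F. \<exists>L0 a. p = (\<lambda>f. sup_on L0 (ext a f)) \<and> L0 \<subseteq> L \<and> a \<in> B"
    using finite_seminorms[OF F(1,2)] by blast
  have "r/2 > 0" using F(3) by simp
  then obtain q where q: "q \<in> Q" "\<forall>a\<in>B. \<forall>z\<in>L. cmod (mixed_deriv a q z - mixed_deriv a p z) < r/2"
    using Q_dense[OF p L(1,3)] by blast
  have qp: "q \<in> polynomials" using q(1) Q_polynomials by blast
  have A: "restrict0 \<Omega> p \<in> A" "restrict0 \<Omega> q \<in> A" using p qp restrict0_polynomial by auto
  have "t (restrict0 \<Omega> p - restrict0 \<Omega> q) < ennreal r" if t: "t \<in> F" for t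
  proof -
    obtain L0 a where La: "t = (\<lambda>f. sup_on L0 (ext a f))" "L0 \<subseteq> L" "a \<in> B" using L(4) t by blast
    show ?thesis
      unfolding La(1)
    proof (rule sup_on_less[where s = "r/2"])
      fix z assume "z \<in> L0"
      then have z: "z \<in> L" using La(2) by blast
      then have zT: "z \<in> T" using L(2) by blast
      have "cmod (mixed_deriv a q z - mixed_deriv a p z) < r/2" using q(2) La(3) z by blast
      then show "cmod (ext a (restrict0 \<Omega> p - restrict0 \<Omega> q) z) \<le> r/2"
        by (simp add: ext_diff[OF A zT] ext_polynomial[OF p zT] ext_polynomial[OF qp zT] norm_minus_commute)
    qed (use F(3) in auto)
  qed
  then have "d (restrict0 \<Omega> p) (restrict0 \<Omega> q) < \<epsilon>" using F(4) A by blast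
  then show ?thesis using that q(1) by blast
qed

lemma zero_holo_near: "0 \<in> holo_near K"
  using polynomials_holo_near[OF polynomials_const[of 0]] by (simp add: zero_fun_def)

text \<open>Partial sums of \<open>f\<close> are steered towards \<open>inverse c * h\<close>, so
  that those of the multiple tend to \<open>h\<close>. As \<open>w\<close> contributes 0 on
  \<open>KK m\<close> along every subset of \<open>\<nu> m\<close>, the indices found for
  \<open>f\<close> serve the sum.\<close>

lemma universal_add:
  assumes c: "c \<noteq> 0" and f: "f \<in> \<Inter>(residual \<nu>)" and \<nu>: "\<And>m. \<nu> m \<subseteq> \<mu>"
    and w: "w \<in> X" "\<And>m. converges_along (cprod (KK m)) 0 w (\<nu> m)"
  shows "universal \<Omega> S N \<mu> d \<rho> (\<lambda>z. c * f z + w z)"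
proof -
  have fA: "f \<in> A" using f Inter_residual_subset_X X_subset_A by blast
  have cfA: "(\<lambda>z. c * f z) \<in> A" using fA by (rule A_cmult)
  have wA: "w \<in> A" using w(1) X_subset_A by blast
  have eq: "(\<lambda>z. c * f z + w z) = (\<lambda>z. c * f z) + w" by (simp add: fun_eq_iff)
  have "(\<lambda>z. c * f z) + w \<in> A" using cfA wA by (rule A_add)
  then show ?thesis
    unfolding eq
  proof (subst universal_iff, assumption, intro allI impI ballI)
    fix K h assume K: "adm K" and h: "h \<in> holo_near (cprod K)"
    obtain m where m: "\<And>i. K i \<subseteq> KK m i" using KK_exhaust[OF K] by blast
    have h': "(\<lambda>z. inverse c * h z) \<in> holo_near (cprod K)" using h by (rule holo_near_cmult)
    have fm: "f \<in> approximants (\<nu> m) (cprod (KK m)) q s" if "q \<in> Q" for q s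
      using f that unfolding mem_Inter_residual by blast
    obtain \<nu>' where \<nu>': "\<nu>' \<subseteq> \<nu> m" "infinite \<nu>'" "converges_along (cprod K) (\<lambda>z. inverse c * h z) f \<nu>'"
      using approximants_imp_converges_along[OF K m h' fm] by blast
    have 1: "converges_along (cprod K) (\<lambda>z. c * (inverse c * h z)) (\<lambda>z. c * f z) \<nu>'"
      by (rule converges_along_cmult[OF \<nu>'(3) fA h'])
    have 2: "converges_along (cprod K) 0 w \<nu>'"
      by (rule converges_along_mono[OF w(2)[of m] cprod_mono[of K "KK m", OF m] \<nu>'(1)])
    have "(\<lambda>z. c * (inverse c * h z)) \<in> holo_near (cprod K)" using h' by (rule holo_near_cmult)
    then have "converges_along (cprod K) ((\<lambda>z. c * (inverse c * h z)) + 0) ((\<lambda>z. c * f z) + w) \<nu>'"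
      by (rule converges_along_add[OF 1 2 cfA wA _ zero_holo_near])
    moreover have "(\<lambda>z. c * (inverse c * h z)) + 0 = h" using c by (simp add: fun_eq_iff)
    ultimately show "\<exists>\<nu>\<subseteq>\<mu>. infinite \<nu> \<and> converges_along (cprod K) h ((\<lambda>z. c * f z) + w) \<nu>"
      using \<nu>'(1,2) \<nu>[of m] by (intro exI[of _ \<nu>']) auto
  qed
qed

text \<open>At each stage Baire's theorem provides a function that is universal along the current
  index sets and close to a prescribed polynomial. Universality with target 0 then yields infinite
  subsets of these index sets, and the next stage starts from them.\<close>

lemma universal_chain:
  assumes "infinite \<mu>"
  obtains \<nu> :: "nat \<Rightarrow> nat \<Rightarrow> nat set" and F :: "nat \<Rightarrow> complex ^ 'n \<Rightarrow> complex" where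
    "\<And>j m. \<nu> j m \<subseteq> \<mu>" "\<And>j. F j \<in> \<Inter>(residual (\<nu> j))" "\<And>j m. \<nu> (Suc j) m \<subseteq> \<nu> j m"
    "\<And>j m. converges_along (cprod (KK m)) 0 (F j) (\<nu> (Suc j) m)"
    "\<And>p \<epsilon>. p \<in> polynomials \<Longrightarrow> \<epsilon> > 0 \<Longrightarrow> \<exists>j. d (restrict0 \<Omega> p) (F j) < \<epsilon>"
proof -
  \<comment> \<open>Enumerates pairs of a target and a precision, so each polynomial of
    \<open>Q\<close> is approached to every accuracy by some \<open>F j\<close>.\<close>
  define t where "t = from_nat_into (Q \<times> (UNIV :: nat set))"
  have t: "range t = Q \<times> UNIV"
    unfolding t_def using Q_nonempty Q_countable by (intro range_from_nat_into) auto
  define P where "P (n::nat) \<nu> \<longleftrightarrow> (\<forall>m. infinite (\<nu> m) \<and> \<nu> m \<subseteq> \<mu>)" for n and \<nu> :: "nat \<Rightarrow> nat set"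
  \<comment> \<open>Dependent choice runs over the index sets alone; the function of each stage
    stays hidden in the relation and is picked afterwards.\<close>
  define R where "R j \<nu> \<nu>' \<longleftrightarrow> (\<exists>f. f \<in> \<Inter>(residual \<nu>) \<and> d (restrict0 \<Omega> (fst (t j))) f < 1 / real (Suc (snd (t j))) \<and>
      (\<forall>m. \<nu>' m \<subseteq> \<nu> m \<and> converges_along (cprod (KK m)) 0 f (\<nu>' m)))" for j \<nu> \<nu>'
  have "\<exists>\<nu>. \<forall>n. P n (\<nu> n) \<and> R n (\<nu> n) (\<nu> (Suc n))"
  proof (rule dependent_nat_choice)
    show "\<exists>\<nu>. P 0 \<nu>" unfolding P_def using assms by (intro exI[of _ "\<lambda>_. \<mu>"]) simp
    fix \<nu> j assume P: "P j \<nu>"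
    have "t j \<in> Q \<times> UNIV" using t by blast
    then have "fst (t j) \<in> polynomials" using Q_polynomials by auto
    then have "restrict0 \<Omega> (fst (t j)) \<in> X" by (rule polynomial_in_X)
    moreover have "XT closure_of (\<Inter>(residual \<nu>)) = X" using P unfolding P_def by (intro residual_dense) blast
    moreover have "1 / real (Suc (snd (t j))) > 0" by simp
    ultimately obtain f where f: "f \<in> \<Inter>(residual \<nu>)" "d (restrict0 \<Omega> (fst (t j))) f < 1 / real (Suc (snd (t j)))"
      using dense_metric by metis
    have "\<exists>\<nu>'\<subseteq>\<nu> m. infinite \<nu>' \<and> converges_along (cprod (KK m)) 0 f \<nu>'" for m
    proof (rule approximants_imp_converges_along[OF KK_adm subset_refl zero_holo_near])
      show "f \<in> approximants (\<nu> m) (cprod (KK m)) q s" if "q \<in> Q" for q s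
        using f(1) that unfolding mem_Inter_residual by blast
    qed
    then obtain \<nu>' where \<nu>': "\<And>m. \<nu>' m \<subseteq> \<nu> m \<and> infinite (\<nu>' m) \<and> converges_along (cprod (KK m)) 0 f (\<nu>' m)"
      by metis
    have "P (Suc j) \<nu>'" unfolding P_def using \<nu>' P unfolding P_def by (meson subset_trans)
    moreover have "R j \<nu> \<nu>'" unfolding R_def using f \<nu>' by blast
    ultimately show "\<exists>\<nu>'. P (Suc j) \<nu>' \<and> R j \<nu> \<nu>'" by blast
  qed
  then obtain \<nu> where \<nu>: "\<And>n. P n (\<nu> n)" "\<And>n. R n (\<nu> n) (\<nu> (Suc n))" by blast
  obtain F where F: "\<And>j. F j \<in> \<Inter>(residual (\<nu> j)) \<and> d (restrict0 \<Omega> (fst (t j))) (F j) < 1 / real (Suc (snd (t j))) \<and>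
      (\<forall>m. \<nu> (Suc j) m \<subseteq> \<nu> j m \<and> converges_along (cprod (KK m)) 0 (F j) (\<nu> (Suc j) m))"
    using \<nu>(2) unfolding R_def by metis
  show ?thesis
  proof (rule that)
    show "\<nu> j m \<subseteq> \<mu>" for j m using \<nu>(1) unfolding P_def by blast
    show "F j \<in> \<Inter>(residual (\<nu> j))" for j by (rule conjunct1[OF F])
    show "\<nu> (Suc j) m \<subseteq> \<nu> j m" "converges_along (cprod (KK m)) 0 (F j) (\<nu> (Suc j) m)" for j m
      using conjunct2[OF conjunct2[OF F[of j]]] by (simp_all only:)
    fix p :: "complex ^ 'n \<Rightarrow> complex" and \<epsilon> :: real assume p: "p \<in> polynomials" and "\<epsilon> > 0"
    then have e2: "\<epsilon>/2 > 0" by simp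
    obtain q where q: "q \<in> Q" "d (restrict0 \<Omega> p) (restrict0 \<Omega> q) < \<epsilon>/2" using Q_dense_metric[OF p e2] by blast
    obtain k where k: "1 / real (Suc k) < \<epsilon>/2" using nat_approx_posE[OF e2] by blast
    have "(q, k) \<in> range t" unfolding t using q(1) by simp
    then obtain j where j: "t j = (q, k)" by (metis imageE)
    have Fj: "d (restrict0 \<Omega> q) (F j) < 1 / real (Suc k)" using conjunct1[OF conjunct2[OF F[of j]]] j by simp
    have "F j \<in> A" using conjunct1[OF F[of j]] Inter_residual_subset_X X_subset_A by blast
    moreover have "restrict0 \<Omega> p \<in> A" "restrict0 \<Omega> q \<in> A"
      using p q(1) Q_polynomials restrict0_polynomial by auto
    ultimately have "d (restrict0 \<Omega> p) (F j) \<le> d (restrict0 \<Omega> p) (restrict0 \<Omega> q) + d (restrict0 \<Omega> q) (F j)"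
      by (intro MA.triangle)
    then have "d (restrict0 \<Omega> p) (F j) < \<epsilon>" using q(2) k Fj by linarith
    then show "\<exists>j. d (restrict0 \<Omega> p) (F j) < \<epsilon>" by blast
  qed
qed

text \<open>The invariant is that every element of \<open>W k\<close> has partial sums tending to 0
  on \<open>KK m\<close> along \<open>\<nu> k m\<close>, while \<open>F k\<close> is still universal
  along these very sets. Adding a nonzero multiple of \<open>F k\<close> thus produces a universal
  function, and adding any multiple restores the invariant along
  \<open>\<nu> (Suc k) m\<close>.\<close>

lemma dense_universal_subspace:
  assumes "infinite \<mu>"
  shows "\<exists>V. V \<subseteq> {f \<in> X. universal \<Omega> S N \<mu> d \<rho> f} \<union> {0} \<and>
    module.subspace (\<lambda>(c::complex) f z. c * f z) V \<and> XT closure_of V = X"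
proof (rule universal_chain[OF assms])
  fix \<nu> F
  assume \<nu>: "\<And>j m. \<nu> j m \<subseteq> \<mu>" and F1: "\<And>j. F j \<in> \<Inter>(residual (\<nu> j))"
    and \<nu>2: "\<And>j m. \<nu> (Suc j) m \<subseteq> \<nu> j m"
    and F: "\<And>j m. converges_along (cprod (KK m)) 0 (F j) (\<nu> (Suc j) m)"
    "\<And>p \<epsilon>. p \<in> polynomials \<Longrightarrow> \<epsilon> > 0 \<Longrightarrow> \<exists>j. d (restrict0 \<Omega> p) (F j) < \<epsilon>"
  have FX: "F j \<in> X" for j using F1 Inter_residual_subset_X by blast
  have FA: "F j \<in> A" for j using FX X_subset_A by blast
  \<comment> \<open>The span of the first \<open>k\<close> functions, built so that the coefficient
    of the last one is exposed to the induction.\<close>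
  define W where "W = rec_nat {0} (\<lambda>k Wk. {\<lambda>z. c * F k z + w z | c w. w \<in> Wk})"
  have W0: "W 0 = {0}" and WS: "W (Suc k) = {\<lambda>z. c * F k z + w z | c w. w \<in> W k}" for k
    by (simp_all add: W_def)
  have zero_conv: "converges_along K 0 0 \<nu>'" for K \<nu>'
  proof (rule converges_alongI)
    fix L :: "(complex ^ 'n) set" and a :: "nat ^ 'n" and \<epsilon> :: real assume L: "compact L" "L \<subseteq> T" "\<epsilon> > 0"
    have e0: "ext b 0 z = 0" if "z \<in> T" for b z
      using ext_cmult[OF A_zero that, of b 0] by (simp add: zero_fun_def)
    have "mixed_deriv a (PS n 0 \<zeta>) z = 0" if "\<zeta> \<in> T" for n \<zeta> z
      unfolding mixed_deriv_PS taylor_coeff_def e0[OF that] by simp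
    then show "\<exists>n0. \<forall>n\<in>\<nu>'. n \<ge> n0 \<longrightarrow> (\<forall>\<zeta>\<in>L. (\<forall>z\<in>K. cmod (mixed_deriv a (PS n 0 \<zeta>) z - mixed_deriv a 0 z) < \<epsilon>) \<and>
           (\<forall>z\<in>L. cmod (mixed_deriv a (PS n 0 \<zeta>) z - ext a 0 z) < \<epsilon>))"
      using L e0 by (simp add: mixed_deriv_zero subset_iff)
  qed
  have inv: "w \<in> X \<and> (\<forall>m. converges_along (cprod (KK m)) 0 w (\<nu> k m)) \<and> (w = 0 \<or> universal \<Omega> S N \<mu> d \<rho> w)"
    if "w \<in> W k" for w k
    using that
  proof (induction k arbitrary: w)
    case 0
    then have w: "w = 0" unfolding W0 by (rule singletonD)
    show ?case unfolding w using zero_in_X zero_conv by blast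
  next
    case (Suc k)
    then obtain c v where w: "w = (\<lambda>z. c * F k z + v z)" "v \<in> W k" unfolding WS by blast
    note v = Suc.IH[OF w(2)]
    have cFX: "(\<lambda>z. c * F k z) \<in> X" by (rule X_cmult[OF FX])
    have eq: "w = (\<lambda>z. c * F k z) + v" by (simp add: w(1) fun_eq_iff)
    have wX: "w \<in> X" unfolding eq using cFX v by (intro X_add) blast+
    have conv: "converges_along (cprod (KK m)) 0 w (\<nu> (Suc k) m)" for m
    proof -
      have "converges_along (cprod (KK m)) (\<lambda>z. c * 0 z) (\<lambda>z. c * F k z) (\<nu> (Suc k) m)"
        by (rule converges_along_cmult[OF F(1) FA zero_holo_near])
      moreover have "(\<lambda>z. c * 0 z) = (0 :: complex ^ 'n \<Rightarrow> complex)" by (simp add: fun_eq_iff)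
      ultimately have 1: "converges_along (cprod (KK m)) 0 (\<lambda>z. c * F k z) (\<nu> (Suc k) m)" by simp
      have "converges_along (cprod (KK m)) 0 v (\<nu> k m)" using v by blast
      then have 2: "converges_along (cprod (KK m)) 0 v (\<nu> (Suc k) m)"
        by (rule converges_along_mono[OF _ subset_refl \<nu>2])
      have "converges_along (cprod (KK m)) (0 + 0) ((\<lambda>z. c * F k z) + v) (\<nu> (Suc k) m)"
        by (rule converges_along_add[OF 1 2 _ _ zero_holo_near zero_holo_near])
          (use cFX v X_subset_A in blast)+
      then show ?thesis unfolding eq by simp
    qed
    have "w = 0 \<or> universal \<Omega> S N \<mu> d \<rho> w"
    proof (cases "c = 0")
      case True
      then have "w = v" by (simp add: w(1))
      then show ?thesis using v by blast
    next
      case False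
      have "universal \<Omega> S N \<mu> d \<rho> (\<lambda>z. c * F k z + v z)"
        by (rule universal_add[OF False F1 \<nu>]) (use v in blast)+
      then show ?thesis unfolding w(1) by blast
    qed
    then show ?case using wX conv by blast
  qed
  have W_step: "(\<lambda>z. c * F k z + w z) \<in> W (Suc k)" if "w \<in> W k" for c w k
    unfolding WS using that by blast
  have W_Suc: "W k \<subseteq> W (Suc k)" for k
  proof
    fix w assume "w \<in> W k"
    moreover have "w = (\<lambda>z. 0 * F k z + w z)" by simp
    ultimately show "w \<in> W (Suc k)" unfolding WS by blast
  qed
  have W_mono: "W k \<subseteq> W l" if "k \<le> l" for k l
    using W_Suc that by (rule lift_Suc_mono_le)
  have W_add: "v + w \<in> W k" if "v \<in> W k" "w \<in> W k" for v w k
    using that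
  proof (induction k arbitrary: v w)
    case 0
    then show ?case by (simp add: W0 fun_eq_iff)
  next
    case (Suc k)
    obtain c v' where v: "v = (\<lambda>z. c * F k z + v' z)" "v' \<in> W k" using Suc.prems(1) unfolding WS by blast
    obtain b w' where w: "w = (\<lambda>z. b * F k z + w' z)" "w' \<in> W k" using Suc.prems(2) unfolding WS by blast
    have "v + w = (\<lambda>z. (c + b) * F k z + (v' + w') z)"
      by (simp add: v(1) w(1) fun_eq_iff algebra_simps)
    then show ?case unfolding WS using Suc.IH[OF v(2) w(2)] by blast
  qed
  have W_cmult: "(\<lambda>z. b * w z) \<in> W k" if "w \<in> W k" for w k b
    using that
  proof (induction k arbitrary: w)
    case 0
    then show ?case by (simp add: W0 fun_eq_iff)
  next
    case (Suc k)
    obtain c w' where w: "w = (\<lambda>z. c * F k z + w' z)" "w' \<in> W k" using Suc.prems unfolding WS by blast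
    have eq: "(\<lambda>z. b * w z) = (\<lambda>z. (b * c) * F k z + b * w' z)"
      by (simp add: w(1) fun_eq_iff algebra_simps)
    show ?case unfolding eq by (rule W_step) (rule Suc.IH[OF w(2)])
  qed
  define V where "V = (\<Union>k. W k)"
  interpret md: module "\<lambda>(c::complex) (f :: complex ^ 'n \<Rightarrow> complex) z. c * f z"
    by unfold_locales (simp_all add: fun_eq_iff algebra_simps)
  have "module.subspace (\<lambda>(c::complex) f z. c * f z) V"
    unfolding md.subspace_def
  proof (intro conjI ballI allI)
    show "0 \<in> V" unfolding V_def using W0 by blast
    fix v assume "v \<in> V"
    then obtain k where k: "v \<in> W k" unfolding V_def by blast
    show "(\<lambda>z. c * v z) \<in> V" for c unfolding V_def using W_cmult[OF k] by blast
    fix w assume "w \<in> V"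
    then obtain l where l: "w \<in> W l" unfolding V_def by blast
    have "v \<in> W (max k l)" using W_mono[of k "max k l"] k by auto
    moreover have "w \<in> W (max k l)" using W_mono[of l "max k l"] l by auto
    ultimately have "v + w \<in> W (max k l)" by (rule W_add)
    then show "v + w \<in> V" unfolding V_def by blast
  qed
  moreover have "V \<subseteq> {f \<in> X. universal \<Omega> S N \<mu> d \<rho> f} \<union> {0}"
    unfolding V_def using inv by blast
  moreover have "XT closure_of V = X"
  proof (rule dense_in_X)
    show "V \<subseteq> X" unfolding V_def using inv by blast
    fix p :: "complex ^ 'n \<Rightarrow> complex" and \<epsilon> :: real assume "p \<in> polynomials" "\<epsilon> > 0"
    then obtain j where j: "d (restrict0 \<Omega> p) (F j) < \<epsilon>" using F(2) by blast
    have "0 \<in> W j" using W_mono[of 0 j] W0 by auto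
    moreover have "F j = (\<lambda>z. 1 * F j z + 0 z)" by simp
    ultimately have "F j \<in> W (Suc j)" unfolding WS by blast
    then show "\<exists>g\<in>V. d (restrict0 \<Omega> p) g < \<epsilon>" unfolding V_def using j by blast
  qed
  ultimately show ?thesis by blast
qed

lemma universal_results:
  assumes "infinite \<mu>"
  shows "(\<exists>f\<in>A. universal \<Omega> S N \<mu> d \<rho> f) \<and>
    gdelta_in XT {f \<in> X. universal \<Omega> S N \<mu> d \<rho> f} \<and>
    XT closure_of {f \<in> X. universal \<Omega> S N \<mu> d \<rho> f} = X \<and>
    (\<exists>V. V \<subseteq> {f \<in> X. universal \<Omega> S N \<mu> d \<rho> f} \<union> {0} \<and>
      module.subspace (\<lambda>(c::complex) f z. c * f z) V \<and> XT closure_of V = X)"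
proof (intro conjI dense_universal_subspace[OF assms])
  show "gdelta_in XT {f \<in> X. universal \<Omega> S N \<mu> d \<rho> f}"
    unfolding universal_eq_residual
    by (rule gdelta_in_Inter[OF residual_props(1,2)]) (rule open_imp_gdelta_in[OF residual_props(3)])
  show dense: "XT closure_of {f \<in> X. universal \<Omega> S N \<mu> d \<rho> f} = X"
    unfolding universal_eq_residual by (rule residual_dense) (rule assms)
  \<comment> \<open>Existence is read off density: some universal function lies within distance 1 of
    \<open>0 \<in> X\<close>.\<close>
  obtain f where "f \<in> {f \<in> X. universal \<Omega> S N \<mu> d \<rho> f}"
    using dense_metric[OF dense zero_in_X zero_less_one] by blast
  then show "\<exists>f\<in>A. universal \<Omega> S N \<mu> d \<rho> f" using X_subset_A by blast
qed

end

section \<open>Exhausting the centres and the admissible products\<close>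

context smooth_domain
begin

text \<open>Relative openness of \<open>S i\<close> in the frontier makes \<open>T\<close> the
  intersection of a closed and an open product. A compact exhaustion of the open one, intersected
  with the closed one, stays compact and still catches every compact subset of
  \<open>T\<close>.\<close>

lemma T_exhaustion:
  "\<exists>Ls. (\<forall>s::nat. compact (Ls s) \<and> Ls s \<subseteq> T) \<and>
    (\<forall>L. compact L \<longrightarrow> L \<subseteq> T \<longrightarrow> (\<exists>s0. \<forall>s\<ge>s0. L \<subseteq> Ls s))"
proof -
  have "\<exists>V. open V \<and> S i = frontier (\<Omega> i) \<inter> V" for i
    using S_open[of i] by (simp add: openin_open)
  then obtain V where V: "\<And>i. open (V i)" "\<And>i. S i = frontier (\<Omega> i) \<inter> V i" by metis
  have factor: "\<Omega> i \<union> S i = closure (\<Omega> i) \<inter> (\<Omega> i \<union> V i)" for i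
    using closure_Un_frontier[of "\<Omega> i"] V(2)[of i] by blast
  have TO: "T = cprod (\<lambda>i. closure (\<Omega> i)) \<inter> cprod (\<lambda>i. \<Omega> i \<union> V i)"
    unfolding factor cprod_def by blast
  have op: "open (cprod (\<lambda>i. \<Omega> i \<union> V i))"
    by (intro open_cprod open_Un open_factor V(1))
  obtain C :: "nat \<Rightarrow> (complex ^ 'n) set" where C: "\<And>n. compact (C n)" "\<And>n. C n \<subseteq> cprod (\<lambda>i. \<Omega> i \<union> V i)"
    "\<And>K. \<lbrakk>compact K; K \<subseteq> cprod (\<lambda>i. \<Omega> i \<union> V i)\<rbrakk> \<Longrightarrow> \<exists>N. \<forall>n\<ge>N. K \<subseteq> C n"
    using open_Union_compact_subsets[OF op] by metis
  have cl: "closed (cprod (\<lambda>i. closure (\<Omega> i)))" by (rule closed_cprod) simp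
  show ?thesis
  proof (rule exI[of _ "\<lambda>s. cprod (\<lambda>i. closure (\<Omega> i)) \<inter> C s"], intro conjI allI impI)
    show "compact (cprod (\<lambda>i. closure (\<Omega> i)) \<inter> C s)" for s using cl C(1) by (rule closed_Int_compact)
    show "cprod (\<lambda>i. closure (\<Omega> i)) \<inter> C s \<subseteq> T" for s unfolding TO using C(2) by blast
    fix L assume L: "compact L" "L \<subseteq> T"
    obtain s0 where "\<forall>s\<ge>s0. L \<subseteq> C s" using C(3)[OF L(1)] L(2) unfolding TO by blast
    then show "\<exists>s0. \<forall>s\<ge>s0. L \<subseteq> cprod (\<lambda>i. closure (\<Omega> i)) \<inter> C s" using L(2) unfolding TO by blast
  qed
qed

end

context taylor_setting
begin

text \<open>Only one coordinate has to avoid the domain: there a member of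
  \<open>planar_exhaustion\<close> is used, and discs of natural radius in all others. The choices
  of coordinate, planar set and radius are countable in number.\<close>

lemma adm_exhaustion: "\<exists>KK :: nat \<Rightarrow> 'n \<Rightarrow> complex set. (\<forall>m. adm (KK m)) \<and> (\<forall>K. adm K \<longrightarrow> (\<exists>m. \<forall>i. K i \<subseteq> KK m i))"
proof -
  define good where "good i \<C> \<longleftrightarrow> countable \<C> \<and> (\<forall>C\<in>\<C>. compact C \<and> connected (- C) \<and> C \<inter> (\<Omega> i \<union> closure (S i)) = {}) \<and>
    (\<forall>K. compact K \<longrightarrow> connected (- K) \<longrightarrow> K \<inter> (\<Omega> i \<union> closure (S i)) = {} \<longrightarrow> (\<exists>C\<in>\<C>. K \<subseteq> C))" for i \<C>
  have "\<exists>\<C>. good i \<C>" for i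
    unfolding good_def by (rule planar_exhaustion[OF open_factor connected_factor nonempty_factor])
  then obtain \<C> where \<C>: "\<And>i. good i (\<C> i)" by metis
  define k where "k = (\<lambda>(i0 :: 'n, C, R) i. if i = i0 then C else cball (0::complex) (real (R::nat)))"
  define \<K> where "\<K> = k ` (SIGMA i0:UNIV. \<C> i0 \<times> UNIV)"
  have "countable \<K>"
    unfolding \<K>_def using \<C> unfolding good_def by (intro countable_image countable_SIGMA) auto
  moreover have adm: "adm K" if K\<K>: "K \<in> \<K>" for K
  proof -
    obtain i0 C R where K: "K = k (i0, C, R)" "C \<in> \<C> i0" using K\<K> unfolding \<K>_def by auto
    have C: "compact C" "connected (- C)" "C \<inter> (\<Omega> i0 \<union> closure (S i0)) = {}"
      using \<C>[of i0] K(2) unfolding good_def by auto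
    have "connected (- cball (0::complex) r)" for r
      by (intro path_connected_imp_connected path_connected_complement_bounded_convex) auto
    then have "compact (K i) \<and> connected (- K i)" for i using C by (simp add: K(1) k_def)
    moreover have "cprod K \<inter> cprod (\<lambda>i. \<Omega> i \<union> closure (S i)) = {}"
    proof -
      have "z $ i0 \<in> C" if "z \<in> cprod K" for z
      proof -
        have "z $ i0 \<in> K i0" using that unfolding cprod_def by blast
        then show ?thesis by (simp add: K(1) k_def)
      qed
      moreover have "z $ i0 \<in> \<Omega> i0 \<union> closure (S i0)" if "z \<in> cprod (\<lambda>i. \<Omega> i \<union> closure (S i))" for z
        using that unfolding cprod_def by blast
      ultimately show ?thesis using C(3) by blast
    qed
    ultimately show ?thesis unfolding adm_def by blast
  qed
  moreover have sup: "\<exists>K'\<in>\<K>. \<forall>i. K i \<subseteq> K' i" if K: "adm K" for K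
  proof -
    obtain i0 where i0: "K i0 \<inter> (\<Omega> i0 \<union> closure (S i0)) = {}" using adm_factor[OF K] by blast
    have Kc: "compact (K i)" "connected (- K i)" for i using K unfolding adm_def by auto
    obtain C where C: "C \<in> \<C> i0" "K i0 \<subseteq> C"
      using \<C>[of i0] Kc[of i0] i0 unfolding good_def by blast
    have "bounded (\<Union>i. K i)" using Kc(1) compact_imp_bounded by (intro bounded_UN) auto
    then obtain r where r: "(\<Union>i. K i) \<subseteq> ball 0 r" using bounded_subset_ballD by blast
    obtain R :: nat where R: "r \<le> real R" using real_arch_simple by blast
    have "K i \<subseteq> k (i0, C, R) i" for i
    proof (cases "i = i0")
      case False
      have "K i \<subseteq> cball 0 r" using r ball_subset_cball by blast
      also have "\<dots> \<subseteq> cball 0 (real R)" using R by (rule subset_cball)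
      finally show ?thesis using False by (simp add: k_def)
    qed (use C in \<open>simp add: k_def\<close>)
    moreover have "k (i0, C, R) \<in> \<K>" unfolding \<K>_def using C(1) by (intro imageI) simp
    ultimately show ?thesis by blast
  qed
  moreover have "\<K> \<noteq> {}"
  proof -
    \<comment> \<open>The product of empty sets is admissible, so the family is nonempty and
      \<open>from_nat_into\<close> enumerates it.\<close>
    have "adm (\<lambda>_. {})" unfolding adm_def cprod_def by (simp add: connected_UNIV)
    then show ?thesis using sup by blast
  qed
  ultimately have "range (from_nat_into \<K>) = \<K>" by (intro range_from_nat_into) auto
  then show ?thesis
    by (intro exI[of _ "from_nat_into \<K>"]) (metis adm sup rangeE rangeI)
qed

end

theorem theorem3p9:
  fixes \<Omega> S :: "'n::finite \<Rightarrow> complex set"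
    and N :: "nat \<Rightarrow> nat ^ 'n"
    and \<mu> :: "nat set"
    and d :: "(complex ^ 'n \<Rightarrow> complex) \<Rightarrow> (complex ^ 'n \<Rightarrow> complex) \<Rightarrow> real"
    and \<rho> :: "(complex ^ 'n) set \<Rightarrow> (complex ^ 'n \<Rightarrow> complex) set \<Rightarrow> (complex ^ 'n \<Rightarrow> complex) set \<Rightarrow> real"
  assumes "\<And>i. open (\<Omega> i)" and "\<And>i. connected (\<Omega> i)" and "\<And>i. \<Omega> i \<noteq> {}"
    and "\<And>i. simply_connected (\<Omega> i)" and "\<And>i. \<Omega> i \<noteq> UNIV"
    and "\<And>i. openin (top_of_set (frontier (\<Omega> i))) (S i)"
    and "\<And>i. connected (- (\<Omega> i \<union> S i))"
    and "\<And>i. bounded (- (\<Omega> i \<union> S i)) \<Longrightarrow> \<Omega> i \<union> closure (S i) = UNIV"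
    and "bij N"
    and "infinite \<mu>"
    and "A_inf_metric \<Omega> S d"
    and "\<And>K. compact K \<Longrightarrow> O_metric K (\<rho> K)"
  shows "(\<exists>f\<in>A_inf \<Omega> S. universal \<Omega> S N \<mu> d \<rho> f) \<and>
    gdelta_in (X_inf_topology \<Omega> S) {f \<in> X_inf \<Omega> S. universal \<Omega> S N \<mu> d \<rho> f} \<and>
    X_inf_topology \<Omega> S closure_of {f \<in> X_inf \<Omega> S. universal \<Omega> S N \<mu> d \<rho> f} = X_inf \<Omega> S \<and>
    (\<exists>V. V \<subseteq> {f \<in> X_inf \<Omega> S. universal \<Omega> S N \<mu> d \<rho> f} \<union> {0} \<and>
      module.subspace (\<lambda>(c::complex) f z. c * f z) V \<and>
      X_inf_topology \<Omega> S closure_of V = X_inf \<Omega> S)"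
proof -
  interpret taylor_setting \<Omega> S N d \<rho>
    by unfold_locales (fact assms)+
  obtain Ls where Ls: "\<And>s::nat. compact (Ls s) \<and> Ls s \<subseteq> T"
    "\<And>L. compact L \<Longrightarrow> L \<subseteq> T \<Longrightarrow> \<exists>s0. \<forall>s\<ge>s0. L \<subseteq> Ls s"
    using T_exhaustion by blast
  obtain KK where KK: "\<And>m::nat. adm (KK m)" "\<And>K. adm K \<Longrightarrow> \<exists>m. \<forall>i. K i \<subseteq> KK m i"
    using adm_exhaustion by blast
  obtain Q :: "(complex ^ 'n \<Rightarrow> complex) set" where Q: "countable Q" "Q \<noteq> {}" "Q \<subseteq> polynomials"
    "\<forall>p\<in>polynomials. \<forall>K B \<epsilon>. compact K \<longrightarrow> finite B \<longrightarrow> \<epsilon> > 0 \<longrightarrow>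
      (\<exists>q\<in>Q. \<forall>a\<in>B. \<forall>z\<in>K. cmod (mixed_deriv a q z - mixed_deriv a p z) < \<epsilon>)"
    using countable_dense_polynomials by blast
  interpret universal_setting \<Omega> S N d \<rho> Ls Q KK
  proof
    show "compact (Ls s)" "Ls s \<subseteq> T" for s using Ls(1)[of s] by simp_all
    show "\<exists>q\<in>Q. \<forall>a\<in>B. \<forall>z\<in>K. cmod (mixed_deriv a q z - mixed_deriv a p z) < \<epsilon>"
      if "p \<in> polynomials" "compact K" "finite B" "\<epsilon> > 0" for p K B \<epsilon>
      by (rule Q(4)[rule_format, OF that])
  qed (fact Ls(2) Q(1-3) KK)+
  show ?thesis by (rule universal_results) (fact assms)
qed

end
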